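(* Let $0<\gamma<1$, let $T\ge R_0^2/\nu$, and suppose that $\sigma_0< c\,\gamma\,R_0$ with $c=1/\sqrt{C_0K_1K_2}$. Let $R$ and $R_2$ both lie in the range $\left[\frac{1}{c\gamma}\sigma_0,\,R_0\right]$. Let $\tilde\Psi_R$ be computed with an optimal covering of $B(\mathbf 0,R_0)$ by balls of radius $R$, and $\tilde\Psi_{2R_2,R_2}$ with an optimal covering of $B(\mathbf 0,R_0)$ by shells $A(\mathbf x_i,2R_2,R_2)$. Then $$\frac{c_{0,\gamma}}{c_{1,\gamma}}\left(\frac{R_2}{R}\right)^2\le\frac{\tilde\Psi_{2R_2,R_2}}{\tilde\Psi_R}\le\frac{c_{1,\gamma}}{c_{0,\gamma}}\left(\frac{R_2}{R}\right)^2,$$ where $c_{0,\gamma}=\frac{1-\gamma^2}{K_1}$ and $c_{1,\gamma}=K_2\left[1+\frac{\gamma^2}{K_1K_2}\right]$. In particular, if $R_2=2^kR$ with $k$ an integer, then $$\frac{c_{0,\gamma}}{c_{1,\gamma}}\,2^{2k}\le\frac{\tilde\Psi_{2^{k+1}R,\,2^kR}}{\tilde\Psi_R}\le\frac{c_{1,\gamma}}{c_{0,\gamma}}\,2^{2k}.$$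
   Context: Solution. $\nu>0$; $\Omega\subset\mathbb{R}^2$ is a bounded open connected set; $R_0>0$ is such that $B(\mathbf 0,3R_0)\subset\Omega$. $B(\mathbf x,r)$ and $S(\mathbf x,r)$ are the ball and the sphere (circle) of center $\mathbf x$ and radius $r$ in $\mathbb{R}^2$; $A(\mathbf x,r_1,r_2)$ is the shell between $S(\mathbf x,r_2)$ and $S(\mathbf x,r_1)$, $r_2<r_1$. $(\mathbf u,p)$, $\mathbf u=(u_1,u_2)$, is a smooth solution on $(0,\infty)\times\Omega$ of $\partial_t\mathbf u-\nu\Delta\mathbf u+(\mathbf u\cdot\nabla)\mathbf u+\nabla p=0$, $\nabla\cdot\mathbf u=0$, with no-slip boundary condition $\mathbf u|_{\partial\Omega}=0$. The vorticity is the scalar $\omega=\partial_1u_2-\partial_2u_1$, which satisfies $\partial_t\omega-\nu\Delta\omega+(\mathbf u\cdot\nabla)\omega=0$. Cut-offs. $1/2\le\delta<1$ and $C_0>0$ are fixed constants; $\mathcal D(U)$ denotes the smooth functions with compact support in $U$. Quotients below are understood where the denominator is nonzero, and $\phi^{2\delta-1}$ is read as $0$ where $\phi=0$. - $\psi_0\in\mathcal D(B(\mathbf 0,2R_0))$, $0\le\psi_0\le1$, $\psi_0=1$ on $B(\mathbf 0,R_0)$, $|\nabla\psi_0|/\psi_0^{\delta}\le C_0/R_0$, $|\Delta\psi_0|/\psi_0^{2\delta-1}\le C_0/R_0^2$. - $\eta\in\mathcal D((0,2T))$, $0\le\eta\le1$, $\eta=1$ on $(T/4,5T/4)$, $|\eta'|/\eta^\delta\le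 C_0/T$. Put $\phi_0=\eta\psi_0$. - Balls. For $\mathbf x_0\in B(\mathbf 0,R_0)$ and $0<r\le R_0$: $\psi=\psi_{\mathbf x_0,r}$ is smooth with $0\le\psi\le\psi_0$, $\psi=1$ on $B(\mathbf x_0,r)\cap B(\mathbf 0,R_0)$, $|\nabla\psi|/\psi^\delta\le C_0/r$, $|\Delta\psi|/\psi^{2\delta-1}\le C_0/r^2$. If $B(\mathbf x_0,r)\subset B(\mathbf 0,R_0)$, then $\psi\in\mathcal D(B(\mathbf x_0,2r))$. If $B(\mathbf x_0,r)\not\subset B(\mathbf 0,R_0)$, then $\psi\in\mathcal D(B(\mathbf 0,2R_0))$ and additionally: $\psi=\psi_0$ on $\{s\mathbf y:\mathbf y\in S(\mathbf 0,R_0)\cap B(\mathbf x_0,r),\,1\le s\le2\}$; $\psi=0$ on $B(\mathbf 0,R_0)\setminus B(\mathbf x_0,2r)$; and $\psi=0$ at those points of $\{R_0\le|\mathbf x|\le2R_0\}$ that do not lie in $\{s\mathbf y:\mathbf y\in S(\mathbf 0,R_0)\cap B(\mathbf x_0,2r),\,1\le s\le2\}$. Put $\phi_{\mathbf x_0,r}=\eta\,\psi_{\mathbf x_0,r}$. - Shells. For $A(\mathbf x_i,2r,r)$ with $B(\mathbf x_i,r)\subset B(\mathbf 0,R_0)$: $\psi_i$ is smooth, $0\le\psi_i\le\psi_0$, $\psi_i=1$ on $A(\mathbf x_i,2r,r)\cap B(\mathbf 0,R_0)$, $|\nabla\psi_i|/\psi_i^\delta\le C_0/r$, $|\Delta\psi_i|/\psi_i^{2\delta-1}\le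 C_0/r^2$. If $A(\mathbf x_i,2r,r)\subset B(\mathbf 0,R_0)$, then $\psi_i\in\mathcal D(A(\mathbf x_i,4r,r/2))$. If $A(\mathbf x_i,2r,r)\not\subset B(\mathbf 0,R_0)$, then $\psi_i\in\mathcal D(B(\mathbf 0,2R_0))$ and additionally: $\psi_i=\psi_0$ on $\{s\mathbf y:\mathbf y\in S(\mathbf 0,R_0)\cap B(\mathbf x_i,2r),\,1\le s\le2\}$; $\psi_i=0$ on $B(\mathbf 0,R_0)\setminus A(\mathbf x_i,4r,r/2)$; and $\psi_i=0$ at those points of $\{R_0\le|\mathbf x|\le2R_0\}$ that do not lie in $\{s\mathbf y:\mathbf y\in S(\mathbf 0,R_0)\cap B(\mathbf x_i,4r),\,1\le s\le2\}$. Put $\phi_i=\eta\psi_i$. Optimal coverings. $K_1,K_2>1$ are absolute constants. A covering $\{B(\mathbf x_i,r)\}_{i=1}^n$ of $B(\mathbf 0,R_0)$, $\mathbf x_i\in B(\mathbf 0,R_0)$, is optimal if $(R_0/r)^2\le n\le K_1(R_0/r)^2$ and every $\mathbf x\in B(\mathbf 0,R_0)$ belongs to at most $K_2$ of the balls $B(\mathbf x_i,2r)$. A covering $\{A(\mathbf x_i,2r,r)\}_{i=1}^n$ of $B(\mathbf 0,R_0)$ is optimal if $B(\mathbf x_i,r)\subset B(\mathbf 0,R_0)$ for all $i$, $(R_0/r)^2\le n\le K_1(R_0/r)^2$, and every $\mathbf x\in B(\mathbf 0,R_0)$ belongs to at most $K_2$ of the shells $A(\mathbf x_i,4r,r/2)$.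 Averages (time integrals are over $(0,2T)$). $$\tilde\Psi_R=\frac1n\sum_{i=1}^n\frac1T\iint\tfrac12|\omega|^2\,\mathbf u\cdot\nabla\phi_{\mathbf x_i,R}\,d\mathbf x\,dt\quad\text{(ball covering)},$$ $$\tilde\Psi_{2r,r}=\frac1n\sum_{i=1}^n\frac1T\iint\tfrac12|\omega|^2\,\mathbf u\cdot\nabla\phi_i\,d\mathbf x\,dt\quad\text{(shell covering)},$$ $$E_0=\frac1T\frac1{R_0^2}\iint\tfrac12|\omega|^2\phi_0^{2\delta-1}\,d\mathbf x\,dt,\qquad P_0=\frac1T\frac1{R_0^2}\iint|\nabla\omega|^2\phi_0\,d\mathbf x\,dt,\qquad\sigma_0=\left(\frac{E_0}{P_0}\right)^{1/2}$$ (it is understood that $P_0>0$).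
   Formalization: For the ball B(0,R_0) itself (x_0=0, r=R_0) the cut-off ψ is required to equal ψ_0; the English only asks 0≤ψ≤ψ_0 and ψ=1 on B(0,R_0), so vorticity gradients in R_0<|x|<2R_0 could be missed by the ball average and the estimate fails. *)

theory Defs
  imports "HOL-Analysis.Analysis"
begin

section \<open>Calculus\<close>

text \<open>On an open set \<open>S\<close> this is the usual \<open>C\<^sup>k\<close>: all iterated partial derivatives up to
  order \<open>k\<close> exist and are continuous.\<close>

primrec Ck_on :: "nat \<Rightarrow> ('a::euclidean_space \<Rightarrow> 'b::real_normed_vector) \<Rightarrow> 'a set \<Rightarrow> bool" where
  "Ck_on 0 f S \<longleftrightarrow> continuous_on S f"
| "Ck_on (Suc k) f S \<longleftrightarrow> (\<forall>x\<in>S. f differentiable (at x)) \<and>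
     (\<forall>b\<in>Basis. Ck_on k (\<lambda>x. frechet_derivative f (at x) b) S)"

definition smooth_on :: "('a::euclidean_space \<Rightarrow> 'b::real_normed_vector) \<Rightarrow> 'a set \<Rightarrow> bool" where
  "smooth_on f S \<longleftrightarrow> (\<forall>k. Ck_on k f S)"

definition test_function :: "'a set \<Rightarrow> ('a::euclidean_space \<Rightarrow> real) \<Rightarrow> bool" where
  "test_function U f \<longleftrightarrow> smooth_on f UNIV \<and>
     compact (closure {x. f x \<noteq> 0}) \<and> closure {x. f x \<noteq> 0} \<subseteq> U"

definition partial :: "2 \<Rightarrow> (real^2 \<Rightarrow> real) \<Rightarrow> real^2 \<Rightarrow> real" where
  "partial i f x = frechet_derivative f (at x) (axis i 1)"

definition grad :: "(real^2 \<Rightarrow> real) \<Rightarrow> real^2 \<Rightarrow> real^2" where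
  "grad f x = (\<chi> i. partial i f x)"

definition laplacian :: "(real^2 \<Rightarrow> real) \<Rightarrow> real^2 \<Rightarrow> real" where
  "laplacian f x = (\<Sum>i\<in>UNIV. partial i (partial i f) x)"


section \<open>Navier-Stokes equations\<close>

definition divergence_free_at :: "(real^2 \<Rightarrow> real^2) \<Rightarrow> real^2 \<Rightarrow> bool" where
  "divergence_free_at v x \<longleftrightarrow> (\<Sum>j\<in>UNIV. partial j (\<lambda>y. v y $ j) x) = 0"

definition NSE_solution ::
    "real \<Rightarrow> (real^2) set \<Rightarrow> (real \<Rightarrow> real^2 \<Rightarrow> real^2) \<Rightarrow> (real \<Rightarrow> real^2 \<Rightarrow> real) \<Rightarrow> bool" where
  "NSE_solution \<nu> \<Omega> u p \<longleftrightarrow>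
     smooth_on (\<lambda>z. u (fst z) (snd z)) ({0<..} \<times> \<Omega>) \<and>
     smooth_on (\<lambda>z. p (fst z) (snd z)) ({0<..} \<times> \<Omega>) \<and>
     (\<forall>t>0. \<forall>x\<in>\<Omega>.
        (\<forall>j. deriv (\<lambda>s. u s x $ j) t - \<nu> * laplacian (\<lambda>y. u t y $ j) x
             + u t x \<bullet> grad (\<lambda>y. u t y $ j) x + partial j (p t) x = 0) \<and>
        divergence_free_at (u t) x) \<and>
     (\<forall>t>0. continuous_on (closure \<Omega>) (u t) \<and> (\<forall>x\<in>frontier \<Omega>. u t x = 0))"

definition vorticity :: "(real \<Rightarrow> real^2 \<Rightarrow> real^2) \<Rightarrow> real \<Rightarrow> real^2 \<Rightarrow> real" where
  "vorticity u t x = partial 1 (\<lambda>y. u t y $ 2) x - partial 2 (\<lambda>y. u t y $ 1) x"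


section \<open>Cut-offs\<close>

definition shell :: "real^2 \<Rightarrow> real \<Rightarrow> real \<Rightarrow> (real^2) set" where
  "shell x r1 r2 = {y. r2 < dist x y \<and> dist x y < r1}"

definition cone_part :: "real \<Rightarrow> (real^2) set \<Rightarrow> (real^2) set" where
  "cone_part R0 U = {s *\<^sub>R y | s y. y \<in> sphere 0 R0 \<inter> U \<and> 1 \<le> s \<and> s \<le> 2}"

text \<open>As \<open>0 powr a = 0\<close> for every \<open>a\<close> (also \<open>a = 0\<close>) and \<open>x powr 0 = 1\<close> for \<open>x \<noteq> 0\<close>, powers
  \<open>\<psi> powr (2 * \<delta> - 1)\<close> vanish where \<open>\<psi>\<close> does, even for \<open>\<delta> = 1/2\<close>.\<close>

definition cutoff_bounds :: "real \<Rightarrow> real \<Rightarrow> real \<Rightarrow> (real^2 \<Rightarrow> real) \<Rightarrow> bool" where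
  "cutoff_bounds \<delta> C0 r \<psi> \<longleftrightarrow> (\<forall>x. \<psi> x \<noteq> 0 \<longrightarrow>
     norm (grad \<psi> x) / \<psi> x powr \<delta> \<le> C0 / r \<and>
     \<bar>laplacian \<psi> x\<bar> / \<psi> x powr (2 * \<delta> - 1) \<le> C0 / r\<^sup>2)"

definition main_cutoff :: "real \<Rightarrow> real \<Rightarrow> real \<Rightarrow> (real^2 \<Rightarrow> real) \<Rightarrow> bool" where
  "main_cutoff \<delta> C0 R0 \<psi>0 \<longleftrightarrow>
     test_function (ball 0 (2 * R0)) \<psi>0 \<and>
     (\<forall>x. 0 \<le> \<psi>0 x \<and> \<psi>0 x \<le> 1) \<and>
     (\<forall>x\<in>ball 0 R0. \<psi>0 x = 1) \<and>
     cutoff_bounds \<delta> C0 R0 \<psi>0"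

definition time_cutoff :: "real \<Rightarrow> real \<Rightarrow> real \<Rightarrow> (real \<Rightarrow> real) \<Rightarrow> bool" where
  "time_cutoff \<delta> C0 T \<eta> \<longleftrightarrow>
     test_function {0<..<2 * T} \<eta> \<and>
     (\<forall>t. 0 \<le> \<eta> t \<and> \<eta> t \<le> 1) \<and>
     (\<forall>t\<in>{T/4<..<5*T/4}. \<eta> t = 1) \<and>
     (\<forall>t. \<eta> t \<noteq> 0 \<longrightarrow> \<bar>deriv \<eta> t\<bar> / \<eta> t powr \<delta> \<le> C0 / T)"

text \<open>Two points of the case distinction matter only for \<open>x0 = 0\<close>, \<open>r = R0\<close>. The inclusion is
  proper, and the cone over which \<open>\<psi>\<close> agrees with \<open>\<psi>0\<close> is taken over the closed ball, which by
  continuity is otherwise the same as taking it over the open one. Thus the cut-off of the full ball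
  \<open>ball 0 R0\<close> equals \<open>\<psi>0\<close>; without this, cut-offs belonging to a covering with \<open>r = R0\<close> need not
  add up to at least \<open>\<psi>0\<close> outside \<open>ball 0 R0\<close>.\<close>

definition ball_cutoff ::
    "real \<Rightarrow> real \<Rightarrow> real \<Rightarrow> (real^2 \<Rightarrow> real) \<Rightarrow> real^2 \<Rightarrow> real \<Rightarrow> (real^2 \<Rightarrow> real) \<Rightarrow> bool" where
  "ball_cutoff \<delta> C0 R0 \<psi>0 x0 r \<psi> \<longleftrightarrow>
     smooth_on \<psi> UNIV \<and>
     (\<forall>x. 0 \<le> \<psi> x \<and> \<psi> x \<le> \<psi>0 x) \<and>
     (\<forall>x\<in>ball x0 r \<inter> ball 0 R0. \<psi> x = 1) \<and>
     cutoff_bounds \<delta> C0 r \<psi> \<and>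
     (if ball x0 r \<subset> ball 0 R0
      then test_function (ball x0 (2 * r)) \<psi>
      else test_function (ball 0 (2 * R0)) \<psi> \<and>
        (\<forall>x\<in>cone_part R0 (cball x0 r). \<psi> x = \<psi>0 x) \<and>
        (\<forall>x\<in>ball 0 R0 - ball x0 (2 * r). \<psi> x = 0) \<and>
        (\<forall>x. R0 \<le> norm x \<and> norm x \<le> 2 * R0 \<and> x \<notin> cone_part R0 (ball x0 (2 * r)) \<longrightarrow> \<psi> x = 0))"

definition shell_cutoff ::
    "real \<Rightarrow> real \<Rightarrow> real \<Rightarrow> (real^2 \<Rightarrow> real) \<Rightarrow> real^2 \<Rightarrow> real \<Rightarrow> (real^2 \<Rightarrow> real) \<Rightarrow> bool" where
  "shell_cutoff \<delta> C0 R0 \<psi>0 x0 r \<psi> \<longleftrightarrow>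
     smooth_on \<psi> UNIV \<and>
     (\<forall>x. 0 \<le> \<psi> x \<and> \<psi> x \<le> \<psi>0 x) \<and>
     (\<forall>x\<in>shell x0 (2 * r) r \<inter> ball 0 R0. \<psi> x = 1) \<and>
     cutoff_bounds \<delta> C0 r \<psi> \<and>
     (if shell x0 (2 * r) r \<subseteq> ball 0 R0
      then test_function (shell x0 (4 * r) (r / 2)) \<psi>
      else test_function (ball 0 (2 * R0)) \<psi> \<and>
        (\<forall>x\<in>cone_part R0 (ball x0 (2 * r)). \<psi> x = \<psi>0 x) \<and>
        (\<forall>x\<in>ball 0 R0 - shell x0 (4 * r) (r / 2). \<psi> x = 0) \<and>
        (\<forall>x. R0 \<le> norm x \<and> norm x \<le> 2 * R0 \<and> x \<notin> cone_part R0 (ball x0 (4 * r)) \<longrightarrow> \<psi> x = 0))"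

definition spacetime_cutoff :: "(real \<Rightarrow> real) \<Rightarrow> (real^2 \<Rightarrow> real) \<Rightarrow> real \<Rightarrow> real^2 \<Rightarrow> real" where
  "spacetime_cutoff \<eta> \<psi> t x = \<eta> t * \<psi> x"


section \<open>Optimal coverings\<close>

definition optimal_ball_covering ::
    "real \<Rightarrow> real \<Rightarrow> real \<Rightarrow> real \<Rightarrow> nat \<Rightarrow> (nat \<Rightarrow> real^2) \<Rightarrow> bool" where
  "optimal_ball_covering K1 K2 R0 r n x \<longleftrightarrow>
     (\<forall>i\<in>{1..n}. x i \<in> ball 0 R0) \<and>
     ball 0 R0 \<subseteq> (\<Union>i\<in>{1..n}. ball (x i) r) \<and>
     (R0 / r)\<^sup>2 \<le> real n \<and> real n \<le> K1 * (R0 / r)\<^sup>2 \<and>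
     (\<forall>y\<in>ball 0 R0. real (card {i\<in>{1..n}. y \<in> ball (x i) (2 * r)}) \<le> K2)"

definition optimal_shell_covering ::
    "real \<Rightarrow> real \<Rightarrow> real \<Rightarrow> real \<Rightarrow> nat \<Rightarrow> (nat \<Rightarrow> real^2) \<Rightarrow> bool" where
  "optimal_shell_covering K1 K2 R0 r n x \<longleftrightarrow>
     (\<forall>i\<in>{1..n}. ball (x i) r \<subseteq> ball 0 R0) \<and>
     ball 0 R0 \<subseteq> (\<Union>i\<in>{1..n}. shell (x i) (2 * r) r) \<and>
     (R0 / r)\<^sup>2 \<le> real n \<and> real n \<le> K1 * (R0 / r)\<^sup>2 \<and>
     (\<forall>y\<in>ball 0 R0. real (card {i\<in>{1..n}. y \<in> shell (x i) (4 * r) (r / 2)}) \<le> K2)"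


section \<open>Averages\<close>

definition spacetime_integral :: "real \<Rightarrow> (real^2) set \<Rightarrow> (real \<Rightarrow> real^2 \<Rightarrow> real) \<Rightarrow> real" where
  "spacetime_integral T \<Omega> f = (LINT z:{0<..<2 * T} \<times> \<Omega>|lborel. f (fst z) (snd z))"

definition local_flux ::
    "real \<Rightarrow> (real^2) set \<Rightarrow> (real \<Rightarrow> real^2 \<Rightarrow> real^2) \<Rightarrow> (real \<Rightarrow> real^2 \<Rightarrow> real) \<Rightarrow> real" where
  "local_flux T \<Omega> u \<phi> = 1 / T * spacetime_integral T \<Omega>
     (\<lambda>t x. 1/2 * \<bar>vorticity u t x\<bar>\<^sup>2 * (u t x \<bullet> grad (\<phi> t) x))"

text \<open>Used for ball and shell coverings alike; \<open>\<psi> i\<close> is the cut-off of the \<open>i\<close>-th member.\<close>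

definition mean_flux ::
    "real \<Rightarrow> (real^2) set \<Rightarrow> (real \<Rightarrow> real^2 \<Rightarrow> real^2) \<Rightarrow> (real \<Rightarrow> real) \<Rightarrow>
     nat \<Rightarrow> (nat \<Rightarrow> real^2 \<Rightarrow> real) \<Rightarrow> real" where
  "mean_flux T \<Omega> u \<eta> n \<psi> =
     1 / real n * (\<Sum>i=1..n. local_flux T \<Omega> u (spacetime_cutoff \<eta> (\<psi> i)))"

definition E0_avg ::
    "real \<Rightarrow> real \<Rightarrow> real \<Rightarrow> (real^2) set \<Rightarrow> (real \<Rightarrow> real^2 \<Rightarrow> real^2) \<Rightarrow>
     (real \<Rightarrow> real^2 \<Rightarrow> real) \<Rightarrow> real" where
  "E0_avg \<delta> R0 T \<Omega> u \<phi>0 = 1 / T * (1 / R0\<^sup>2) * spacetime_integral T \<Omega>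
     (\<lambda>t x. 1/2 * \<bar>vorticity u t x\<bar>\<^sup>2 * \<phi>0 t x powr (2 * \<delta> - 1))"

definition P0_avg ::
    "real \<Rightarrow> real \<Rightarrow> (real^2) set \<Rightarrow> (real \<Rightarrow> real^2 \<Rightarrow> real^2) \<Rightarrow>
     (real \<Rightarrow> real^2 \<Rightarrow> real) \<Rightarrow> real" where
  "P0_avg R0 T \<Omega> u \<phi>0 = 1 / T * (1 / R0\<^sup>2) * spacetime_integral T \<Omega>
     (\<lambda>t x. (norm (grad (vorticity u t) x))\<^sup>2 * \<phi>0 t x)"

end

theory Submission
  imports Defs
begin

text \<open>
  Write \<open>S\<close> for the sum of the cut-offs of a covering with \<open>n\<close> members of size \<open>r\<close>, \<open>a = (R0 / r)\<^sup>2\<close>,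
  \<open>b = 2 \<delta> - 1\<close>, and \<open>P\<close>, \<open>E\<close> for the integrals that \<open>P0\<close>, \<open>E0\<close> average.  Multiplying the vorticity
  equation by \<open>\<omega> \<eta> S\<close> and integrating gives
  \<open>flux S = \<nu> \<integral> \<eta> |\<nabla>\<omega>|\<^sup>2 S - \<integral> 1/2 \<omega>\<^sup>2 (\<eta>' S + \<nu> \<eta> \<Delta>S)\<close> (\<open>enstrophy_balance\<close>).  If
  \<open>\<psi>0 \<le> S \<le> M \<psi>0\<close> with \<open>M \<le> K2\<close>, the first term lies between \<open>\<nu> P\<close> and \<open>\<nu> K2 P\<close>.  Since
  \<open>T \<ge> R0\<^sup>2 / \<nu>\<close>, the second is at most \<open>\<nu> (C0 / R0\<^sup>2) W E\<close> for every \<open>W\<close> with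
  \<open>S + (R0\<^sup>2 / C0) |\<Delta>S| \<le> W \<psi>0 powr b\<close> (\<open>flux_bounds\<close>).  The bound on \<open>\<sigma>0\<close> says
  \<open>(C0 / R0\<^sup>2) n K2 E \<le> \<gamma>\<^sup>2 P\<close>.  So if \<open>W \<le> n K2\<close>, the flux is \<open>\<nu> P\<close> up to the factors \<open>1 - \<gamma>\<^sup>2\<close> and
  \<open>K2 + \<gamma>\<^sup>2\<close>; dividing by \<open>n\<close>, which lies between \<open>a\<close> and \<open>K1 a\<close>, and comparing the two coverings yields
  the theorem (\<open>covering_ratio\<close>).

  The difficulty is \<open>W \<le> n K2\<close>.  Adding the Laplacians of \<open>M\<close> overlapping cut-offs and the time term gives
  only \<open>W = M + M a\<close>, which exceeds \<open>n K2\<close> when \<open>M = K2\<close> and \<open>a = n\<close>.  Three observations repair this.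

  At a point near which one cut-off coincides with \<open>\<psi>0\<close>, its Laplacian is \<open>\<Delta>\<psi>0\<close>, of size
  \<open>C0 / R0\<^sup>2\<close> and zero inside \<open>ball 0 R0\<close>, so only \<open>M - 1\<close> Laplacians have size \<open>C0 / r\<^sup>2\<close>.  Such points
  are dense, because the covering meets a dense set of points inside and of directions outside, and continuity
  extends the bound (\<open>sum_of_cutoffs\<close>, \<open>cover_weights\<close>).  Inside, \<open>W = M + (M - 1) a \<le> M n\<close>; outside
  there is one more unit from \<open>\<Delta>\<psi>0\<close>.

  For balls, a point of the rim cannot lie in almost all of the doubled discs unless \<open>r\<close> is comparable
  with \<open>R0\<close> (\<open>rim_multiplicity\<close>).  This lowers \<open>M\<close> outside and even leaves a surplus when \<open>K2 \<ge> 5\<close>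
  (\<open>ball_weights\<close>).

  For shells \<open>m \<ge> 5\<close> (\<open>shell_covering_facts\<close>).  If \<open>K2 < m\<close>, then \<open>M \<le> m - 1\<close> pays for the extra unit.
  Otherwise the weight outside can be \<open>m K2 + 1\<close>.  In the upper bound of the ratio the excess is
  absorbed by the surplus of the balls.  In the lower bound it is removed by
  \<open>flux_lower_bound\<close>: the part \<open>\<integral> \<eta> |\<nabla>\<omega>|\<^sup>2 (S - \<psi>0)\<close> of the dissipation dominates a multiple of
  \<open>\<omega>\<^sup>2\<close>, as one sees by integrating the divergence of \<open>\<omega>\<^sup>2 F \<nabla>(S - \<psi>0)\<close> and completing squares, where
  \<open>F\<close> is a logarithm of \<open>S - \<psi>0\<close> relative to a local average of \<open>\<psi>0\<close> (\<open>comparison_function\<close>).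
\<close>

section \<open>Directional derivatives and smooth functions\<close>

text \<open>Derivatives along a line are all that integration by parts needs.  Functions such as a local
  average are handled through them without being shown to be smooth.\<close>

definition dd :: "('a::real_vector \<Rightarrow> real) \<Rightarrow> 'a \<Rightarrow> 'a \<Rightarrow> real \<Rightarrow> bool" where
  "dd f e z d \<longleftrightarrow> ((\<lambda>h. f (z + h *\<^sub>R e)) has_real_derivative d) (at 0)"

lemma dd_const: "dd (\<lambda>_. c) e z 0"
  by (simp add: dd_def)

lemma dd_add: "dd f e z a \<Longrightarrow> dd g e z b \<Longrightarrow> dd (\<lambda>y. f y + g y) e z (a + b)"
  unfolding dd_def by (rule DERIV_add)

lemma dd_diff: "dd f e z a \<Longrightarrow> dd g e z b \<Longrightarrow> dd (\<lambda>y. f y - g y) e z (a - b)"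
  unfolding dd_def by (rule DERIV_diff)

lemma dd_mult: "dd f e z a \<Longrightarrow> dd g e z b \<Longrightarrow> dd (\<lambda>y. f y * g y) e z (a * g z + f z * b)"
  unfolding dd_def by (drule (1) DERIV_mult) (simp add: algebra_simps)

lemma dd_compose:
  assumes "dd f e z a" "(F has_real_derivative d) (at (f z))"
  shows "dd (\<lambda>y. F (f y)) e z (d * a)"
  using DERIV_chain2[of F d "\<lambda>h. f (z + h *\<^sub>R e)" 0 a UNIV] assms
  unfolding dd_def by simp

lemma dd_divide:
  assumes "dd f e z a" "dd g e z b" "g z \<noteq> 0"
  shows "dd (\<lambda>y. f y / g y) e z (a / g z - f z * b / (g z)\<^sup>2)"
  using DERIV_divide[of "\<lambda>h. f (z + h *\<^sub>R e)" a 0 UNIV "\<lambda>h. g (z + h *\<^sub>R e)" b] assms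
  unfolding dd_def by (simp add: power2_eq_square diff_divide_distrib)

lemma dd_sum:
  assumes "\<And>i. i \<in> I \<Longrightarrow> dd (f i) e z (d i)"
  shows "dd (\<lambda>y. \<Sum>i\<in>I. f i y) e z (\<Sum>i\<in>I. d i)"
  using assms unfolding dd_def by (intro DERIV_sum) auto

lemma dd_unique: "dd f e z a \<Longrightarrow> dd f e z b \<Longrightarrow> a = b"
  unfolding dd_def by (rule DERIV_unique)

lemma dd_frechet:
  fixes f :: "'a::real_normed_vector \<Rightarrow> real"
  assumes "f differentiable (at z)"
  shows "dd f e z (frechet_derivative f (at z) e)"
proof -
  have "(f has_derivative frechet_derivative f (at z)) (at (z + 0 *\<^sub>R e))"
    using assms frechet_derivative_works by auto
  moreover have "((\<lambda>h. z + h *\<^sub>R e) has_derivative (\<lambda>h. h *\<^sub>R e)) (at 0)"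
    by (auto intro!: derivative_eq_intros)
  ultimately have "((\<lambda>h. f (z + h *\<^sub>R e)) has_derivative
      (\<lambda>h. frechet_derivative f (at z) (h *\<^sub>R e))) (at 0)"
    using diff_chain_at[of "\<lambda>h. z + h *\<^sub>R e" "\<lambda>h. h *\<^sub>R e" 0 f] by (simp add: o_def)
  moreover have "linear (frechet_derivative f (at z))"
    using assms by (rule linear_frechet_derivative)
  ultimately show ?thesis
    unfolding dd_def has_field_derivative_def
    by (simp add: linear_cmul[of "frechet_derivative f (at z)"] mult_commute_abs)
qed

lemma dd_shift:
  "dd f e (z + s *\<^sub>R e) d \<longleftrightarrow> ((\<lambda>h. f (z + h *\<^sub>R e)) has_real_derivative d) (at s)"
  unfolding dd_def
  using DERIV_shift[of "\<lambda>h. f (z + h *\<^sub>R e)" d 0 s]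
  by (simp add: algebra_simps)

lemma dd_cong_ev:
  fixes z :: "'a::real_normed_vector"
  assumes "\<forall>\<^sub>F y in nhds z. f y = g y" "dd f e z d"
  shows "dd g e z d"
proof -
  have "((\<lambda>h. z + h *\<^sub>R e) \<longlongrightarrow> z + 0 *\<^sub>R e) (nhds (0::real))"
    by (intro tendsto_intros filterlim_ident)
  then have "filterlim (\<lambda>h. z + h *\<^sub>R e) (nhds z) (nhds (0::real))" by simp
  then have "\<forall>\<^sub>F h in nhds 0. f (z + h *\<^sub>R e) = g (z + h *\<^sub>R e)"
    using assms(1) eventually_compose_filterlim by blast
  then show ?thesis using assms(2) unfolding dd_def
    using DERIV_cong_ev[of 0 0 "\<lambda>h. f (z + h *\<^sub>R e)" "\<lambda>h. g (z + h *\<^sub>R e)" d d] by blast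
qed

lemma frechet_derivative_cong_ev:
  assumes "\<forall>\<^sub>F y in nhds z. f y = g y"
  shows "frechet_derivative f (at z) = frechet_derivative g (at z)"
proof -
  have "(f has_derivative f') (at z) \<longleftrightarrow> (g has_derivative f') (at z)" for f'
    using has_derivative_transform_eventually[of f f' z UNIV g]
      has_derivative_transform_eventually[of g f' z UNIV f] assms
    by (auto simp: eq_commute eventually_nhds_conv_at elim: eventually_mono)
  then show ?thesis unfolding frechet_derivative_def by simp
qed

lemma differentiable_cong_ev:
  assumes "\<forall>\<^sub>F y in nhds z. f y = g y" "f differentiable (at z)"
  shows "g differentiable (at z)"
  using assms has_derivative_transform_eventually[of f _ z UNIV g]
  unfolding differentiable_def by (auto simp: eventually_nhds_conv_at)

lemma eventually_open_eq: "open S \<Longrightarrow> z \<in> S \<Longrightarrow> (\<And>y. y \<in> S \<Longrightarrow> P y) \<Longrightarrow> \<forall>\<^sub>F y in nhds z. P y"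
  using eventually_nhds by blast

lemma Ck_on_cong:
  fixes f g :: "'a::euclidean_space \<Rightarrow> 'b::real_normed_vector"
  assumes "open S" "\<And>x. x \<in> S \<Longrightarrow> f x = g x" "Ck_on k f S"
  shows "Ck_on k g S"
  using assms(2,3)
proof (induction k arbitrary: f g)
  case 0
  then show ?case by (metis Ck_on.simps(1) continuous_on_cong)
next
  case (Suc k)
  have ev: "\<forall>\<^sub>F y in nhds x. f y = g y" if "x \<in> S" for x
    by (rule eventually_open_eq[OF assms(1) that]) (rule Suc.prems(1))
  have "g differentiable (at x)" if "x \<in> S" for x
    using Suc.prems(2) that differentiable_cong_ev[OF ev[OF that]] by auto
  moreover have "Ck_on k (\<lambda>x. frechet_derivative g (at x) b) S" if "b \<in> Basis" for b
  proof (rule Suc.IH[of "\<lambda>x. frechet_derivative f (at x) b"])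
    show "frechet_derivative f (at x) b = frechet_derivative g (at x) b" if "x \<in> S" for x
      using frechet_derivative_cong_ev[OF ev[OF that]] by simp
    show "Ck_on k (\<lambda>x. frechet_derivative f (at x) b) S"
      using Suc.prems(2) that by simp
  qed
  ultimately show ?case by simp
qed

lemma Ck_on_bounded_linear:
  fixes f :: "'a::euclidean_space \<Rightarrow> 'b::real_normed_vector"
    and L :: "'b \<Rightarrow> 'c::real_normed_vector"
  assumes "open S" "bounded_linear L" "Ck_on k f S"
  shows "Ck_on k (\<lambda>x. L (f x)) S"
  using assms(3)
proof (induction k arbitrary: f)
  case 0
  then show ?case
    by (auto intro!: bounded_linear.continuous_on[OF assms(2)])
next
  case (Suc k)
  have hd: "((\<lambda>x. L (f x)) has_derivative (\<lambda>v. L (frechet_derivative f (at x) v))) (at x)" if "x \<in> S" for x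
    using Suc.prems that
    by (intro bounded_linear.has_derivative[OF assms(2)]) (auto simp: frechet_derivative_works)
  have "(\<lambda>x. L (f x)) differentiable (at x)" if "x \<in> S" for x
    using hd[OF that] differentiableI by blast
  moreover have "Ck_on k (\<lambda>x. frechet_derivative (\<lambda>x. L (f x)) (at x) b) S" if "b \<in> Basis" for b
  proof (rule Ck_on_cong[OF assms(1) _ Suc.IH[of "\<lambda>x. frechet_derivative f (at x) b"]])
    fix x assume "x \<in> S"
    then show "L (frechet_derivative f (at x) b) = frechet_derivative (\<lambda>x. L (f x)) (at x) b"
      by (simp add: frechet_derivative_at[OF hd, symmetric])
  qed (use Suc.prems that in auto)
  ultimately show ?case by simp
qed

lemma Ck_on_add:
  fixes f g :: "'a::euclidean_space \<Rightarrow> 'b::real_normed_vector"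
  assumes "open S" "Ck_on k f S" "Ck_on k g S"
  shows "Ck_on k (\<lambda>x. f x + g x) S"
  using assms(2,3)
proof (induction k arbitrary: f g)
  case 0
  then show ?case by (auto intro: continuous_intros)
next
  case (Suc k)
  have hd: "((\<lambda>x. f x + g x) has_derivative
      (\<lambda>v. frechet_derivative f (at x) v + frechet_derivative g (at x) v)) (at x)" if "x \<in> S" for x
    using Suc.prems that by (intro has_derivative_add) (auto simp: frechet_derivative_works)
  have "(\<lambda>x. f x + g x) differentiable (at x)" if "x \<in> S" for x
    using hd[OF that] differentiableI by blast
  moreover have "Ck_on k (\<lambda>x. frechet_derivative (\<lambda>x. f x + g x) (at x) b) S" if "b \<in> Basis" for b
  proof (rule Ck_on_cong[OF assms(1) _ Suc.IH[of "\<lambda>x. frechet_derivative f (at x) b"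
          "\<lambda>x. frechet_derivative g (at x) b"]])
    fix x assume "x \<in> S"
    then show "frechet_derivative f (at x) b + frechet_derivative g (at x) b
        = frechet_derivative (\<lambda>x. f x + g x) (at x) b"
      by (simp add: frechet_derivative_at[OF hd, symmetric])
  qed (use Suc.prems that in auto)
  ultimately show ?case by simp
qed

lemma smooth_on_add: "open S \<Longrightarrow> smooth_on f S \<Longrightarrow> smooth_on g S \<Longrightarrow> smooth_on (\<lambda>x. f x + g x) S"
  unfolding smooth_on_def using Ck_on_add[of S] by blast

lemma smooth_on_bounded_linear:
  "open S \<Longrightarrow> bounded_linear L \<Longrightarrow> smooth_on f S \<Longrightarrow> smooth_on (\<lambda>x. L (f x)) S"
  unfolding smooth_on_def using Ck_on_bounded_linear[of S L] by blast

lemma smooth_on_diff: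
  assumes "open S" "smooth_on f S" "smooth_on g S"
  shows "smooth_on (\<lambda>x. f x - g x) S"
  using smooth_on_add[OF assms(1,2) smooth_on_bounded_linear[OF assms(1) bounded_linear_minus[OF bounded_linear_ident] assms(3)]]
  by simp

lemma smooth_on_cong: "open S \<Longrightarrow> (\<And>x. x \<in> S \<Longrightarrow> f x = g x) \<Longrightarrow> smooth_on f S \<Longrightarrow> smooth_on g S"
  unfolding smooth_on_def using Ck_on_cong by blast

lemma Ck_on_const: "Ck_on k (\<lambda>_::'a::euclidean_space. c) S"
proof (induction k arbitrary: c)
  case (Suc k)
  have "frechet_derivative (\<lambda>_::'a. c) (at x) = (\<lambda>_. 0)" for x :: 'a
    by (rule frechet_derivative_const)
  then show ?case using Suc by simp
qed simp

lemma smooth_on_sum: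
  assumes "open S" "finite I" "\<And>i. i \<in> I \<Longrightarrow> smooth_on (f i) S"
  shows "smooth_on (\<lambda>x. \<Sum>i\<in>I. f i x) S"
  using assms(2,3)
proof (induction I rule: finite_induct)
  case empty
  then show ?case by (simp add: smooth_on_def Ck_on_const)
next
  case (insert i I)
  then show ?case using smooth_on_add[OF assms(1), of "f i" "\<lambda>x. \<Sum>i\<in>I. f i x"] by simp
qed

lemma smooth_onD:
  assumes "smooth_on f S"
  shows "continuous_on S f"
    and "x \<in> S \<Longrightarrow> f differentiable (at x)"
    and "b \<in> Basis \<Longrightarrow> smooth_on (\<lambda>x. frechet_derivative f (at x) b) S"
proof -
  show "continuous_on S f" using assms unfolding smooth_on_def by (metis Ck_on.simps(1))
  show "x \<in> S \<Longrightarrow> f differentiable (at x)"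
    using assms unfolding smooth_on_def by (metis Ck_on.simps(2))
  show "b \<in> Basis \<Longrightarrow> smooth_on (\<lambda>x. frechet_derivative f (at x) b) S"
    using assms unfolding smooth_on_def by (metis Ck_on.simps(2))
qed

section \<open>Symmetry of second derivatives\<close>

text \<open>Two applications of the mean value theorem turn a second difference into a mixed derivative.  The
  second difference is symmetric in \<open>a\<close> and \<open>b\<close>, so the two mixed derivatives agree in the limit.\<close>

lemma double_difference:
  fixes f :: "'a::real_vector \<Rightarrow> real"
  assumes "h > 0"
    and fa: "\<And>s t. s \<in> {0..h} \<Longrightarrow> t \<in> {0..h} \<Longrightarrow>
      dd f a (x + s *\<^sub>R a + t *\<^sub>R b) (fa (x + s *\<^sub>R a + t *\<^sub>R b))"
    and fab: "\<And>s t. s \<in> {0..h} \<Longrightarrow> t \<in> {0..h} \<Longrightarrow>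
      dd fa b (x + s *\<^sub>R a + t *\<^sub>R b) (fab (x + s *\<^sub>R a + t *\<^sub>R b))"
  shows "\<exists>s\<in>{0..h}. \<exists>t\<in>{0..h}. f (x + h *\<^sub>R a + h *\<^sub>R b) - f (x + h *\<^sub>R a)
      - f (x + h *\<^sub>R b) + f x = h\<^sup>2 * fab (x + s *\<^sub>R a + t *\<^sub>R b)"
proof -
  define G where "G s = f (x + h *\<^sub>R b + s *\<^sub>R a) - f (x + s *\<^sub>R a)" for s
  have "\<exists>s. s > 0 \<and> s < h \<and> G h - G 0 = (h - 0) * (fa (x + s *\<^sub>R a + h *\<^sub>R b) - fa (x + s *\<^sub>R a + 0 *\<^sub>R b))"
  proof (rule MVT2[OF \<open>h > 0\<close>])
    fix s assume s: "0 \<le> s" "s \<le> h"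
    have "dd f a (x + h *\<^sub>R b + s *\<^sub>R a) (fa (x + s *\<^sub>R a + h *\<^sub>R b))"
      using fa[of s h] s \<open>h > 0\<close> by (simp add: algebra_simps)
    moreover have "dd f a (x + s *\<^sub>R a) (fa (x + s *\<^sub>R a + 0 *\<^sub>R b))"
      using fa[of s 0] s \<open>h > 0\<close> by simp
    ultimately show "(G has_real_derivative fa (x + s *\<^sub>R a + h *\<^sub>R b) - fa (x + s *\<^sub>R a + 0 *\<^sub>R b)) (at s)"
      unfolding G_def dd_shift by (rule DERIV_diff)
  qed
  then obtain s where s: "s > 0" "s < h"
    and Gs: "G h - G 0 = h * (fa (x + s *\<^sub>R a + h *\<^sub>R b) - fa (x + s *\<^sub>R a + 0 *\<^sub>R b))" by auto
  have "\<exists>t. t > 0 \<and> t < h \<and> fa (x + s *\<^sub>R a + h *\<^sub>R b) - fa (x + s *\<^sub>R a + 0 *\<^sub>R b)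
      = (h - 0) * fab (x + s *\<^sub>R a + t *\<^sub>R b)"
  proof (rule MVT2[OF \<open>h > 0\<close>])
    fix t assume t: "0 \<le> t" "t \<le> h"
    show "((\<lambda>t. fa (x + s *\<^sub>R a + t *\<^sub>R b)) has_real_derivative fab (x + s *\<^sub>R a + t *\<^sub>R b)) (at t)"
      using fab[of s t] s t unfolding dd_shift by simp
  qed
  then obtain t where t: "t > 0" "t < h"
    and "fa (x + s *\<^sub>R a + h *\<^sub>R b) - fa (x + s *\<^sub>R a + 0 *\<^sub>R b) = h * fab (x + s *\<^sub>R a + t *\<^sub>R b)" by auto
  with Gs have "G h - G 0 = h\<^sup>2 * fab (x + s *\<^sub>R a + t *\<^sub>R b)" by (simp add: power2_eq_square)
  then show ?thesis using s t unfolding G_def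
    by (intro bexI[of _ s] bexI[of _ t]) (auto simp: algebra_simps)
qed

lemma mixed_dd_commute:
  fixes f :: "'a::real_normed_vector \<Rightarrow> real"
  assumes "open S" "x \<in> S"
    and fa: "\<And>y. y \<in> S \<Longrightarrow> dd f a y (fa y)" and fb: "\<And>y. y \<in> S \<Longrightarrow> dd f b y (fb y)"
    and fab: "\<And>y. y \<in> S \<Longrightarrow> dd fa b y (fab y)" and fba: "\<And>y. y \<in> S \<Longrightarrow> dd fb a y (fba y)"
    and "continuous_on S fab" "continuous_on S fba"
  shows "fab x = fba x"
proof (rule ccontr)
  assume ne: "fab x \<noteq> fba x"
  define e where "e = \<bar>fab x - fba x\<bar> / 2"
  have "e > 0" using ne by (simp add: e_def)
  have c: "isCont fab x" "isCont fba x"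
    using assms by (auto simp: continuous_on_eq_continuous_at)
  obtain r1 where r1: "r1 > 0" "\<And>y. dist y x < r1 \<Longrightarrow> dist (fab y) (fab x) < e"
    using c(1) \<open>e > 0\<close> unfolding continuous_at_eps_delta by blast
  obtain r2 where r2: "r2 > 0" "\<And>y. dist y x < r2 \<Longrightarrow> dist (fba y) (fba x) < e"
    using c(2) \<open>e > 0\<close> unfolding continuous_at_eps_delta by blast
  obtain r3 where r3: "r3 > 0" "ball x r3 \<subseteq> S" using assms(1,2) openE by blast
  define r where "r = Min {r1, r2, r3}"
  have r: "r > 0" "r \<le> r1" "r \<le> r2" "r \<le> r3" using r1 r2 r3 by (auto simp: r_def)
  define q where "q = norm a + norm b + 1"
  define h where "h = r / (2 * q)"
  have "q > 0" by (simp add: q_def add_nonneg_pos)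
  then have h: "h > 0" and "h * q = r / 2" using r by (simp_all add: h_def)
  then have hh: "h * (norm a + norm b + 1) = r / 2" by (simp add: q_def)
  have near: "dist (x + s *\<^sub>R a + t *\<^sub>R b) x < r" if "s \<in> {0..h}" "t \<in> {0..h}" for s t
  proof -
    have "dist (x + s *\<^sub>R a + t *\<^sub>R b) x = norm (s *\<^sub>R a + t *\<^sub>R b)"
      by (simp add: dist_norm)
    also have "\<dots> \<le> s * norm a + t * norm b"
      using norm_triangle_ineq[of "s *\<^sub>R a" "t *\<^sub>R b"] that by simp
    also have "\<dots> \<le> h * norm a + h * norm b"
      using that by (intro add_mono mult_right_mono) auto
    also have "\<dots> < r" using hh h r by (simp add: algebra_simps)
    finally show ?thesis .
  qed
  then have inS: "x + s *\<^sub>R a + t *\<^sub>R b \<in> S" if "s \<in> {0..h}" "t \<in> {0..h}" for s t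
    using that r3(2) r(4) by (force simp: dist_commute)
  then have inS': "x + t *\<^sub>R b + s *\<^sub>R a \<in> S" if "s \<in> {0..h}" "t \<in> {0..h}" for s t
    using that by (simp add: algebra_simps)
  obtain s t where 1: "s \<in> {0..h}" "t \<in> {0..h}" "f (x + h *\<^sub>R a + h *\<^sub>R b) - f (x + h *\<^sub>R a)
      - f (x + h *\<^sub>R b) + f x = h\<^sup>2 * fab (x + s *\<^sub>R a + t *\<^sub>R b)"
    using double_difference[OF h, of f a x b fa fab] fa fab inS by blast
  obtain s' t' where 2: "s' \<in> {0..h}" "t' \<in> {0..h}" "f (x + h *\<^sub>R b + h *\<^sub>R a) - f (x + h *\<^sub>R b)
      - f (x + h *\<^sub>R a) + f x = h\<^sup>2 * fba (x + s' *\<^sub>R b + t' *\<^sub>R a)"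
    using double_difference[OF h, of f b x a fb fba] fb fba inS' by blast
  have "x + h *\<^sub>R b + h *\<^sub>R a = x + h *\<^sub>R a + h *\<^sub>R b" by (simp add: algebra_simps)
  with 1 2 h have eq: "fab (x + s *\<^sub>R a + t *\<^sub>R b) = fba (x + t' *\<^sub>R a + s' *\<^sub>R b)"
    by (simp add: algebra_simps)
  have "dist (fab (x + s *\<^sub>R a + t *\<^sub>R b)) (fab x) < e"
    using near[OF 1(1,2)] r by (intro r1(2)) auto
  moreover have "dist (fba (x + t' *\<^sub>R a + s' *\<^sub>R b)) (fba x) < e"
    using near[OF 2(2,1)] r by (intro r2(2)) auto
  ultimately show False using eq unfolding e_def dist_real_def by (simp add: abs_if split: if_splits)
qed

lemma smooth_on_dd:
  fixes f :: "'a::euclidean_space \<Rightarrow> real"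
  shows "smooth_on f S \<Longrightarrow> x \<in> S \<Longrightarrow> dd f e x (frechet_derivative f (at x) e)"
  by (rule dd_frechet) (rule smooth_onD)

lemma smooth_on_mixed:
  fixes f :: "'a::euclidean_space \<Rightarrow> real"
  assumes "open S" "smooth_on f S" "x \<in> S" "a \<in> Basis" "b \<in> Basis"
  shows "frechet_derivative (\<lambda>y. frechet_derivative f (at y) a) (at x) b
       = frechet_derivative (\<lambda>y. frechet_derivative f (at y) b) (at x) a"
proof -
  have A: "smooth_on (\<lambda>y. frechet_derivative f (at y) a) S" and B: "smooth_on (\<lambda>y. frechet_derivative f (at y) b) S"
    using smooth_onD(3) assms by auto
  show ?thesis
  proof (rule mixed_dd_commute[OF assms(1,3)])
    show "dd f a y (frechet_derivative f (at y) a)" "dd f b y (frechet_derivative f (at y) b)" if "y \<in> S" for y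
      using assms(2) that by (auto intro: smooth_on_dd)
    show "dd (\<lambda>y. frechet_derivative f (at y) a) b y (frechet_derivative (\<lambda>y. frechet_derivative f (at y) a) (at y) b)"
      "dd (\<lambda>y. frechet_derivative f (at y) b) a y (frechet_derivative (\<lambda>y. frechet_derivative f (at y) b) (at y) a)"
      if "y \<in> S" for y
      using A B that by (auto intro: smooth_on_dd)
    show "continuous_on S (\<lambda>y. frechet_derivative (\<lambda>y. frechet_derivative f (at y) a) (at y) b)"
      "continuous_on S (\<lambda>y. frechet_derivative (\<lambda>y. frechet_derivative f (at y) b) (at y) a)"
      using smooth_onD(1)[OF smooth_onD(3)] A B assms(4,5) by auto
  qed
qed

section \<open>Integration by parts\<close>

lemma lborel_integral_shift:
  fixes f :: "'a::euclidean_space \<Rightarrow> real"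
  assumes "f \<in> borel_measurable borel"
  shows "(LINT x|lborel. f (x + t)) = (LINT x|lborel. f x)"
proof -
  have "(LINT x|lborel. f x) = (LINT x|distr lborel borel ((+) t). f x)"
    by (simp add: lborel_distr_plus)
  also have "\<dots> = (LINT x|lborel. f (t + x))"
    using assms by (intro integral_distr) auto
  finally show ?thesis by (simp add: add.commute)
qed

lemma dd_zero_local:
  fixes x :: "'a::euclidean_space"
  assumes "dd G e x d" "open V" "x \<in> V" "\<And>y. y \<in> V \<Longrightarrow> G y = 0"
  shows "d = 0"
proof -
  have "\<forall>\<^sub>F y in nhds x. (\<lambda>_. 0) y = G y"
    by (rule eventually_open_eq[OF assms(2,3)]) (simp add: assms(4))
  then have "dd G e x 0" by (rule dd_cong_ev[OF _ dd_const])
  then show ?thesis using assms(1) dd_unique by blast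
qed

lemma integrable_continuous_compact_support:
  fixes f :: "'a::euclidean_space \<Rightarrow> real"
  assumes "compact K" "continuous_on K f" "\<And>x. x \<notin> K \<Longrightarrow> f x = 0"
  shows "integrable lborel f"
proof -
  have "(\<lambda>x. indicator K x *\<^sub>R f x) = f"
    by (intro ext) (use assms(3) in \<open>force simp: indicator_def\<close>)
  then show ?thesis using borel_integrable_compact[OF assms(1,2)] by simp
qed

text \<open>Difference quotients integrate to zero by translation invariance, and they converge boundedly
  with supports in a fixed compact set.  This replaces the theorem of Fubini.\<close>

lemma integral_dd_zero:
  fixes G G' :: "'a::euclidean_space \<Rightarrow> real"
  assumes K: "compact K" and G0: "\<And>x. x \<notin> K \<Longrightarrow> G x = 0"
    and G: "continuous_on UNIV G" and G': "continuous_on UNIV G'"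
    and dd: "\<And>x. dd G e x (G' x)"
  shows "(LINT x|lborel. G' x) = 0"
proof -
  have G'0: "G' x = 0" if "x \<notin> K" for x
    using dd_zero_local[OF dd, of "- K" x] that G0 K by (auto simp: open_Compl compact_imp_closed)
  obtain M where M: "\<And>x. \<bar>G' x\<bar> \<le> M" "M \<ge> 0"
  proof -
    have "compact (G' ` K)"
      by (intro compact_continuous_image K continuous_on_subset[OF G']) simp
    then obtain B where B: "\<forall>y\<in>G' ` K. norm y \<le> B" using compact_imp_bounded bounded_iff by metis
    have "\<bar>G' x\<bar> \<le> max B 0" for x
    proof (cases "x \<in> K")
      case True
      then show ?thesis using B by (simp add: le_max_iff_disj)
    qed (simp add: G'0)
    then show thesis using that[of "max B 0"] by simp
  qed
  define K1 where "K1 = (\<lambda>(x, s). x - s *\<^sub>R e) ` (K \<times> {0..1::real})"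
  have K1: "compact K1" unfolding K1_def
    by (intro compact_continuous_image compact_Times K) (auto simp: case_prod_unfold intro!: continuous_intros)
  define q where "q n = 1 / real (Suc n)" for n
  have q: "q n > 0" "q n \<le> 1" for n by (auto simp: q_def)
  define Q where "Q n x = (G (x + q n *\<^sub>R e) - G x) / q n" for n x
  have intG: "integrable lborel G"
    by (rule integrable_continuous_compact_support[OF K continuous_on_subset[OF G] G0]) auto
  have meas: "G \<in> borel_measurable borel" using G by (intro borel_measurable_continuous_onI)
  have Gs: "continuous_on UNIV (\<lambda>x. G (x + t))" for t
    by (rule continuous_on_compose2[OF G]) (auto intro!: continuous_intros)
  have intGs: "integrable lborel (\<lambda>x. G (x + t))" for t
  proof (rule integrable_continuous_compact_support)
    show "compact ((\<lambda>x. x - t) ` K)" by (intro compact_continuous_image K continuous_intros)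
    show "continuous_on ((\<lambda>x. x - t) ` K) (\<lambda>x. G (x + t))" by (rule continuous_on_subset[OF Gs]) simp
    show "G (x + t) = 0" if "x \<notin> (\<lambda>x. x - t) ` K" for x
    proof (rule G0)
      show "x + t \<notin> K" using that by (metis add_diff_cancel_right' image_eqI)
    qed
  qed
  have intQ: "(LINT x|lborel. Q n x) = 0" for n
    unfolding Q_def using lborel_integral_shift[OF meas, of "q n *\<^sub>R e"] intG intGs by simp
  have bound: "\<bar>Q n x\<bar> \<le> indicator K1 x *\<^sub>R M" for n x
  proof -
    have "\<exists>s. s > 0 \<and> s < q n \<and> G (x + q n *\<^sub>R e) - G (x + 0 *\<^sub>R e) = (q n - 0) * G' (x + s *\<^sub>R e)"
    proof (rule MVT2)
      show "((\<lambda>s. G (x + s *\<^sub>R e)) has_real_derivative G' (x + s *\<^sub>R e)) (at s)" for s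
        using dd[of "x + s *\<^sub>R e"] by (simp add: dd_shift)
    qed (rule q)
    then obtain s where s: "0 < s" "s < q n" "Q n x = G' (x + s *\<^sub>R e)"
      using q[of n] by (auto simp: Q_def)
    show ?thesis
    proof (cases "x + s *\<^sub>R e \<in> K")
      case True
      then have "x \<in> K1" unfolding K1_def using s q[of n]
        by (intro image_eqI[of _ _ "(x + s *\<^sub>R e, s)"]) auto
      then show ?thesis using M s by simp
    next
      case False
      then show ?thesis using s G'0 M by (simp add: indicator_def)
    qed
  qed
  have "(\<lambda>n. LINT x|lborel. Q n x) \<longlonglongrightarrow> (LINT x|lborel. G' x)"
  proof (rule integral_dominated_convergence)
    show "G' \<in> borel_measurable lborel" using G' by (simp add: borel_measurable_continuous_onI)
    show "Q n \<in> borel_measurable lborel" for n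
      unfolding Q_def using Gs[of "q n *\<^sub>R e"] G q(1)[of n]
      by (auto intro!: borel_measurable_continuous_onI continuous_intros simp: less_imp_neq[symmetric])
    show "integrable lborel (\<lambda>x. indicator K1 x *\<^sub>R M)"
      using borel_integrable_compact[OF K1, of "\<lambda>_. M"] by simp
    show "AE x in lborel. norm (Q n x) \<le> indicator K1 x *\<^sub>R M" for n using bound by simp
    show "AE x in lborel. (\<lambda>n. Q n x) \<longlonglongrightarrow> G' x"
    proof (intro AE_I2)
      fix x
      have "((\<lambda>h. (G (x + h *\<^sub>R e) - G x) / h) \<longlongrightarrow> G' x) (at 0)"
        using dd[of x] unfolding dd_def DERIV_def by simp
      moreover have "filterlim q (at 0) sequentially"
      proof (subst filterlim_at, intro conjI)
        show "q \<longlonglongrightarrow> 0" unfolding q_def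
          using LIMSEQ_inverse_real_of_nat by (simp add: inverse_eq_divide)
      qed (use q in \<open>auto simp: less_imp_neq[symmetric]\<close>)
      ultimately show "(\<lambda>n. Q n x) \<longlonglongrightarrow> G' x" unfolding Q_def
        by (rule filterlim_compose[where f = q])
    qed
  qed
  then show ?thesis using intQ LIMSEQ_unique by (simp add: LIMSEQ_const_iff)
qed

lemma set_integral_dd_zero:
  fixes G G' :: "'a::euclidean_space \<Rightarrow> real"
  assumes U: "open U" and K: "compact K" "K \<subseteq> U" and G0: "\<And>x. x \<in> U \<Longrightarrow> x \<notin> K \<Longrightarrow> G x = 0"
    and G: "continuous_on U G" and G': "continuous_on U G'"
    and dd: "\<And>x. x \<in> U \<Longrightarrow> dd G e x (G' x)"
  shows "(LINT x:K|lborel. G' x) = 0"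
proof -
  have oK: "open (- K)" using K by (simp add: open_Compl compact_imp_closed)
  have G'0: "G' x = 0" if "x \<in> U" "x \<notin> K" for x
    using dd_zero_local[OF dd, of x "U \<inter> - K"] that G0 U oK by auto
  define H where "H x = (if x \<in> K then G x else 0)" for x
  define H' where "H' x = (if x \<in> K then G' x else 0)" for x
  have cont: "continuous_on UNIV (\<lambda>x. if x \<in> K then F x else 0)"
    if "continuous_on U F" "\<And>x. x \<in> U \<Longrightarrow> x \<notin> K \<Longrightarrow> F x = 0" for F :: "'a \<Rightarrow> real"
  proof -
    have "continuous_on U (\<lambda>x. if x \<in> K then F x else 0)"
      using that(1) by (rule continuous_on_eq) (use that(2) in auto)
    moreover have "continuous_on (- K) (\<lambda>x. if x \<in> K then F x else 0)"
      using continuous_on_const[of "- K" 0] by (rule continuous_on_eq) auto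
    ultimately have "continuous_on (U \<union> - K) (\<lambda>x. if x \<in> K then F x else 0)"
      using U oK by (intro continuous_on_open_Un)
    moreover have "U \<union> - K = UNIV" using K by auto
    ultimately show ?thesis by simp
  qed
  have "(LINT x|lborel. H' x) = 0"
  proof (rule integral_dd_zero[OF K(1), of H])
    show "H x = 0" if "x \<notin> K" for x using that by (simp add: H_def)
    show "continuous_on UNIV H" unfolding H_def using cont[OF G G0] .
    show "continuous_on UNIV H'" unfolding H'_def using cont[OF G' G'0] .
    show "dd H e x (H' x)" for x
    proof (cases "x \<in> U")
      case True
      have "\<forall>\<^sub>F y in nhds x. G y = H y"
        by (rule eventually_open_eq[OF U True]) (use G0 in \<open>auto simp: H_def\<close>)
      moreover have "H' x = G' x" using G'0 True by (auto simp: H'_def)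
      ultimately show ?thesis using dd[OF True] dd_cong_ev by metis
    next
      case False
      then have "x \<in> - K" using K by auto
      have "\<forall>\<^sub>F y in nhds x. (\<lambda>_. 0) y = H y"
        by (rule eventually_open_eq[OF oK \<open>x \<in> - K\<close>]) (auto simp: H_def)
      then have "dd H e x 0" by (rule dd_cong_ev[OF _ dd_const])
      then show ?thesis using \<open>x \<in> - K\<close> by (simp add: H'_def)
    qed
  qed
  moreover have "H' = (\<lambda>x. indicator K x *\<^sub>R G' x)" by (auto simp: H'_def indicator_def)
  ultimately show ?thesis by (simp add: set_lebesgue_integral_def)
qed

lemma set_integrable_compact:
  fixes f :: "'a::euclidean_space \<Rightarrow> real"
  assumes "compact K" "continuous_on K f"
  shows "set_integrable lborel K f"
  using borel_integrable_compact[OF assms] by (simp add: set_integrable_def)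

section \<open>The vorticity equation\<close>

definition D :: "'a::real_normed_vector \<Rightarrow> ('a \<Rightarrow> real) \<Rightarrow> 'a \<Rightarrow> real" where
  "D e f z = frechet_derivative f (at z) e"

abbreviation et :: "real \<times> (real^2)" where "et \<equiv> (1, 0)"
abbreviation es :: "2 \<Rightarrow> real \<times> (real^2)" where "es i \<equiv> (0, axis i 1)"

lemma et_Basis [simp]: "et \<in> Basis"
  by (simp add: Basis_prod_def)

lemma es_Basis [simp]: "es i \<in> Basis"
  by (simp add: Basis_prod_def)

lemma smooth_on_D: "b \<in> Basis \<Longrightarrow> smooth_on f S \<Longrightarrow> smooth_on (D b f) S"
  unfolding D_def[abs_def] by (rule smooth_onD(3))

lemma dd_D: "smooth_on f S \<Longrightarrow> z \<in> S \<Longrightarrow> dd f e z (D e f z)"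
  for f :: "'a::euclidean_space \<Rightarrow> real"
  unfolding D_def by (rule smooth_on_dd)

lemma D_eqI: "smooth_on f S \<Longrightarrow> z \<in> S \<Longrightarrow> dd f e z d \<Longrightarrow> D e f z = d"
  for f :: "'a::euclidean_space \<Rightarrow> real"
  using dd_D dd_unique by blast

lemma D_cong:
  assumes "open S" "z \<in> S" "\<And>y. y \<in> S \<Longrightarrow> f y = g y"
  shows "D e f z = D e g z"
  unfolding D_def
  using frechet_derivative_cong_ev[OF eventually_open_eq[OF assms(1,2), of "\<lambda>y. f y = g y"]] assms(3) by simp

lemma D_commute:
  fixes f :: "'a::euclidean_space \<Rightarrow> real"
  assumes "open S" "smooth_on f S" "z \<in> S" "a \<in> Basis" "b \<in> Basis"
  shows "D b (D a f) z = D a (D b f) z"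
  using smooth_on_mixed[OF assms] by (simp add: D_def[abs_def])

lemma D_diff:
  fixes f :: "'a::euclidean_space \<Rightarrow> real"
  assumes "open S" "smooth_on f S" "smooth_on g S" "z \<in> S"
  shows "D e (\<lambda>y. f y - g y) z = D e f z - D e g z"
  by (rule D_eqI[OF smooth_on_diff[OF assms(1-3)] assms(4)])
    (intro dd_diff dd_D[OF assms(2)] dd_D[OF assms(3)] assms(4))

lemma D_sum:
  fixes f :: "'i \<Rightarrow> 'a::euclidean_space \<Rightarrow> real"
  assumes "open S" "finite I" "\<And>i. i \<in> I \<Longrightarrow> smooth_on (f i) S" "z \<in> S"
  shows "D e (\<lambda>y. \<Sum>i\<in>I. f i y) z = (\<Sum>i\<in>I. D e (f i) z)"
  by (rule D_eqI[OF smooth_on_sum[OF assms(1-3)] assms(4)]) (auto intro!: dd_sum dd_D assms)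

lemma partial_D: "partial i f = D (axis i 1) f"
  by (simp add: partial_def[abs_def] D_def[abs_def])

lemma laplacian_D: "laplacian f x = D (axis 1 1) (D (axis 1 1) f) x + D (axis 2 1) (D (axis 2 1) f) x"
  by (simp add: laplacian_def sum_2 partial_D)

lemma slice_space:
  fixes f :: "real \<times> (real^2) \<Rightarrow> real"
  assumes "f differentiable (at (t, x))"
  shows "D e (\<lambda>y. f (t, y)) x = D (0, e) f (t, x)"
proof -
  have "(f has_derivative frechet_derivative f (at (t, x))) (at (t, x))"
    using assms frechet_derivative_works by blast
  moreover have "((\<lambda>y. (t, y)) has_derivative (\<lambda>h. (0, h))) (at x)"
    by (auto intro!: derivative_eq_intros)
  ultimately have "((\<lambda>y. f (t, y)) has_derivative (\<lambda>h. frechet_derivative f (at (t, x)) (0, h))) (at x)"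
    using diff_chain_at[of "\<lambda>y. (t, y)" "\<lambda>h. (0, h)" x f] by (simp add: o_def)
  then show ?thesis unfolding D_def by (simp add: frechet_derivative_at[symmetric])
qed

lemma slice_time:
  fixes f :: "real \<times> (real^2) \<Rightarrow> real"
  assumes "f differentiable (at (t, x))"
  shows "deriv (\<lambda>s. f (s, x)) t = D et f (t, x)"
proof -
  have "dd f et (t, x) (D et f (t, x))" unfolding D_def by (rule dd_frechet[OF assms])
  then have "((\<lambda>h. f (t + h, x)) has_real_derivative D et f (t, x)) (at 0)"
    by (simp add: dd_def)
  then have "((\<lambda>s. f (s, x)) has_real_derivative D et f (t, x)) (at t)"
    using DERIV_shift[of "\<lambda>s. f (s, x)" "D et f (t, x)" 0 t] by (simp add: add.commute)
  then show ?thesis by (rule DERIV_imp_deriv)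
qed

lemma slice_laplacian:
  fixes f :: "real \<times> (real^2) \<Rightarrow> real"
  assumes f: "smooth_on f ({0<..} \<times> \<Omega>)" and "open \<Omega>" "t > 0" "x \<in> \<Omega>"
  shows "laplacian (\<lambda>y. f (t, y)) x = D (es 1) (D (es 1) f) (t, x) + D (es 2) (D (es 2) f) (t, x)"
proof -
  have d1: "D (axis i 1) (\<lambda>y. f (t, y)) y = D (es i) f (t, y)" if "y \<in> \<Omega>" for i y
    by (rule slice_space) (use smooth_onD(2)[OF f] that assms in auto)
  have d2: "D (axis i 1) (D (axis i 1) (\<lambda>y. f (t, y))) x = D (es i) (D (es i) f) (t, x)" for i
  proof -
    have "D (axis i 1) (D (axis i 1) (\<lambda>y. f (t, y))) x = D (axis i 1) (\<lambda>y. D (es i) f (t, y)) x"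
      by (rule D_cong[OF assms(2,4)]) (rule d1)
    also have "\<dots> = D (es i) (D (es i) f) (t, x)"
      by (rule slice_space) (use smooth_onD(2)[OF smooth_on_D[OF es_Basis f]] assms in auto)
    finally show ?thesis .
  qed
  show ?thesis unfolding laplacian_D d2 ..
qed

lemma slice_grad:
  fixes f :: "real \<times> (real^2) \<Rightarrow> real"
  assumes "f differentiable (at (t, x))"
  shows "grad (\<lambda>y. f (t, y)) x $ i = D (es i) f (t, x)"
  using slice_space[OF assms] by (simp add: grad_def partial_D)

lemma inner_2: "x \<bullet> y = x $ 1 * y $ 1 + x $ 2 * y $ 2" for x y :: "real^2"
  by (simp add: inner_vec_def sum_2)

text \<open>The curl of the momentum equation: the pressure drops out because its second derivatives commute,
  and the stretching terms cancel because the velocity is divergence free.\<close>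

lemma vorticity_equation:
  assumes NSE: "NSE_solution \<nu> \<Omega> u p" and "open \<Omega>"
  defines "Z \<equiv> {0<..} \<times> \<Omega>"
    and "w \<equiv> \<lambda>z. vorticity u (fst z) (snd z)"
    and "v \<equiv> \<lambda>j z. u (fst z) (snd z) $ j"
  shows "open Z" "smooth_on w Z" "\<And>j. smooth_on (v j) Z"
    and "\<And>z. z \<in> Z \<Longrightarrow> D (es 1) (v 1) z + D (es 2) (v 2) z = 0"
    and "\<And>z. z \<in> Z \<Longrightarrow> D et w z - \<nu> * (D (es 1) (D (es 1) w) z + D (es 2) (D (es 2) w) z)
          + v 1 z * D (es 1) w z + v 2 z * D (es 2) w z = 0"
proof -
  show oZ: "open Z" unfolding Z_def using assms(2) by (intro open_Times) auto
  have "smooth_on (\<lambda>z. u (fst z) (snd z)) Z" and P: "smooth_on (\<lambda>z. p (fst z) (snd z)) Z"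
    using NSE by (auto simp: NSE_solution_def Z_def)
  then show v: "smooth_on (v j) Z" for j
    unfolding v_def by (intro smooth_on_bounded_linear[OF oZ bounded_linear_vec_nth])
  define q where "q = (\<lambda>z. p (fst z) (snd z))"
  have q: "smooth_on q Z" using P by (simp add: q_def)
  have w_eq: "w z = D (es 1) (v 2) z - D (es 2) (v 1) z" if "z \<in> Z" for z
  proof -
    have "D (axis i 1) (\<lambda>y. v j (fst z, y)) (snd z) = D (es i) (v j) (fst z, snd z)" for i j
      by (rule slice_space) (use smooth_onD(2)[OF v] that in auto)
    then show ?thesis by (simp add: w_def vorticity_def partial_D v_def)
  qed
  have Dv: "smooth_on (D b (v j)) Z" if "b \<in> Basis" for b j
    by (rule smooth_on_D[OF that v])
  have W: "smooth_on (\<lambda>z. D (es 1) (v 2) z - D (es 2) (v 1) z) Z"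
    by (intro smooth_on_diff[OF oZ] Dv) auto
  show w: "smooth_on w Z"
    by (rule smooth_on_cong[OF oZ _ W]) (simp add: w_eq)
  have NSz: "D et (v j) z - \<nu> * (D (es 1) (D (es 1) (v j)) z + D (es 2) (D (es 2) (v j)) z)
      + v 1 z * D (es 1) (v j) z + v 2 z * D (es 2) (v j) z + D (es j) q z = 0"
    and divz: "D (es 1) (v 1) z + D (es 2) (v 2) z = 0" if z: "z \<in> Z" for z j
  proof -
    obtain t x where tx: "z = (t, x)" "t > 0" "x \<in> \<Omega>" using z unfolding Z_def by auto
    have d: "f differentiable (at (t, x))" if "smooth_on f Z" for f :: "real \<times> (real^2) \<Rightarrow> real"
      using smooth_onD(2)[OF that z] tx by simp
    have N: "(\<forall>j. deriv (\<lambda>s. u s x $ j) t - \<nu> * laplacian (\<lambda>y. u t y $ j) x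
             + u t x \<bullet> grad (\<lambda>y. u t y $ j) x + partial j (p t) x = 0) \<and>
        divergence_free_at (u t) x"
      using NSE tx by (simp add: NSE_solution_def)
    have 1: "deriv (\<lambda>s. u s x $ j) t = D et (v j) z"
      using slice_time[OF d[OF v[of j]]] tx by (simp add: v_def)
    have 2: "laplacian (\<lambda>y. u t y $ j) x = D (es 1) (D (es 1) (v j)) z + D (es 2) (D (es 2) (v j)) z"
      using slice_laplacian[of "v j" \<Omega> t x] v[of j] assms(2) tx by (simp add: v_def Z_def)
    have 3: "grad (\<lambda>y. u t y $ j) x $ i = D (es i) (v j) z" for i
      using slice_grad[OF d[OF v[of j]]] tx by (simp add: v_def)
    have 4: "partial j (p t) x = D (es j) q z"
      using slice_space[OF d[OF q]] tx by (simp add: q_def partial_D)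
    have 5: "partial i (\<lambda>y. u t y $ j) x = D (es i) (v j) z" for i j
      using slice_space[OF d[OF v[of j]]] tx by (simp add: v_def partial_D)
    show "D et (v j) z - \<nu> * (D (es 1) (D (es 1) (v j)) z + D (es 2) (D (es 2) (v j)) z)
      + v 1 z * D (es 1) (v j) z + v 2 z * D (es 2) (v j) z + D (es j) q z = 0"
      using N[THEN conjunct1, rule_format, of j] tx
      unfolding 1 2 4 inner_2 3 by (simp add: v_def)
    show "D (es 1) (v 1) z + D (es 2) (v 2) z = 0"
      using N unfolding divergence_free_at_def sum_2 5 by simp
  qed
  show "D (es 1) (v 1) z + D (es 2) (v 2) z = 0" if "z \<in> Z" for z
    by (rule divz[OF that])
  show "D et w z - \<nu> * (D (es 1) (D (es 1) w) z + D (es 2) (D (es 2) w) z)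
          + v 1 z * D (es 1) w z + v 2 z * D (es 2) w z = 0" if z: "z \<in> Z" for z
  proof -
    let ?L = "\<lambda>j z. D et (v j) z - \<nu> * (D (es 1) (D (es 1) (v j)) z + D (es 2) (D (es 2) (v j)) z)
      + v 1 z * D (es 1) (v j) z + v 2 z * D (es 2) (v j) z + D (es j) q z"
    have ddv: "dd (v j) e z (D e (v j) z)" for j e by (rule dd_D[OF v z])
    have ddv1: "dd (D b (v j)) e z (D e (D b (v j)) z)" if "b \<in> Basis" for j b e
      by (rule dd_D[OF Dv[OF that] z])
    have ddv2: "dd (D a (D b (v j))) e z (D e (D a (D b (v j))) z)" if "b \<in> Basis" "a \<in> Basis" for j a b e
      by (rule dd_D[OF smooth_on_D[OF that(2) Dv[OF that(1)]] z])
    have ddq: "dd (D b q) e z (D e (D b q) z)" if "b \<in> Basis" for b e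
      by (rule dd_D[OF smooth_on_D[OF that q] z])
    have E: "D e (D et (v j)) z - \<nu> * (D e (D (es 1) (D (es 1) (v j))) z + D e (D (es 2) (D (es 2) (v j))) z)
       + (D e (v 1) z * D (es 1) (v j) z + v 1 z * D e (D (es 1) (v j)) z)
       + (D e (v 2) z * D (es 2) (v j) z + v 2 z * D e (D (es 2) (v j)) z) + D e (D (es j) q) z = 0"
      for e j
    proof -
      have "dd (?L j) e z (D e (D et (v j)) z
       - (0 * (D (es 1) (D (es 1) (v j)) z + D (es 2) (D (es 2) (v j)) z)
        + \<nu> * (D e (D (es 1) (D (es 1) (v j))) z + D e (D (es 2) (D (es 2) (v j))) z))
       + (D e (v 1) z * D (es 1) (v j) z + v 1 z * D e (D (es 1) (v j)) z)
       + (D e (v 2) z * D (es 2) (v j) z + v 2 z * D e (D (es 2) (v j)) z) + D e (D (es j) q) z)"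
        by (intro dd_add dd_diff dd_mult dd_const ddv ddv1 ddv2 ddq et_Basis es_Basis)
      moreover have "dd (?L j) e z 0"
        by (rule dd_cong_ev[OF eventually_open_eq[OF oZ z] dd_const]) (simp add: NSz)
      ultimately show ?thesis using dd_unique by fastforce
    qed
    have c3: "D (es i) (D (es i) (D (es k) (v j))) z = D (es k) (D (es i) (D (es i) (v j))) z" for i k j
    proof -
      have "D (es i) (D (es i) (D (es k) (v j))) z = D (es i) (D (es k) (D (es i) (v j))) z"
        by (rule D_cong[OF oZ z]) (rule D_commute[OF oZ v], auto)
      also have "\<dots> = D (es k) (D (es i) (D (es i) (v j))) z"
        by (rule D_commute[OF oZ Dv z]) auto
      finally show ?thesis .
    qed
    have ct: "D et (D (es k) (v j)) z = D (es k) (D et (v j)) z" for k j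
      by (rule D_commute[OF oZ v z]) auto
    have Dw: "D e w y = D e (D (es 1) (v 2)) y - D e (D (es 2) (v 1)) y" if "y \<in> Z" for e y
    proof -
      have "D e w y = D e (\<lambda>z. D (es 1) (v 2) z - D (es 2) (v 1) z) y"
        by (rule D_cong[OF oZ that]) (rule w_eq)
      also have "\<dots> = D e (D (es 1) (v 2)) y - D e (D (es 2) (v 1)) y"
        by (rule D_diff[OF oZ Dv Dv that]) auto
      finally show ?thesis .
    qed
    have DDw: "D (es i) (D (es i) w) z = D (es i) (D (es i) (D (es 1) (v 2))) z
        - D (es i) (D (es i) (D (es 2) (v 1))) z" for i
    proof -
      have "D (es i) (D (es i) w) z
          = D (es i) (\<lambda>y. D (es i) (D (es 1) (v 2)) y - D (es i) (D (es 2) (v 1)) y) z"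
        by (rule D_cong[OF oZ z]) (rule Dw)
      also have "\<dots> = D (es i) (D (es i) (D (es 1) (v 2))) z - D (es i) (D (es i) (D (es 2) (v 1))) z"
        by (rule D_diff[OF oZ smooth_on_D smooth_on_D z]) (auto intro: Dv)
      finally show ?thesis .
    qed
    have cq: "D (es 1) (D (es 2) q) z = D (es 2) (D (es 1) q) z"
      by (rule D_commute[OF oZ q z]) auto
    have c12: "D (es 1) (D (es 2) (v j)) z = D (es 2) (D (es 1) (v j)) z" for j
      by (rule D_commute[OF oZ v z]) auto
    show ?thesis
      using E[of "es 1" 2] E[of "es 2" 1] divz[OF z] cq
      unfolding Dw[OF z] DDw c3[of 1 2 1] c3[of 2 1 2] ct c12 by algebra
  qed
qed

section \<open>The localized enstrophy balance\<close>

lemma set_integral_restrict: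
  fixes f :: "'a::euclidean_space \<Rightarrow> real"
  assumes "K \<subseteq> S" "\<And>z. z \<in> S \<Longrightarrow> z \<notin> K \<Longrightarrow> f z = 0"
  shows "(LINT z:S|lborel. f z) = (LINT z:K|lborel. f z)"
proof -
  have "(\<lambda>z. indicator S z *\<^sub>R f z) = (\<lambda>z. indicator K z *\<^sub>R f z)"
    using assms by (auto simp: indicator_def fun_eq_iff)
  then show ?thesis by (simp add: set_lebesgue_integral_def)
qed

lemma set_integral_flux_zero:
  fixes G H1 H2 :: "real \<times> (real^2) \<Rightarrow> real"
  assumes U: "open U" "compact K" "K \<subseteq> U"
    and zero: "\<And>z. z \<in> U \<Longrightarrow> z \<notin> K \<Longrightarrow> G z = 0 \<and> H1 z = 0 \<and> H2 z = 0"
    and c: "continuous_on U G" "continuous_on U H1" "continuous_on U H2"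
      "continuous_on U G'" "continuous_on U H1'" "continuous_on U H2'"
    and d: "\<And>z. z \<in> U \<Longrightarrow> dd G et z (G' z)" "\<And>z. z \<in> U \<Longrightarrow> dd H1 (es 1) z (H1' z)"
      "\<And>z. z \<in> U \<Longrightarrow> dd H2 (es 2) z (H2' z)"
  shows "(LINT z:K|lborel. G' z + H1' z + H2' z) = 0"
proof -
  have "(LINT z:K|lborel. G' z) = 0"
    by (rule set_integral_dd_zero[OF U, of G G' et]) (use zero c d in simp_all)
  moreover have "(LINT z:K|lborel. H1' z) = 0"
    by (rule set_integral_dd_zero[OF U, of H1 H1' "es 1"]) (use zero c d in simp_all)
  moreover have "(LINT z:K|lborel. H2' z) = 0"
    by (rule set_integral_dd_zero[OF U, of H2 H2' "es 2"]) (use zero c d in simp_all)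
  moreover have "set_integrable lborel K G'" "set_integrable lborel K H1'" "set_integrable lborel K H2'"
    using c U(3) by (auto intro!: set_integrable_compact[OF U(2)] elim: continuous_on_subset)
  ultimately show ?thesis by simp
qed

locale flow =
  fixes \<nu> R0 \<delta> C0 T :: real and \<Omega> :: "(real^2) set"
    and u :: "real \<Rightarrow> real^2 \<Rightarrow> real^2" and p :: "real \<Rightarrow> real^2 \<Rightarrow> real"
    and \<eta> :: "real \<Rightarrow> real" and \<psi>0 :: "real^2 \<Rightarrow> real"
  assumes nu: "\<nu> > 0" and open_Omega: "open \<Omega>" and R0: "R0 > 0"
    and ball_Omega: "ball 0 (3 * R0) \<subseteq> \<Omega>"
    and NSE: "NSE_solution \<nu> \<Omega> u p"
    and delta: "1/2 \<le> \<delta>" "\<delta> < 1" and C0: "C0 > 0"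
    and main: "main_cutoff \<delta> C0 R0 \<psi>0" and time: "time_cutoff \<delta> C0 T \<eta>"
    and T: "T \<ge> R0\<^sup>2 / \<nu>"
begin

definition b :: real where "b = 2 * \<delta> - 1"

definition Z :: "(real \<times> (real^2)) set" where "Z = {0<..} \<times> \<Omega>"

definition w :: "real \<times> (real^2) \<Rightarrow> real" where "w = (\<lambda>z. vorticity u (fst z) (snd z))"

definition v :: "2 \<Rightarrow> real \<times> (real^2) \<Rightarrow> real" where "v j = (\<lambda>z. u (fst z) (snd z) $ j)"

text \<open>The compact set \<open>K\<close> carries everything that is multiplied by \<open>\<eta> \<psi>0\<close>, so all integrals
  are taken over \<open>K\<close>, where continuity suffices for integrability.\<close>

definition K :: "(real \<times> (real^2)) set" where
  "K = closure {t. \<eta> t \<noteq> 0} \<times> closure {x. \<psi>0 x \<noteq> 0}"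

definition J :: "(real \<times> (real^2) \<Rightarrow> real) \<Rightarrow> real" where "J f = (LINT z:K|lborel. f z)"

abbreviation dx :: "2 \<Rightarrow> (real^2 \<Rightarrow> real) \<Rightarrow> real^2 \<Rightarrow> real" where "dx i \<equiv> D (axis i 1)"

abbreviation sq_grad_w :: "real \<times> (real^2) \<Rightarrow> real" where
  "sq_grad_w z \<equiv> (D (es 1) w z)\<^sup>2 + (D (es 2) w z)\<^sup>2"

definition admissible :: "(real^2 \<Rightarrow> real) \<Rightarrow> bool" where
  "admissible \<psi> \<longleftrightarrow> smooth_on \<psi> UNIV \<and> (\<forall>x. 0 \<le> \<psi> x) \<and> (\<forall>x. \<psi>0 x = 0 \<longrightarrow> \<psi> x = 0)"

lemma b: "0 \<le> b" "b < 1" "b \<le> \<delta>"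
  using delta by (auto simp: b_def)

lemma T_pos: "T > 0"
proof -
  have "R0\<^sup>2 / \<nu> > 0" using nu R0 by simp
  then show ?thesis using T by linarith
qed

lemma psi0: "smooth_on \<psi>0 UNIV" "0 \<le> \<psi>0 x" "\<psi>0 x \<le> 1" "x \<in> ball 0 R0 \<Longrightarrow> \<psi>0 x = 1"
    "cutoff_bounds \<delta> C0 R0 \<psi>0" "compact (closure {x. \<psi>0 x \<noteq> 0})"
    "closure {x. \<psi>0 x \<noteq> 0} \<subseteq> ball 0 (2 * R0)"
  using main by (auto simp: main_cutoff_def test_function_def)

lemma eta: "smooth_on \<eta> UNIV" "0 \<le> \<eta> t" "\<eta> t \<le> 1" "compact (closure {t. \<eta> t \<noteq> 0})"
    "closure {t. \<eta> t \<noteq> 0} \<subseteq> {0<..<2 * T}"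
  using time by (auto simp: time_cutoff_def test_function_def)

lemma admissible_psi0: "admissible \<psi>0"
  using psi0 by (simp add: admissible_def)

lemma K: "compact K" "K \<subseteq> {0<..<2 * T} \<times> \<Omega>" "K \<subseteq> Z"
proof -
  show "compact K" unfolding K_def using eta psi0 by (intro compact_Times)
  have "ball 0 (2 * R0) \<subseteq> \<Omega>" using ball_Omega R0 by (auto simp: subset_iff)
  then show "K \<subseteq> {0<..<2 * T} \<times> \<Omega>" unfolding K_def using eta(5) psi0(7) by auto
  then show "K \<subseteq> Z" unfolding Z_def by auto
qed

lemma K_zero: "z \<notin> K \<Longrightarrow> \<eta> (fst z) = 0 \<or> \<psi>0 (snd z) = 0"
proof (rule ccontr)
  assume "z \<notin> K" "\<not> (\<eta> (fst z) = 0 \<or> \<psi>0 (snd z) = 0)"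
  then have "fst z \<in> closure {t. \<eta> t \<noteq> 0}" "snd z \<in> closure {x. \<psi>0 x \<noteq> 0}"
    using closure_subset[of "{t. \<eta> t \<noteq> 0}"] closure_subset[of "{x. \<psi>0 x \<noteq> 0}"] by auto
  then show False using \<open>z \<notin> K\<close> by (simp add: K_def mem_Times_iff)
qed

lemma vort: "open Z" "smooth_on w Z" "smooth_on (v j) Z"
    "z \<in> Z \<Longrightarrow> D (es 1) (v 1) z + D (es 2) (v 2) z = 0"
    "z \<in> Z \<Longrightarrow> D et w z - \<nu> * (D (es 1) (D (es 1) w) z + D (es 2) (D (es 2) w) z)
          + v 1 z * D (es 1) w z + v 2 z * D (es 2) w z = 0"
  unfolding Z_def w_def v_def
  using vorticity_equation[OF NSE open_Omega] by auto

lemma cont_Z [continuous_intros]: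
  "continuous_on Z w" "continuous_on Z (D (es i) w)" "continuous_on Z (D et w)"
  "continuous_on Z (D (es i) (D (es i) w))"
  "continuous_on Z (v j)" "continuous_on Z (D (es i) (v j))"
  by (auto intro!: smooth_onD(1) smooth_on_D vort)

lemma cont_eta [continuous_intros]:
  "continuous_on X (\<lambda>z. \<eta> (fst z))" "continuous_on X (\<lambda>z. deriv \<eta> (fst z))"
  and dd_eta: "dd (\<lambda>z. \<eta> (fst z)) et z (deriv \<eta> (fst z))" "dd (\<lambda>z. \<eta> (fst z)) (es i) z 0"
  and deriv_eta: "(\<eta> has_real_derivative deriv \<eta> t) (at t)"
proof -
  have d1: "dd \<eta> 1 t (D 1 \<eta> t)" for t by (rule dd_D[OF eta(1)]) simp
  then have d2: "(\<eta> has_real_derivative D 1 \<eta> t) (at t)" for t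
    using d1[of "0 + t *\<^sub>R 1"] unfolding dd_shift by simp
  then have e: "deriv \<eta> = D 1 \<eta>" by (auto intro: DERIV_imp_deriv)
  show "(\<eta> has_real_derivative deriv \<eta> t) (at t)" using d2 e by simp
  show "dd (\<lambda>z. \<eta> (fst z)) et z (deriv \<eta> (fst z))" using d1[of "fst z"] e by (simp add: dd_def)
  show "dd (\<lambda>z. \<eta> (fst z)) (es i) z 0" by (simp add: dd_def)
  show "continuous_on X (\<lambda>z. \<eta> (fst z))"
    by (rule continuous_on_compose2[OF smooth_onD(1)[OF eta(1)]]) (auto intro!: continuous_intros)
  show "continuous_on X (\<lambda>z. deriv \<eta> (fst z))" unfolding e
    by (rule continuous_on_compose2[OF smooth_onD(1)[OF smooth_on_D[OF _ eta(1)]]])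
      (auto intro!: continuous_intros)
qed

lemma cont_snd:
  fixes f :: "real^2 \<Rightarrow> real"
  assumes "continuous_on UNIV f"
  shows "continuous_on X (\<lambda>z. f (snd z))"
  by (rule continuous_on_compose2[OF assms]) (auto intro!: continuous_intros)

lemma dd_snd: "dd f e (snd z) d \<Longrightarrow> dd (\<lambda>z. f (snd z)) (0, e) z d"
  "dd (\<lambda>z. f (snd z)) et z 0"
  by (simp_all add: dd_def)

lemma cont_psi:
  assumes "smooth_on \<psi> UNIV"
  shows "continuous_on UNIV \<psi>" "continuous_on UNIV (dx i \<psi>)" "continuous_on UNIV (dx i (dx j \<psi>))"
    "continuous_on UNIV (laplacian \<psi>)"
proof -
  show "continuous_on UNIV \<psi>" "continuous_on UNIV (dx i \<psi>)"
    and *: "continuous_on UNIV (dx i (dx j \<psi>))" for i j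
    using assms by (auto intro!: smooth_onD(1) smooth_on_D)
  show "continuous_on UNIV (laplacian \<psi>)" unfolding laplacian_D[abs_def] by (intro continuous_intros *)
qed

text \<open>A nonnegative function has a minimum at each of its zeros.\<close>

lemma min_zero_grad:
  assumes "smooth_on \<psi> UNIV" "\<And>x. 0 \<le> \<psi> x" "\<psi> x = 0"
  shows "dx i \<psi> x = 0"
proof -
  have "dd \<psi> (axis i 1) x (dx i \<psi> x)" by (rule dd_D[OF assms(1)]) simp
  then show ?thesis unfolding dd_def
    by (rule DERIV_local_min[of _ _ 0 1]) (use assms in auto)
qed

lemma deriv_eta_bound: "\<bar>deriv \<eta> t\<bar> \<le> C0 / T * \<eta> t powr \<delta>"
proof (cases "\<eta> t = 0")
  case True
  have "deriv \<eta> t = 0"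
    by (rule DERIV_local_min[OF deriv_eta, of 1]) (use True eta(2) in auto)
  then show ?thesis using True by simp
next
  case False
  then have "\<eta> t powr \<delta> > 0" by simp
  moreover have "\<bar>deriv \<eta> t\<bar> / \<eta> t powr \<delta> \<le> C0 / T"
    using False time by (simp add: time_cutoff_def)
  ultimately show ?thesis by (simp add: pos_divide_le_eq)
qed

lemma admissible_zero: "admissible \<psi> \<Longrightarrow> z \<notin> K \<Longrightarrow> \<eta> (fst z) * \<psi> (snd z) = 0"
  "admissible \<psi> \<Longrightarrow> z \<notin> K \<Longrightarrow> \<eta> (fst z) * dx i \<psi> (snd z) = 0"
proof -
  show "\<eta> (fst z) * \<psi> (snd z) = 0" if "admissible \<psi>" "z \<notin> K"
    using K_zero[OF that(2)] that(1) unfolding admissible_def by auto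
  show "\<eta> (fst z) * dx i \<psi> (snd z) = 0" if "admissible \<psi>" "z \<notin> K"
  proof (cases "\<eta> (fst z) = 0")
    case False
    then have "\<psi> (snd z) = 0" using K_zero[OF that(2)] that(1) unfolding admissible_def by auto
    then have "dx i \<psi> (snd z) = 0"
      using that(1) unfolding admissible_def by (intro min_zero_grad) auto
    then show ?thesis by simp
  qed simp
qed

lemma J_add: "continuous_on K f \<Longrightarrow> continuous_on K g \<Longrightarrow> J (\<lambda>z. f z + g z) = J f + J g"
  unfolding J_def by (intro set_integral_add set_integrable_compact K)

lemma J_diff: "continuous_on K f \<Longrightarrow> continuous_on K g \<Longrightarrow> J (\<lambda>z. f z - g z) = J f - J g"
  unfolding J_def by (intro set_integral_diff set_integrable_compact K)

lemma J_cmult: "J (\<lambda>z. c * f z) = c * J f"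
  unfolding J_def by simp

lemma J_sum: "finite I \<Longrightarrow> (\<And>i. i \<in> I \<Longrightarrow> continuous_on K (f i)) \<Longrightarrow> J (\<lambda>z. \<Sum>i\<in>I. f i z) = (\<Sum>i\<in>I. J (f i))"
proof (induction I rule: finite_induct)
  case (insert i I)
  then show ?case by (simp add: J_add continuous_on_sum)
qed (simp add: J_def)

lemma J_cong: "(\<And>z. z \<in> K \<Longrightarrow> f z = g z) \<Longrightarrow> J f = J g"
  unfolding J_def by (rule set_lebesgue_integral_cong) (use K in \<open>auto intro: borel_compact\<close>)

lemma spacetime_integral_J:
  assumes "\<And>z. z \<notin> K \<Longrightarrow> f (fst z) (snd z) = 0"
  shows "spacetime_integral T \<Omega> f = J (\<lambda>z. f (fst z) (snd z))"
  unfolding spacetime_integral_def J_def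
  by (rule set_integral_restrict) (use K assms in auto)

lemma grad_cmult:
  assumes "smooth_on \<psi> UNIV"
  shows "grad (\<lambda>x. c * \<psi> x) x $ i = c * dx i \<psi> x"
proof -
  have "smooth_on (\<lambda>x. c * \<psi> x) UNIV"
    by (rule smooth_on_bounded_linear[OF _ bounded_linear_mult_right assms]) simp
  moreover have "dd (\<lambda>x. c * \<psi> x) (axis i 1) x (0 * \<psi> x + c * dx i \<psi> x)"
    by (intro dd_mult dd_const dd_D[OF assms]) simp
  ultimately have "dx i (\<lambda>x. c * \<psi> x) x = c * dx i \<psi> x"
    using D_eqI by fastforce
  then show ?thesis by (simp add: grad_def partial_D)
qed

definition flux :: "(real^2 \<Rightarrow> real) \<Rightarrow> real" where
  "flux \<psi> = J (\<lambda>z. 1/2 * (w z)\<^sup>2 * (\<eta> (fst z) * (v 1 z * dx 1 \<psi> (snd z) + v 2 z * dx 2 \<psi> (snd z))))"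

lemma local_flux_eq:
  assumes "admissible \<psi>"
  shows "local_flux T \<Omega> u (spacetime_cutoff \<eta> \<psi>) = 1 / T * flux \<psi>"
proof -
  have s: "smooth_on \<psi> UNIV" using assms by (simp add: admissible_def)
  have g: "u t x \<bullet> grad (spacetime_cutoff \<eta> \<psi> t) x
      = \<eta> t * (v 1 (t, x) * dx 1 \<psi> x + v 2 (t, x) * dx 2 \<psi> x)" for t x
    unfolding spacetime_cutoff_def[abs_def] inner_2 grad_cmult[OF s] by (simp add: v_def algebra_simps)
  have z: "\<eta> (fst z) * (v 1 z * dx 1 \<psi> (snd z) + v 2 z * dx 2 \<psi> (snd z)) = 0" if "z \<notin> K" for z
    using admissible_zero(2)[OF assms that, of 1] admissible_zero(2)[OF assms that, of 2]
    by auto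
  show ?thesis unfolding local_flux_def flux_def g
    by (subst spacetime_integral_J) (use z in \<open>simp_all add: w_def\<close>)
qed

text \<open>The divergence of \<open>\<omega>\<^sup>2 (\<eta> \<psi>, v \<eta> \<psi>) - 2 \<nu> \<omega> \<nabla>\<omega> \<eta> \<psi> + \<nu> \<omega>\<^sup>2 \<eta> \<nabla>\<psi>\<close> has integral
  zero; expanding it with the vorticity equation gives twice the balance.\<close>

lemma enstrophy_balance:
  assumes "admissible \<psi>"
  shows "flux \<psi> = \<nu> * J (\<lambda>z. sq_grad_w z * (\<eta> (fst z) * \<psi> (snd z)))
     - J (\<lambda>z. 1/2 * (w z)\<^sup>2 * (deriv \<eta> (fst z) * \<psi> (snd z) + \<nu> * (\<eta> (fst z) * laplacian \<psi> (snd z))))"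
proof -
  have s: "smooth_on \<psi> UNIV" using assms by (simp add: admissible_def)
  note [continuous_intros] = cont_snd[OF cont_psi(1)[OF s]] cont_snd[OF cont_psi(2)[OF s]]
    cont_snd[OF cont_psi(3)[OF s]] cont_snd[OF cont_psi(4)[OF s]]
  let ?\<eta> = "\<lambda>z::real \<times> (real^2). \<eta> (fst z)" and ?\<psi> = "\<lambda>z::real \<times> (real^2). \<psi> (snd z)"
  let ?d\<psi> = "\<lambda>i z::real \<times> (real^2). dx i \<psi> (snd z)" and ?dd\<psi> = "\<lambda>i z::real \<times> (real^2). dx i (dx i \<psi>) (snd z)"
  let ?\<eta>' = "\<lambda>z::real \<times> (real^2). deriv \<eta> (fst z)"
  let ?G = "\<lambda>z. (w z * w z) * (?\<eta> z * ?\<psi> z)"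
  let ?H = "\<lambda>i z. (w z * w z) * (v i z * (?\<eta> z * ?\<psi> z)) - 2 * \<nu> * (w z * (D (es i) w z * (?\<eta> z * ?\<psi> z)))
    + \<nu> * ((w z * w z) * (?\<eta> z * ?d\<psi> i z))"
  let ?G' = "\<lambda>z. 2 * w z * D et w z * (?\<eta> z * ?\<psi> z) + (w z * w z) * (?\<eta>' z * ?\<psi> z)"
  let ?H' = "\<lambda>i z. 2 * w z * D (es i) w z * v i z * (?\<eta> z * ?\<psi> z) + (w z * w z) * D (es i) (v i) z * (?\<eta> z * ?\<psi> z)
     + (w z * w z) * v i z * (?\<eta> z * ?d\<psi> i z)
     - 2 * \<nu> * ((D (es i) w z)\<^sup>2 * (?\<eta> z * ?\<psi> z) + w z * D (es i) (D (es i) w) z * (?\<eta> z * ?\<psi> z))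
     + \<nu> * ((w z * w z) * (?\<eta> z * ?dd\<psi> i z))"
  have ddw: "dd w e z (D e w z)" "dd (v j) e z (D e (v j) z)"
    "dd (D (es i) w) e z (D e (D (es i) w) z)" if "z \<in> Z" for e z j i
    using that by (auto intro!: dd_D vort smooth_on_D)
  have ddp: "dd ?\<psi> (es i) z (?d\<psi> i z)" "dd (?d\<psi> i) (es i) z (?dd\<psi> i z)" for i z
    by (auto intro!: dd_snd dd_D[of _ UNIV] smooth_on_D s)
  have zero: "?\<eta> z * ?\<psi> z = 0" "?\<eta> z * ?d\<psi> i z = 0" if "z \<notin> K" for z i
    using admissible_zero[OF assms that] by auto
  have ddH: "dd (?H i) (es i) z (?H' i z)" if z: "z \<in> Z" for z i
    proof -
      have "dd (?H i) (es i) z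
        (((D (es i) w z * w z + w z * D (es i) w z) * (v i z * (?\<eta> z * ?\<psi> z))
          + (w z * w z) * (D (es i) (v i) z * (?\<eta> z * ?\<psi> z) + v i z * (0 * ?\<psi> z + ?\<eta> z * ?d\<psi> i z)))
         - (0 * (w z * (D (es i) w z * (?\<eta> z * ?\<psi> z)))
           + 2 * \<nu> * (D (es i) w z * (D (es i) w z * (?\<eta> z * ?\<psi> z))
             + w z * (D (es i) (D (es i) w) z * (?\<eta> z * ?\<psi> z)
               + D (es i) w z * (0 * ?\<psi> z + ?\<eta> z * ?d\<psi> i z))))
         + (0 * ((w z * w z) * (?\<eta> z * ?d\<psi> i z))
           + \<nu> * ((D (es i) w z * w z + w z * D (es i) w z) * (?\<eta> z * ?d\<psi> i z)
             + (w z * w z) * (0 * ?d\<psi> i z + ?\<eta> z * ?dd\<psi> i z))))"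
        by (intro dd_add dd_diff dd_mult dd_const ddw z dd_eta ddp)
      then show ?thesis by (rule back_subst[where P = "dd (?H i) (es i) z"])
        (simp add: algebra_simps power2_eq_square)
    qed
  have "(LINT z:K|lborel. ?G' z + ?H' 1 z + ?H' 2 z) = 0"
  proof (rule set_integral_flux_zero[OF vort(1) K(1,3)])
    show "dd ?G et z (?G' z)" if z: "z \<in> Z" for z
    proof -
      have "dd ?G et z ((D et w z * w z + w z * D et w z) * (?\<eta> z * ?\<psi> z)
          + (w z * w z) * (?\<eta>' z * ?\<psi> z + ?\<eta> z * 0))"
        by (intro dd_mult ddw z dd_eta dd_snd)
      then show ?thesis by (rule back_subst[where P = "dd ?G et z"]) (simp add: algebra_simps)
    qed
    show "dd (?H 1) (es 1) z (?H' 1 z)" "dd (?H 2) (es 2) z (?H' 2 z)" if "z \<in> Z" for z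
      by (rule ddH[OF that])+
    show "?G z = 0 \<and> ?H 1 z = 0 \<and> ?H 2 z = 0" if "z \<notin> K" for z
      unfolding zero[OF that] by simp
    show "continuous_on Z ?G" "continuous_on Z (?H 1)" "continuous_on Z (?H 2)"
      "continuous_on Z ?G'" "continuous_on Z (?H' 1)" "continuous_on Z (?H' 2)"
      by (intro continuous_intros)+
  qed
  moreover have "J (\<lambda>z. ?G' z + ?H' 1 z + ?H' 2 z) = J (\<lambda>z.
      2 * (1/2 * (w z)\<^sup>2 * (?\<eta> z * (v 1 z * ?d\<psi> 1 z + v 2 z * ?d\<psi> 2 z)))
      + 2 * (1/2 * (w z)\<^sup>2 * (?\<eta>' z * ?\<psi> z + \<nu> * (?\<eta> z * laplacian \<psi> (snd z))))
      - (2 * \<nu>) * (sq_grad_w z * (?\<eta> z * ?\<psi> z)))"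
  proof (rule J_cong)
    fix z assume "z \<in> K"
    then have z: "z \<in> Z" using K by auto
    show "?G' z + ?H' 1 z + ?H' 2 z = 
      2 * (1/2 * (w z)\<^sup>2 * (?\<eta> z * (v 1 z * ?d\<psi> 1 z + v 2 z * ?d\<psi> 2 z)))
      + 2 * (1/2 * (w z)\<^sup>2 * (?\<eta>' z * ?\<psi> z + \<nu> * (?\<eta> z * laplacian \<psi> (snd z))))
      - (2 * \<nu>) * (sq_grad_w z * (?\<eta> z * ?\<psi> z))"
      using vort(4,5)[OF z] unfolding laplacian_D by algebra
  qed
  ultimately have "2 * flux \<psi>
      + 2 * J (\<lambda>z. 1/2 * (w z)\<^sup>2 * (?\<eta>' z * ?\<psi> z + \<nu> * (?\<eta> z * laplacian \<psi> (snd z))))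
      - (2 * \<nu>) * J (\<lambda>z. sq_grad_w z * (?\<eta> z * ?\<psi> z)) = 0"
    unfolding flux_def J_cmult[symmetric]
    by (subst J_add[symmetric] J_diff[symmetric];
      (intro continuous_on_subset[OF _ K(3)] continuous_intros)?)+
      (simp add: J_def)
  then show ?thesis by simp
qed

section \<open>A divergence identity and the zero set of a cut-off\<close>

lemma J_mono_AE:
  assumes "set_integrable lborel K f" "set_integrable lborel K g"
    and "AE z in lborel. z \<in> K \<longrightarrow> f z \<le> g z"
  shows "J f \<le> J g"
  unfolding J_def using assms by (intro set_integral_mono_AE) auto

lemma weighted_divergence_zero:
  fixes V1 V2 V1' V2' :: "real^2 \<Rightarrow> real"
  assumes V: "\<And>x. dd V1 (axis 1 1) x (V1' x)" "\<And>x. dd V2 (axis 2 1) x (V2' x)"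
    and c: "continuous_on UNIV V1" "continuous_on UNIV V2" "continuous_on UNIV V1'" "continuous_on UNIV V2'"
    and zero: "\<And>x. \<psi>0 x = 0 \<Longrightarrow> V1 x = 0 \<and> V2 x = 0"
  shows "J (\<lambda>z. \<eta> (fst z) * (2 * w z * (D (es 1) w z * V1 (snd z) + D (es 2) w z * V2 (snd z))
      + (w z)\<^sup>2 * (V1' (snd z) + V2' (snd z)))) = 0"
proof -
  note [continuous_intros] = cont_snd[OF c(1)] cont_snd[OF c(2)] cont_snd[OF c(3)] cont_snd[OF c(4)]
  have ddw: "dd w e z (D e w z)" if "z \<in> Z" for e z
    using that by (auto intro!: dd_D vort)
  have z0: "\<eta> (fst z) * V1 (snd z) = 0 \<and> \<eta> (fst z) * V2 (snd z) = 0" if "z \<notin> K" for z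
    using K_zero[OF that] zero by auto
  let ?H' = "\<lambda>i V V' z::real \<times> (real^2). \<eta> (fst z) * (2 * w z * (D (es i) w z * V (snd z)) + (w z)\<^sup>2 * V' (snd z))"
  have *: "J (?H' i V V') = 0"
    if V: "\<And>x. dd V (axis i 1) x (V' x)" and c: "continuous_on UNIV V" "continuous_on UNIV V'"
      and z0: "\<And>z. z \<notin> K \<Longrightarrow> \<eta> (fst z) * V (snd z) = 0" for i V V'
    unfolding J_def
  proof (rule set_integral_dd_zero[OF vort(1) K(1,3), where G = "\<lambda>z. (w z * w z) * (\<eta> (fst z) * V (snd z))" and e = "es i"])
    note [continuous_intros] = cont_snd[OF c(1)] cont_snd[OF c(2)]
    show "(w z * w z) * (\<eta> (fst z) * V (snd z)) = 0" if "z \<notin> K" for z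
      unfolding z0[OF that] by simp
    show "continuous_on Z (\<lambda>z. (w z * w z) * (\<eta> (fst z) * V (snd z)))" by (intro continuous_intros)
    show "continuous_on Z (?H' i V V')" by (intro continuous_intros)
    show "dd (\<lambda>z. (w z * w z) * (\<eta> (fst z) * V (snd z))) (es i) z (?H' i V V' z)" if "z \<in> Z" for z
    proof -
      have "dd (\<lambda>z. (w z * w z) * (\<eta> (fst z) * V (snd z))) (es i) z
        ((D (es i) w z * w z + w z * D (es i) w z) * (\<eta> (fst z) * V (snd z))
         + (w z * w z) * (0 * V (snd z) + \<eta> (fst z) * V' (snd z)))"
        by (intro dd_mult ddw that dd_eta dd_snd V)
      then show ?thesis by (rule back_subst[where P = "dd _ (es i) z"])
        (simp add: algebra_simps power2_eq_square)
    qed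
  qed
  have "J (\<lambda>z. ?H' 1 V1 V1' z + ?H' 2 V2 V2' z) = 0"
    using *[OF V(1) c(1,3)] *[OF V(2) c(2,4)] z0
    by (subst J_add; (intro continuous_on_subset[OF _ K(3)] continuous_intros)?) simp
  then show ?thesis by (simp add: algebra_simps)
qed

text \<open>On the zero set of \<open>g\<close> the derivative of \<open>g\<close> vanishes almost everywhere: integrate the derivative
  of the bounded function \<open>\<epsilon> arctan (g / \<epsilon>)\<close>, which is small with \<open>\<epsilon>\<close>, against \<open>\<partial>g\<close>.\<close>

lemma derivative_zero_on_zero_set:
  assumes "admissible \<psi>"
  shows "AE z in lborel. z \<in> K \<longrightarrow> \<eta> (fst z) \<noteq> 0 \<longrightarrow> dx i \<psi> (snd z) = 0 \<longrightarrow> dx i (dx i \<psi>) (snd z) = 0"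
proof -
  have s: "smooth_on \<psi> UNIV" using assms by (simp add: admissible_def)
  have s1: "smooth_on (dx i \<psi>) UNIV" and s2: "smooth_on (dx i (dx i \<psi>)) UNIV"
    and s3: "smooth_on (dx i (dx i (dx i \<psi>))) UNIV"
    by (intro smooth_on_D s; simp)+
  let ?g = "\<lambda>z::real \<times> (real^2). dx i \<psi> (snd z)" and ?g' = "\<lambda>z::real \<times> (real^2). dx i (dx i \<psi>) (snd z)"
  let ?g'' = "\<lambda>z::real \<times> (real^2). dx i (dx i (dx i \<psi>)) (snd z)"
  note [continuous_intros] = cont_snd[OF smooth_onD(1)[OF s1]] cont_snd[OF smooth_onD(1)[OF s2]]
    cont_snd[OF smooth_onD(1)[OF s3]]
  let ?I = "\<lambda>z. indicator {z. ?g z = 0} z :: real"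
  define A where "A = J (\<lambda>z. \<bar>\<eta> (fst z) * ?g'' z\<bar>)"
  have [measurable]: "K \<in> sets borel" using K by (simp add: borel_compact)
  have [measurable]: "(\<lambda>z. ?g z) \<in> borel_measurable borel" "(\<lambda>z. ?g' z) \<in> borel_measurable borel"
    "(\<lambda>z::real \<times> (real^2). \<eta> (fst z)) \<in> borel_measurable borel"
    by (intro borel_measurable_continuous_onI continuous_intros)+
  have int1: "set_integrable lborel K (\<lambda>z. \<eta> (fst z) * (?g' z)\<^sup>2)"
    by (intro set_integrable_compact K continuous_intros)
  have intI: "set_integrable lborel K (\<lambda>z. \<eta> (fst z) * (?g' z)\<^sup>2 * ?I z)"
  proof (rule set_integrable_bound[OF int1])
    show "set_borel_measurable lborel K (\<lambda>z. \<eta> (fst z) * (?g' z)\<^sup>2 * ?I z)"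
      unfolding set_borel_measurable_def by measurable
    show "AE z in lborel. z \<in> K \<longrightarrow> norm (\<eta> (fst z) * (?g' z)\<^sup>2 * ?I z) \<le> norm (\<eta> (fst z) * (?g' z)\<^sup>2)"
      by (auto simp: indicator_def)
  qed
  have bound: "J (\<lambda>z. \<eta> (fst z) * (?g' z)\<^sup>2 * ?I z) \<le> \<epsilon> * (2 * A)" if e: "\<epsilon> > 0" for \<epsilon>
  proof -
    let ?a = "\<lambda>z. \<eta> (fst z) * (?g'' z * (\<epsilon> * arctan (?g z / \<epsilon>)))"
    let ?b = "\<lambda>z. \<eta> (fst z) * ((?g' z)\<^sup>2 / (1 + (?g z / \<epsilon>)\<^sup>2))"
    have pos: "1 + (r / \<epsilon>)\<^sup>2 \<noteq> 0" for r using zero_le_power2[of "r / \<epsilon>"] by linarith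
    have "J (\<lambda>z. ?a z + ?b z) = 0"
      unfolding J_def
    proof (rule set_integral_dd_zero[OF vort(1) K(1,3),
          where G = "\<lambda>z. \<eta> (fst z) * (?g' z * (\<epsilon> * arctan (?g z / \<epsilon>)))" and e = "es i"])
      show "\<eta> (fst z) * (?g' z * (\<epsilon> * arctan (?g z / \<epsilon>))) = 0" if "z \<notin> K" for z
        using admissible_zero(2)[OF assms that, of i] by auto
      show "continuous_on Z (\<lambda>z. \<eta> (fst z) * (?g' z * (\<epsilon> * arctan (?g z / \<epsilon>))))"
        "continuous_on Z (\<lambda>z. ?a z + ?b z)"
        using e pos by (auto intro!: continuous_intros)
      show "dd (\<lambda>z. \<eta> (fst z) * (?g' z * (\<epsilon> * arctan (?g z / \<epsilon>)))) (es i) z (?a z + ?b z)" for z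
      proof -
        have F: "((\<lambda>r. \<epsilon> * arctan (r / \<epsilon>)) has_real_derivative (1 / (1 + (r / \<epsilon>)\<^sup>2))) (at r)" for r
        proof -
          have "((\<lambda>r. \<epsilon> * arctan (r / \<epsilon>)) has_real_derivative
              \<epsilon> * (inverse (1 + (r / \<epsilon>)\<^sup>2) * (1 / \<epsilon>))) (at r)"
            using DERIV_chain2[OF DERIV_arctan DERIV_cdivide[OF DERIV_ident], of \<epsilon> r UNIV]
            by (rule DERIV_cmult)
          then show ?thesis using e by (simp add: inverse_eq_divide)
        qed
        have "dd (\<lambda>z. \<eta> (fst z) * (?g' z * (\<epsilon> * arctan (?g z / \<epsilon>)))) (es i) z
          (0 * (?g' z * (\<epsilon> * arctan (?g z / \<epsilon>)))
           + \<eta> (fst z) * (?g'' z * (\<epsilon> * arctan (?g z / \<epsilon>))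
              + ?g' z * ((1 / (1 + (?g z / \<epsilon>)\<^sup>2)) * ?g' z)))"
          by (intro dd_mult dd_eta dd_snd dd_compose[OF _ F] dd_D[OF s1] dd_D[OF s2]) auto
        then show ?thesis by (rule back_subst[where P = "dd _ (es i) z"])
          (simp add: algebra_simps power2_eq_square)
      qed
    qed
    moreover have ca: "continuous_on K ?a" and cb: "continuous_on K ?b"
      using e pos by (auto intro!: continuous_intros)
    ultimately have "J ?b = - J ?a" using J_add[OF ca cb] by simp
    also have "\<dots> = J (\<lambda>z. (- 1) * ?a z)" unfolding J_cmult by simp
    also have "\<dots> \<le> J (\<lambda>z. (2 * \<epsilon>) * \<bar>\<eta> (fst z) * ?g'' z\<bar>)"
    proof (rule J_mono_AE)
      show "set_integrable lborel K (\<lambda>z. (- 1) * ?a z)" "set_integrable lborel K (\<lambda>z. (2 * \<epsilon>) * \<bar>\<eta> (fst z) * ?g'' z\<bar>)"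
        using e by (intro set_integrable_compact K continuous_intros ca; simp)+
      show "AE z in lborel. z \<in> K \<longrightarrow> (- 1) * ?a z \<le> (2 * \<epsilon>) * \<bar>\<eta> (fst z) * ?g'' z\<bar>"
      proof (intro AE_I2 impI)
        fix z
        have at: "\<bar>arctan (?g z / \<epsilon>)\<bar> \<le> 2"
          using arctan_bounded[of "?g z / \<epsilon>"] pi_less_4 by (simp add: abs_le_iff)
        have "(- 1) * ?a z \<le> \<bar>?a z\<bar>" by simp
        also have "\<dots> = \<bar>\<eta> (fst z) * ?g'' z\<bar> * (\<epsilon> * \<bar>arctan (?g z / \<epsilon>)\<bar>)"
          using e by (simp add: abs_mult mult_ac)
        also have "\<dots> \<le> \<bar>\<eta> (fst z) * ?g'' z\<bar> * (\<epsilon> * 2)"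
          using e at by (intro mult_left_mono) auto
        finally show "(- 1) * ?a z \<le> (2 * \<epsilon>) * \<bar>\<eta> (fst z) * ?g'' z\<bar>" by (simp add: mult_ac)
      qed
    qed
    also have "\<dots> = \<epsilon> * (2 * A)" unfolding J_cmult A_def by simp
    finally have "J ?b \<le> \<epsilon> * (2 * A)" .
    moreover have "J (\<lambda>z. \<eta> (fst z) * (?g' z)\<^sup>2 * ?I z) \<le> J ?b"
      by (rule J_mono_AE[OF intI set_integrable_compact[OF K(1) cb]])
        (use eta(2) in \<open>auto simp: indicator_def\<close>)
    ultimately show ?thesis by linarith
  qed
  have "J (\<lambda>z. \<eta> (fst z) * (?g' z)\<^sup>2 * ?I z) \<le> 0"
  proof (rule field_le_epsilon)
    fix e :: real assume "e > 0"
    have "0 \<le> A" unfolding A_def J_def set_lebesgue_integral_def by (intro integral_nonneg_AE) auto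
    then have "e / (2 * A + 1) * (2 * A) \<le> e" "e / (2 * A + 1) > 0"
      using \<open>e > 0\<close> by (simp_all add: divide_simps)
    then show "J (\<lambda>z. \<eta> (fst z) * (?g' z)\<^sup>2 * ?I z) \<le> 0 + e"
      using bound[of "e / (2 * A + 1)"] by linarith
  qed
  moreover have nn: "0 \<le> indicator K z *\<^sub>R (\<eta> (fst z) * (?g' z)\<^sup>2 * ?I z)" for z
    using eta(2) by simp
  ultimately have "integral\<^sup>L lborel (\<lambda>z. indicator K z *\<^sub>R (\<eta> (fst z) * (?g' z)\<^sup>2 * ?I z)) = 0"
    unfolding J_def set_lebesgue_integral_def by (intro antisym integral_nonneg_AE) auto
  then have "AE z in lborel. indicator K z *\<^sub>R (\<eta> (fst z) * (?g' z)\<^sup>2 * ?I z) = 0"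
    using integral_nonneg_eq_0_iff_AE[OF intI[unfolded set_integrable_def]] nn by simp
  then show ?thesis by (rule AE_mp) (auto simp: indicator_def)
qed

text \<open>Where \<open>\<psi>0\<close> vanishes the error terms cannot be compared with powers of \<open>\<psi>0\<close>.  There \<open>\<psi>\<close> is
  minimal, so its gradient vanishes, and then so do the second derivatives at almost all such points.\<close>

lemma laplacian_zero_on_zero_set:
  assumes "admissible \<psi>"
  shows "AE z in lborel. z \<in> K \<longrightarrow> \<eta> (fst z) \<noteq> 0 \<longrightarrow> \<psi>0 (snd z) = 0 \<longrightarrow> laplacian \<psi> (snd z) = 0"
  using derivative_zero_on_zero_set[OF assms, of 1] derivative_zero_on_zero_set[OF assms, of 2]
proof eventually_elim
  case (elim z)
  have "dx i \<psi> (snd z) = 0" if "\<psi>0 (snd z) = 0" for i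
    using assms that unfolding admissible_def by (intro min_zero_grad) auto
  then show ?case using elim by (auto simp: laplacian_D)
qed

section \<open>Weighted enstrophy\<close>

definition e_dens :: "real \<times> (real^2) \<Rightarrow> real" where
  "e_dens z = 1/2 * (w z)\<^sup>2 * (\<eta> (fst z) * \<psi>0 (snd z)) powr b"

definition E_tot :: real where "E_tot = J e_dens"

text \<open>The part of the enstrophy beyond the ball of radius \<open>R0\<close> is tracked separately, because only there does
  \<open>\<Delta>\<psi>0\<close> contribute to the error.\<close>

definition E_out :: real where "E_out = J (\<lambda>z. e_dens z * indicator {z. R0 \<le> norm (snd z)} z)"

lemma meas_w: "(\<lambda>z. indicator K z *\<^sub>R w z) \<in> borel_measurable borel"
  using K cont_Z(1) by (intro borel_measurable_continuous_on_indicator) (auto intro: borel_compact continuous_on_subset)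

lemma e_dens_nonneg: "0 \<le> e_dens z"
  by (simp add: e_dens_def)

lemma e_dens_int: "set_integrable lborel K e_dens"
  "set_integrable lborel K (\<lambda>z. e_dens z * indicator {z. R0 \<le> norm (snd z)} z)"
proof -
  have cw: "continuous_on K w" using cont_Z(1) K continuous_on_subset by blast
  have 1: "set_integrable lborel K (\<lambda>z. 1/2 * (w z)\<^sup>2)"
    by (intro set_integrable_compact K continuous_intros cw)
  note [measurable] = meas_w
  have [measurable]: "(\<lambda>z::real \<times> (real^2). \<eta> (fst z)) \<in> borel_measurable borel"
    "(\<lambda>z::real \<times> (real^2). \<psi>0 (snd z)) \<in> borel_measurable borel"
    by (intro borel_measurable_continuous_onI continuous_intros cont_snd cont_psi psi0)+
  have [measurable]: "{z::real \<times> (real^2). R0 \<le> norm (snd z)} \<in> sets borel"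
    by (intro borel_closed closed_Collect_le continuous_intros)
  have eq: "(\<lambda>z. indicator K z *\<^sub>R e_dens z)
      = (\<lambda>z. 1/2 * (indicator K z *\<^sub>R w z)\<^sup>2 * (\<eta> (fst z) * \<psi>0 (snd z)) powr b)"
    by (auto simp: e_dens_def indicator_def fun_eq_iff)
  have m: "(\<lambda>z. indicator K z *\<^sub>R e_dens z) \<in> borel_measurable borel" unfolding eq by measurable
  have le: "(\<eta> t * \<psi>0 x) powr b \<le> 1" for t x
    using eta psi0 b by (intro powr_le1) (auto intro: mult_le_one)
  show "set_integrable lborel K e_dens"
  proof (rule set_integrable_bound[OF 1])
    show "set_borel_measurable lborel K e_dens" using m by (simp add: set_borel_measurable_def)
    show "AE z in lborel. z \<in> K \<longrightarrow> norm (e_dens z) \<le> norm (1/2 * (w z)\<^sup>2)"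
      using le by (auto simp: e_dens_def abs_mult intro!: mult_left_le)
  qed
  note [measurable] = m
  show "set_integrable lborel K (\<lambda>z. e_dens z * indicator {z. R0 \<le> norm (snd z)} z)"
  proof (rule set_integrable_bound[OF \<open>set_integrable lborel K e_dens\<close>])
    have "(\<lambda>z. (indicator K z *\<^sub>R e_dens z) * indicator {z. R0 \<le> norm (snd z)} z) \<in> borel_measurable borel"
      by measurable
    then show "set_borel_measurable lborel K (\<lambda>z. e_dens z * indicator {z. R0 \<le> norm (snd z)} z)"
      by (simp add: set_borel_measurable_def mult.assoc)
  qed (auto simp: indicator_def)
qed

lemma E_bounds: "0 \<le> E_out" "E_out \<le> E_tot"
proof -
  show "0 \<le> E_out" unfolding E_out_def J_def set_lebesgue_integral_def
    using e_dens_nonneg by (intro integral_nonneg_AE) auto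
  show "E_out \<le> E_tot" unfolding E_out_def E_tot_def
    by (rule J_mono_AE[OF e_dens_int(2,1)]) (use e_dens_nonneg in \<open>auto simp: indicator_def\<close>)
qed

lemma J_le_E:
  assumes c: "continuous_on K f"
    and le: "\<And>z. z \<in> K \<Longrightarrow> \<eta> (fst z) \<noteq> 0 \<Longrightarrow> \<psi>0 (snd z) \<noteq> 0 \<Longrightarrow>
      f z \<le> (if R0 \<le> norm (snd z) then wo else wi) * e_dens z"
    and zero: "AE z in lborel. z \<in> K \<longrightarrow> \<eta> (fst z) = 0 \<or> \<psi>0 (snd z) = 0 \<longrightarrow> f z \<le> 0"
  shows "J f \<le> wi * E_tot + (wo - wi) * E_out"
proof -
  let ?o = "\<lambda>z::real \<times> (real^2). e_dens z * indicator {z. R0 \<le> norm (snd z)} z"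
  have i1: "set_integrable lborel K (\<lambda>z. wi * e_dens z)" "set_integrable lborel K (\<lambda>z. (wo - wi) * ?o z)"
    using e_dens_int by auto
  have "J f \<le> J (\<lambda>z. wi * e_dens z + (wo - wi) * ?o z)"
  proof (rule J_mono_AE[OF set_integrable_compact[OF K(1) c] set_integral_add(1)[OF i1]])
    show "AE z in lborel. z \<in> K \<longrightarrow> f z \<le> wi * e_dens z + (wo - wi) * ?o z"
      using zero
    proof eventually_elim
      case (elim z)
      show ?case
      proof
        assume z: "z \<in> K"
        show "f z \<le> wi * e_dens z + (wo - wi) * ?o z"
        proof (cases "\<eta> (fst z) = 0 \<or> \<psi>0 (snd z) = 0")
          case True
          then have "e_dens z = 0" by (auto simp: e_dens_def)
          then show ?thesis using elim z True by simp
        next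
          case False
          then show ?thesis using le[OF z] by (auto simp: indicator_def algebra_simps split: if_splits)
        qed
      qed
    qed
  qed
  also have "\<dots> = wi * E_tot + (wo - wi) * E_out"
    unfolding J_def E_tot_def E_out_def using set_integral_add(2)[OF i1] by simp
  finally show ?thesis .
qed

text \<open>Time and space parts of the error are compared with the same power of \<open>\<eta> \<psi>0\<close>; this is where
  \<open>T \<ge> R0\<^sup>2 / \<nu>\<close> enters.\<close>

lemma time_term_le:
  assumes "0 \<le> s"
  shows "\<bar>deriv \<eta> t * s\<bar> \<le> \<nu> * C0 / R0\<^sup>2 * (\<eta> t powr b * s)"
proof -
  have "C0 / T \<le> \<nu> * C0 / R0\<^sup>2"
  proof -
    have "R0\<^sup>2 \<le> T * \<nu>" using T nu by (simp add: pos_divide_le_eq)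
    then have "C0 * R0\<^sup>2 \<le> C0 * (T * \<nu>)" using C0 by (intro mult_left_mono) auto
    then show ?thesis using T_pos R0 by (simp add: divide_simps mult_ac)
  qed
  moreover have "\<eta> t powr \<delta> \<le> \<eta> t powr b"
    using eta b by (intro powr_mono') auto
  ultimately have "C0 / T * \<eta> t powr \<delta> \<le> \<nu> * C0 / R0\<^sup>2 * \<eta> t powr b"
    using C0 T_pos nu by (intro mult_mono) auto
  then have "\<bar>deriv \<eta> t\<bar> \<le> \<nu> * C0 / R0\<^sup>2 * \<eta> t powr b" using deriv_eta_bound[of t] by linarith
  then have "\<bar>deriv \<eta> t\<bar> * s \<le> \<nu> * C0 / R0\<^sup>2 * \<eta> t powr b * s" using assms by (rule mult_right_mono)
  then show ?thesis using assms by (simp add: abs_mult mult.assoc)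
qed

lemma eta_le_powr: "\<eta> t \<le> \<eta> t powr b"
proof (cases "\<eta> t = 0")
  case False
  have "\<eta> t powr 1 \<le> \<eta> t powr b" using eta b by (intro powr_mono') auto
  then show ?thesis using eta(2) by simp
qed simp

end

section \<open>A Harnack type comparison function\<close>

definition bump :: "nat \<Rightarrow> real^2 \<Rightarrow> real" where "bump p y = (max 0 (1 - y \<bullet> y)) ^ p"

abbreviation (input) Q :: "(real^2) set" where "Q \<equiv> cbox (- One) One"

definition bump_mean :: "nat \<Rightarrow> (real^2 \<Rightarrow> real) \<Rightarrow> real \<Rightarrow> real^2 \<Rightarrow> real" where
  "bump_mean p f r x = integral Q (\<lambda>y. bump p y * f (x + r *\<^sub>R y))"

lemma bump_outside: "y \<notin> Q \<Longrightarrow> p > 0 \<Longrightarrow> bump p y = 0"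
proof -
  assume "y \<notin> Q" "p > 0"
  then obtain b where b: "b \<in> Basis" "\<bar>y \<bullet> b\<bar> > 1" by (force simp: mem_box)
  have "\<bar>y \<bullet> b\<bar> \<le> norm y" using Basis_le_norm[OF b(1)] .
  then have "1 < (norm y)\<^sup>2" using b(2) by (simp add: one_less_power less_le_trans)
  then show "bump p y = 0" using \<open>p > 0\<close> by (simp add: bump_def power2_norm_eq_inner)
qed

lemma bump_nonneg: "0 \<le> bump p y" by (simp add: bump_def)

lemma bump_Suc: "bump (Suc p) y \<le> bump p y"
proof -
  have "max 0 (1 - y \<bullet> y) \<le> 1" by simp
  then show ?thesis unfolding bump_def power_Suc
    by (intro mult_left_le_one_le) auto
qed

lemma cont_bump [continuous_intros]: "continuous_on X (bump p)"
  unfolding bump_def[abs_def] by (intro continuous_intros)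

lemma has_real_derivative_cong_ev:
  assumes "\<forall>\<^sub>F y in nhds s. f y = g y" "(f has_real_derivative d) (at s)"
  shows "(g has_real_derivative d) (at s)"
  using DERIV_cong_ev[OF refl assms(1) refl] assms(2) by simp

lemma pos_part_power_deriv:
  "((\<lambda>s::real. (max 0 s) ^ Suc (Suc q)) has_real_derivative (real (Suc (Suc q)) * (max 0 s) ^ Suc q)) (at s)"
proof (cases s "0::real" rule: linorder_cases)
  case less
  have "\<forall>\<^sub>F y in nhds s. (0::real) = (max 0 y) ^ Suc (Suc q)"
    by (rule eventually_open_eq[of "{..<0}"]) (use less in auto)
  then have "((\<lambda>s::real. (max 0 s) ^ Suc (Suc q)) has_real_derivative 0) (at s)"
    by (rule has_real_derivative_cong_ev) (rule DERIV_const)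
  then show ?thesis using less by simp
next
  case greater
  have "\<forall>\<^sub>F y in nhds s. y ^ Suc (Suc q) = (max 0 y) ^ Suc (Suc q)"
    by (rule eventually_open_eq[of "{0<..}"]) (use greater in auto)
  moreover have "((\<lambda>s::real. s ^ Suc (Suc q)) has_real_derivative (real (Suc (Suc q)) * s ^ Suc q)) (at s)"
    using DERIV_pow[of "Suc (Suc q)" s UNIV] by simp
  ultimately have "((\<lambda>s::real. (max 0 s) ^ Suc (Suc q)) has_real_derivative (real (Suc (Suc q)) * s ^ Suc q)) (at s)"
    by (rule has_real_derivative_cong_ev)
  then show ?thesis using greater by simp
next
  case equal
  have "((\<lambda>h::real. max 0 h * max 0 h ^ q) \<longlongrightarrow> max 0 0 * max 0 0 ^ q) (at 0)"
    by (intro tendsto_intros)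
  then have lim: "((\<lambda>h::real. max 0 h * max 0 h ^ q) \<longlongrightarrow> 0) (at 0)" by simp
  have "((\<lambda>h::real. (max 0 h ^ Suc (Suc q)) / h) \<longlongrightarrow> 0) (at 0)"
  proof (rule Lim_transform_eventually[OF lim])
    show "\<forall>\<^sub>F h in at 0. max 0 h * max 0 h ^ q = max 0 h ^ Suc (Suc q) / (h::real)"
      by (auto simp: eventually_at_filter max_def)
  qed
  then show ?thesis using equal by (simp add: DERIV_def)
qed

lemma dd_bump:
  "dd (bump (Suc (Suc q))) (axis i 1) y (- 2 * real (Suc (Suc q)) * y $ i * bump (Suc q) y)"
proof -
  have inn: "(y + h *\<^sub>R axis i 1) \<bullet> (y + h *\<^sub>R axis i 1) = y \<bullet> y + 2 * h * y $ i + h * h" for h :: real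
    by (simp add: inner_add_left inner_add_right inner_axis inner_commute[of _ "axis i 1"] inner_axis' algebra_simps)
  have "((\<lambda>h. 1 - (y \<bullet> y + 2 * h * y $ i + h * h)) has_real_derivative (- 2 * y $ i)) (at 0)"
    by (auto intro!: derivative_eq_intros)
  then have "dd (\<lambda>y. 1 - y \<bullet> y) (axis i 1) y (- 2 * y $ i)"
    unfolding dd_def inn .
  from dd_compose[OF this pos_part_power_deriv[of q "1 - y \<bullet> y"]]
  have "dd (\<lambda>y. max 0 (1 - y \<bullet> y) ^ Suc (Suc q)) (axis i 1) y
    (real (Suc (Suc q)) * max 0 (1 - y \<bullet> y) ^ Suc q * (- 2 * y $ i))" .
  then show ?thesis unfolding bump_def[abs_def]
    by (rule back_subst[where P = "dd _ (axis i 1) y"]) (simp add: algebra_simps)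
qed

lemma integral_dd_zero_Q:
  fixes G :: "real^2 \<Rightarrow> real"
  assumes "\<And>y. dd G e y (G' y)" "continuous_on UNIV G" "continuous_on UNIV G'"
    "\<And>y. y \<notin> Q \<Longrightarrow> G y = 0"
  shows "integral Q G' = 0"
proof -
  have "set_integrable lborel Q G'"
    using assms(3) by (intro set_integrable_compact) (auto intro: continuous_on_subset)
  moreover have "(LINT y:Q|lborel. G' y) = 0"
    by (rule set_integral_dd_zero[of UNIV Q G G' e]) (use assms in auto)
  ultimately show ?thesis using set_borel_integral_eq_integral(2) by metis
qed

lemma dd_scaled:
  assumes "dd f e (x + r *\<^sub>R y) d"
  shows "dd (\<lambda>y. f (x + r *\<^sub>R y)) e y (r * d)"
proof -
  have "((\<lambda>h. f (x + r *\<^sub>R y + h *\<^sub>R e)) has_real_derivative d) (at (r * 0))"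
    using assms by (simp add: dd_def)
  moreover have "((\<lambda>h. r * h) has_real_derivative r) (at 0)"
    by (auto intro!: derivative_eq_intros)
  ultimately have "((\<lambda>h. f (x + r *\<^sub>R y + (r * h) *\<^sub>R e)) has_real_derivative d * r) (at 0)"
    by (rule DERIV_chain2)
  then show ?thesis by (simp add: dd_def algebra_simps)
qed

lemma D_direction:
  fixes f :: "real^2 \<Rightarrow> real"
  assumes "f differentiable (at z)"
  shows "D y f z = y $ 1 * D (axis 1 1) f z + y $ 2 * D (axis 2 1) f z"
proof -
  have "y = y $ 1 *\<^sub>R axis 1 1 + y $ 2 *\<^sub>R axis 2 1"
    by (simp add: vec_eq_iff forall_2 axis_def)
  then have "D y f z = D (y $ 1 *\<^sub>R axis 1 1 + y $ 2 *\<^sub>R axis 2 1) f z" by simp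
  moreover have l: "linear (frechet_derivative f (at z))" using assms by (rule linear_frechet_derivative)
  ultimately show ?thesis unfolding D_def by (simp add: linear_add[OF l] linear_cmul[OF l])
qed

lemma Q_integrable: "continuous_on UNIV f \<Longrightarrow> (f :: real^2 \<Rightarrow> real) integrable_on Q"
  by (rule integrable_continuous) (rule continuous_on_subset, auto)

lemma Q_integral_linear:
  fixes F G :: "real^2 \<Rightarrow> real"
  assumes "continuous_on UNIV F" "continuous_on UNIV G"
  shows "integral Q (\<lambda>y. a * F y - b * G y) = a * integral Q F - b * integral Q G"
proof -
  have "integral Q (\<lambda>y. a * F y - b * G y) = integral Q (\<lambda>y. a * F y) - integral Q (\<lambda>y. b * G y)"
    by (intro integral_diff Q_integrable continuous_intros assms)
  then show ?thesis by simp
qed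

text \<open>If \<open>|\<Delta>f| \<le> B (f + c)\<close>, then averages of \<open>f + c\<close> over discs of radius \<open>\<rho>\<close> change with \<open>\<rho>\<close> at a
  bounded logarithmic rate.  So an average is comparable with \<open>f + c\<close> itself, while its gradient falls on
  the kernel and is bounded by the average.  The powers of \<open>1 - |y|\<^sup>2\<close> as kernels make the constants
  explicit, because the gradient of one of them is a multiple of \<open>y\<close> times the previous one.\<close>

locale laplacian_controlled =
  fixes f :: "real^2 \<Rightarrow> real" and c B :: real
  assumes smooth: "smooth_on f UNIV" and nonneg: "\<And>x. 0 \<le> f x" and c: "c > 0" and B: "B > 0"
    and lap: "\<And>x. \<bar>laplacian f x\<bar> \<le> B * (f x + c)"
begin

abbreviation "fc \<equiv> \<lambda>x. f x + c"

lemma contf: "continuous_on UNIV f" "continuous_on UNIV (D (axis i 1) f)"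
    "continuous_on UNIV (D (axis i 1) (D (axis i 1) f))"
  using smooth by (auto intro!: smooth_onD(1) smooth_on_D)

lemma cont_comp:
  fixes h :: "real^2 \<Rightarrow> real" and a :: "'a::topological_space \<Rightarrow> real^2"
  assumes "continuous_on UNIV h" "continuous_on X a"
  shows "continuous_on X (\<lambda>y. h (a y))"
  by (rule continuous_on_compose2[OF assms]) auto

text \<open>The radial derivative of an average is an average of \<open>y \<bullet> \<nabla>f\<close>, and \<open>y\<close> times one kernel is a
  multiple of the gradient of the next; integration by parts produces the Laplacian.\<close>

lemma bump_mean_rderiv:
  assumes "p > 0"
  shows "((\<lambda>r. bump_mean p fc r x) has_real_derivative
    r / (2 * real (Suc p)) * integral Q (\<lambda>y. bump (Suc p) y * laplacian f (x + r *\<^sub>R y))) (at r)"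
proof -
  obtain q where q: "p = Suc q" using assms not0_implies_Suc by blast
  let ?d = "\<lambda>i z. D (axis i 1) f z"
  have "((\<lambda>r. bump_mean p fc r x) has_real_derivative
    integral Q (\<lambda>y. bump p y * (y $ 1 * ?d 1 (x + r *\<^sub>R y) + y $ 2 * ?d 2 (x + r *\<^sub>R y)))) (at r within UNIV)"
    unfolding bump_mean_def
  proof (rule leibniz_rule_field_derivative[where U = UNIV])
    show "((\<lambda>r. bump p y * (f (x + r *\<^sub>R y) + c)) has_real_derivative
      bump p y * (y $ 1 * ?d 1 (x + r *\<^sub>R y) + y $ 2 * ?d 2 (x + r *\<^sub>R y))) (at r within UNIV)" for r y
    proof -
      have "dd f y (x + r *\<^sub>R y) (D y f (x + r *\<^sub>R y))" by (rule dd_D[OF smooth]) simp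
      then have "((\<lambda>r. f (x + r *\<^sub>R y)) has_real_derivative D y f (x + r *\<^sub>R y)) (at r)"
        by (simp add: dd_shift)
      from DERIV_cmult[OF DERIV_add[OF this DERIV_const[of c]], of "bump p y"]
      show ?thesis
        by (simp add: D_direction[where y = y and z = "x + r *\<^sub>R y", OF smooth_onD(2)[OF smooth UNIV_I]])
    qed
    show "(\<lambda>y. bump p y * (f (x + r *\<^sub>R y) + c)) integrable_on Q" for r
      by (intro Q_integrable continuous_intros cont_comp[OF contf(1)])
    show "continuous_on (UNIV \<times> Q) (\<lambda>(r, y). bump p y * (y $ 1 * ?d 1 (x + r *\<^sub>R y) + y $ 2 * ?d 2 (x + r *\<^sub>R y)))"
      unfolding case_prod_unfold
      by (intro continuous_intros cont_comp[OF contf(2)] cont_comp[OF cont_bump])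
  qed auto
  moreover have "integral Q (\<lambda>y. bump p y * (y $ 1 * ?d 1 (x + r *\<^sub>R y) + y $ 2 * ?d 2 (x + r *\<^sub>R y)))
    = r / (2 * real (Suc p)) * integral Q (\<lambda>y. bump (Suc p) y * laplacian f (x + r *\<^sub>R y))"
  proof -
    let ?A = "\<lambda>i y. bump p y * (y $ i * ?d i (x + r *\<^sub>R y))"
    let ?B = "\<lambda>i y. bump (Suc p) y * D (axis i 1) (D (axis i 1) f) (x + r *\<^sub>R y)"
    have cA: "continuous_on UNIV (?A i)" and cB: "continuous_on UNIV (?B i)" for i
      by (intro continuous_intros cont_comp[OF contf(2)] cont_comp[OF contf(3)])+
    have *: "2 * real (Suc p) * integral Q (?A i) = r * integral Q (?B i)" for i
    proof -
      have "integral Q (\<lambda>y. r * ?B i y - 2 * real (Suc p) * ?A i y) = 0"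
      proof (rule integral_dd_zero_Q[where G = "\<lambda>y. bump (Suc p) y * ?d i (x + r *\<^sub>R y)" and e = "axis i 1"])
        show "dd (\<lambda>y. bump (Suc p) y * ?d i (x + r *\<^sub>R y)) (axis i 1) y (r * ?B i y - 2 * real (Suc p) * ?A i y)" for y
        proof -
          have "dd (\<lambda>y. bump (Suc p) y * ?d i (x + r *\<^sub>R y)) (axis i 1) y
            ((- 2 * real (Suc p) * y $ i * bump p y) * ?d i (x + r *\<^sub>R y)
             + bump (Suc p) y * (r * D (axis i 1) (D (axis i 1) f) (x + r *\<^sub>R y)))"
            unfolding q by (intro dd_mult dd_bump dd_scaled dd_D[of _ UNIV] smooth_on_D smooth) auto
          then show ?thesis by (rule back_subst[where P = "dd _ (axis i 1) y"]) (simp add: algebra_simps)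
        qed
        show "continuous_on UNIV (\<lambda>y. bump (Suc p) y * ?d i (x + r *\<^sub>R y))"
          by (intro continuous_intros cont_comp[OF contf(2)])
        show "continuous_on UNIV (\<lambda>y. r * ?B i y - 2 * real (Suc p) * ?A i y)"
          by (intro continuous_intros cA[unfolded q] cB cA)
        show "bump (Suc p) y * ?d i (x + r *\<^sub>R y) = 0" if "y \<notin> Q" for y
          using bump_outside[OF that] by simp
      qed
      then show ?thesis using Q_integral_linear[OF cB cA, of r i "2 * real (Suc p)" i] by linarith
    qed
    have "integral Q (\<lambda>y. bump p y * (y $ 1 * ?d 1 (x + r *\<^sub>R y) + y $ 2 * ?d 2 (x + r *\<^sub>R y)))
      = integral Q (\<lambda>y. ?A 1 y + ?A 2 y)" by (simp add: algebra_simps)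
    also have "\<dots> = integral Q (?A 1) + integral Q (?A 2)"
      by (intro integral_add Q_integrable cA)
    also have "\<dots> = r / (2 * real (Suc p)) * (integral Q (?B 1) + integral Q (?B 2))"
      using *[of 1] *[of 2] by (simp add: field_simps)
    also have "integral Q (?B 1) + integral Q (?B 2) = integral Q (\<lambda>y. ?B 1 y + ?B 2 y)"
      by (intro integral_add[symmetric] Q_integrable cB)
    also have "\<dots> = integral Q (\<lambda>y. bump (Suc p) y * laplacian f (x + r *\<^sub>R y))"
      by (simp add: laplacian_D algebra_simps)
    finally show ?thesis .
  qed
  ultimately show ?thesis by simp
qed

lemma cont_fc: "continuous_on UNIV (\<lambda>y. bump p y * fc (x + r *\<^sub>R y))"
  by (intro continuous_intros cont_comp[OF contf(1)])

lemma bump_mean_rderiv_bound: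
  assumes "p > 0" "r \<ge> 0"
  shows "\<bar>r / (2 * real (Suc p)) * integral Q (\<lambda>y. bump (Suc p) y * laplacian f (x + r *\<^sub>R y))\<bar>
    \<le> B / (2 * real (Suc p)) * r * bump_mean p fc r x"
proof -
  have cl: "continuous_on UNIV (laplacian f)"
    unfolding laplacian_D[abs_def] by (intro continuous_intros contf)
  have "norm (integral Q (\<lambda>y. bump (Suc p) y * laplacian f (x + r *\<^sub>R y)))
    \<le> integral Q (\<lambda>y. B * (bump p y * fc (x + r *\<^sub>R y)))"
  proof (rule integral_norm_bound_integral)
    show "(\<lambda>y. bump (Suc p) y * laplacian f (x + r *\<^sub>R y)) integrable_on Q"
      by (intro Q_integrable continuous_intros cont_comp[OF cl])
    show "(\<lambda>y. B * (bump p y * fc (x + r *\<^sub>R y))) integrable_on Q"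
      by (intro Q_integrable continuous_intros cont_comp[OF contf(1)])
    show "norm (bump (Suc p) y * laplacian f (x + r *\<^sub>R y)) \<le> B * (bump p y * fc (x + r *\<^sub>R y))" for y
    proof -
      have "norm (bump (Suc p) y * laplacian f (x + r *\<^sub>R y)) = bump (Suc p) y * \<bar>laplacian f (x + r *\<^sub>R y)\<bar>"
        using bump_nonneg by (simp add: abs_mult)
      also have "\<dots> \<le> bump p y * (B * fc (x + r *\<^sub>R y))"
        using bump_Suc bump_nonneg lap by (intro mult_mono) auto
      finally show ?thesis by (simp add: mult_ac)
    qed
  qed
  also have "\<dots> = B * bump_mean p fc r x" unfolding bump_mean_def by simp
  finally have "\<bar>integral Q (\<lambda>y. bump (Suc p) y * laplacian f (x + r *\<^sub>R y))\<bar> \<le> B * bump_mean p fc r x" by simp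
  then have "r / (2 * real (Suc p)) * \<bar>integral Q (\<lambda>y. bump (Suc p) y * laplacian f (x + r *\<^sub>R y))\<bar>
    \<le> r / (2 * real (Suc p)) * (B * bump_mean p fc r x)"
    using assms by (intro mult_left_mono) auto
  then show ?thesis using assms by (simp add: abs_mult mult_ac)
qed

lemma bump_mean_zero: "bump_mean p fc 0 x = integral Q (bump p) * fc x"
  unfolding bump_mean_def by simp

text \<open>A differential inequality \<open>|m'| \<le> \<beta> r m\<close> is integrated with the factors \<open>exp (\<plusminus> \<beta> r\<^sup>2 / 2)\<close>.\<close>

lemma bump_mean_bounds:
  assumes "p > 0" "\<rho> \<ge> 0"
  defines "\<beta> \<equiv> B / (2 * real (Suc p))"
  shows "bump_mean p fc \<rho> x \<le> exp (\<beta> * \<rho>\<^sup>2 / 2) * (integral Q (bump p) * fc x)"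
    and "integral Q (bump p) * fc x \<le> exp (\<beta> * \<rho>\<^sup>2 / 2) * bump_mean p fc \<rho> x"
proof -
  define m where "m r = bump_mean p fc r x" for r
  define m' where "m' r = r / (2 * real (Suc p)) * integral Q (\<lambda>y. bump (Suc p) y * laplacian f (x + r *\<^sub>R y))" for r
  have m': "(m has_real_derivative m' r) (at r)" "r \<ge> 0 \<Longrightarrow> \<bar>m' r\<bar> \<le> \<beta> * r * m r" for r
    unfolding m_def[abs_def] m'_def \<beta>_def by (rule bump_mean_rderiv[OF assms(1)] bump_mean_rderiv_bound[OF assms(1)]; simp)+
  have d: "((\<lambda>r. m r * exp (s * \<beta> * r\<^sup>2 / 2)) has_real_derivative
      (m' r + s * \<beta> * r * m r) * exp (s * \<beta> * r\<^sup>2 / 2)) (at r)" for r s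
    by (auto intro!: derivative_eq_intros m' simp: algebra_simps)
  have "m \<rho> * exp (- 1 * \<beta> * \<rho>\<^sup>2 / 2) \<le> m 0 * exp (- 1 * \<beta> * 0\<^sup>2 / 2)"
  proof (rule DERIV_nonpos_imp_nonincreasing[OF assms(2)])
    show "\<exists>y. ((\<lambda>r. m r * exp (- 1 * \<beta> * r\<^sup>2 / 2)) has_real_derivative y) (at r) \<and> y \<le> 0"
      if "0 \<le> r" "r \<le> \<rho>" for r
    proof -
      have "(m' r + - 1 * \<beta> * r * m r) * exp (- 1 * \<beta> * r\<^sup>2 / 2) \<le> 0"
        using m'(2)[OF that(1)] by (intro mult_nonpos_nonneg) auto
      then show ?thesis using d[of "- 1" r] by blast
    qed
  qed
  then show "bump_mean p fc \<rho> x \<le> exp (\<beta> * \<rho>\<^sup>2 / 2) * (integral Q (bump p) * fc x)"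
    using bump_mean_zero[of p x] by (simp add: m_def exp_minus field_simps)
  have "m 0 * exp (1 * \<beta> * 0\<^sup>2 / 2) \<le> m \<rho> * exp (1 * \<beta> * \<rho>\<^sup>2 / 2)"
  proof (rule DERIV_nonneg_imp_nondecreasing[OF assms(2)])
    show "\<exists>y. ((\<lambda>r. m r * exp (1 * \<beta> * r\<^sup>2 / 2)) has_real_derivative y) (at r) \<and> 0 \<le> y"
      if "0 \<le> r" "r \<le> \<rho>" for r
    proof -
      have "0 \<le> (m' r + 1 * \<beta> * r * m r) * exp (1 * \<beta> * r\<^sup>2 / 2)"
        using m'(2)[OF that(1)] by (intro mult_nonneg_nonneg) auto
      then show ?thesis using d[of 1 r] by blast
    qed
  qed
  then show "integral Q (bump p) * fc x \<le> exp (\<beta> * \<rho>\<^sup>2 / 2) * bump_mean p fc \<rho> x"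
    using bump_mean_zero[of p x] by (simp add: m_def mult_ac)
qed

end

text \<open>Integrating \<open>\<partial>\<^sub>i (y\<^sub>i bump 2 y)\<close> over the plane relates the second moments of \<open>bump 1\<close> to the
  integrals of \<open>bump 1\<close> and \<open>bump 2\<close>.\<close>

lemma bump_moment: "3 * integral Q (bump 2) = 2 * integral Q (bump 1)"
proof -
  let ?A = "\<lambda>i y::real^2. y $ i * (y $ i * bump 1 y)"
  have cA: "continuous_on UNIV (?A i)" for i by (intro continuous_intros)
  have *: "integral Q (\<lambda>y. bump 2 y - 4 * ?A i y) = 0" for i
  proof (rule integral_dd_zero_Q[where G = "\<lambda>y. y $ i * bump 2 y" and e = "axis i 1"])
    show "dd (\<lambda>y. y $ i * bump 2 y) (axis i 1) y (bump 2 y - 4 * ?A i y)" for y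
    proof -
      have 1: "dd (\<lambda>y::real^2. y $ i) (axis i 1) y 1"
        by (auto simp: dd_def intro!: derivative_eq_intros)
      have 2: "dd (bump 2) (axis i 1) y (- 2 * real 2 * y $ i * bump 1 y)"
        using dd_bump[of 0 i y] by (simp add: numeral_2_eq_2)
      show ?thesis using dd_mult[OF 1 2]
        by (rule back_subst[where P = "dd _ (axis i 1) y"]) (simp add: algebra_simps)
    qed
    show "continuous_on UNIV (\<lambda>y. y $ i * bump 2 y)" "continuous_on UNIV (\<lambda>y. bump 2 y - 4 * ?A i y)"
      by (intro continuous_intros)+
  qed (simp add: bump_outside)
  have ik: "bump p integrable_on Q" for p by (intro Q_integrable continuous_intros)
  define I where "I i = integral Q (?A i)" for i
  have I: "integral Q (bump 2) = 4 * I i" for i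
    unfolding I_def using *[of i] Q_integral_linear[OF cont_bump cA, of 1 2 4 i] by simp
  have "2 * integral Q (bump 2) = 4 * (I 1 + I 2)"
    by (simp only: mult_2[of "integral Q (bump 2)"] distrib_left I[of 1, symmetric] I[of 2, symmetric])
  also have "I 1 + I 2 = integral Q (\<lambda>y. ?A 1 y + ?A 2 y)"
    unfolding I_def by (intro integral_add[symmetric] Q_integrable cA)
  also have "\<dots> = integral Q (\<lambda>y. bump 1 y - bump 2 y)"
  proof (rule arg_cong[where f = "integral Q"], rule ext)
    fix y :: "real^2"
    have "?A 1 y + ?A 2 y = (y \<bullet> y) * bump 1 y" by (simp add: inner_2 algebra_simps)
    also have "\<dots> = bump 1 y - bump 2 y" by (simp add: bump_def max_def power2_eq_square algebra_simps)
    finally show "?A 1 y + ?A 2 y = bump 1 y - bump 2 y" .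
  qed
  also have "\<dots> = integral Q (bump 1) - integral Q (bump 2)" by (intro integral_diff ik)
  finally show ?thesis by simp
qed

lemma bump_integral_pos: "integral Q (bump 2) > 0"
proof -
  let ?P = "cbox (- (1/2) *\<^sub>R One) ((1/2) *\<^sub>R One) :: (real^2) set"
  have sub: "?P \<subseteq> Q" by (auto simp: mem_box) force+
  have "0 < measure lborel ?P" by (simp add: content_pos_lt_eq)
  moreover have "(1/4) * measure lborel ?P \<le> integral ?P (bump 2)"
  proof -
    have "integral ?P (\<lambda>y. 1/4 :: real) \<le> integral ?P (bump 2)"
    proof (rule integral_le)
      show "bump 2 integrable_on ?P" by (rule integrable_continuous) (intro continuous_intros)
      fix y :: "real^2" assume "y \<in> ?P"
      then have "\<bar>y \<bullet> b\<bar> \<le> 1/2" if "b \<in> Basis" for b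
        using that by (auto simp: mem_box abs_le_iff)
      from this[of "axis 1 1"] this[of "axis 2 1"]
      have "\<bar>y $ 1\<bar> \<le> 1/2" "\<bar>y $ 2\<bar> \<le> 1/2" by (simp_all add: inner_axis)
      then have "(y $ 1)\<^sup>2 \<le> (1/2)\<^sup>2" "(y $ 2)\<^sup>2 \<le> (1/2)\<^sup>2" by (simp_all only: abs_le_square_iff[symmetric])
      moreover define a1 a2 where "a1 = y $ 1" and "a2 = y $ 2"
      ultimately have "a1\<^sup>2 \<le> 1/4" "a2\<^sup>2 \<le> 1/4" "y \<bullet> y = a1\<^sup>2 + a2\<^sup>2"
        by (simp_all only: inner_2 power2_eq_square)
      then have "1/2 \<le> 1 - y \<bullet> y" by linarith
      then have "(1/2)\<^sup>2 \<le> (max 0 (1 - y \<bullet> y))\<^sup>2" by (intro power_mono) auto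
      then show "1/4 \<le> bump 2 y" by (simp add: bump_def power2_eq_square)
    qed auto
    then show ?thesis by (simp add: mult.commute)
  qed
  moreover have "integral ?P (bump 2) \<le> integral Q (bump 2)"
    by (rule integral_subset_le[OF sub]) (auto intro!: integrable_continuous continuous_intros bump_nonneg)
  ultimately show ?thesis by linarith
qed

lemma exp_five_sixteenth: "exp (5/16 :: real) \<le> 1.394"
proof -
  have "exp (5/32 :: real) \<le> 1 + 5/32 + (5/32)\<^sup>2" by (rule exp_bound) auto
  then have "(exp (5/32 :: real))\<^sup>2 \<le> (1 + 5/32 + (5/32)\<^sup>2)\<^sup>2" by (intro power_mono) auto
  also have "(exp (5/32 :: real))\<^sup>2 = exp (5/16)" by (simp flip: exp_double)
  also have "(1 + 5/32 + (5/32)\<^sup>2)\<^sup>2 \<le> (1.394 :: real)" by (simp add: power2_eq_square)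
  finally show ?thesis .
qed

lemma cauchy_schwarz_2: "(a * c + b * d)\<^sup>2 \<le> (a\<^sup>2 + b\<^sup>2) * (c\<^sup>2 + d\<^sup>2)" for a b c d :: real
proof -
  have "(a\<^sup>2 + b\<^sup>2) * (c\<^sup>2 + d\<^sup>2) = (a * c + b * d)\<^sup>2 + (a * d - b * c)\<^sup>2" by algebra
  then show ?thesis by simp
qed

context laplacian_controlled
begin

text \<open>A local average of \<open>f + c\<close>, comparable with \<open>f + c\<close>, whose logarithmic gradient is at most
  \<open>sqrt (122/5 B)\<close>.  The averaging radius with \<open>\<rho>\<^sup>2 = 3 / (2 B)\<close> keeps the factor \<open>exp (1/8)\<close> close to
  one while the gradient bound, which is proportional to \<open>1 / \<rho>\<close>, stays small.\<close>

theorem comparison_function: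
  "\<exists>h h'. continuous_on UNIV h \<and> (\<forall>i. continuous_on UNIV (h' i)) \<and>
     (\<forall>x i. dd h (axis i 1) x (h' i x)) \<and>
     (\<forall>x. fc x \<le> exp (1/8) * h x \<and> h x \<le> exp (1/8) * fc x \<and>
        (h' (1::2) x)\<^sup>2 + (h' 2 x)\<^sup>2 \<le> 122/5 * B * (h x)\<^sup>2)"
proof -
  define \<rho> where "\<rho> = sqrt (3 / (2 * B))"
  have \<rho>: "\<rho> > 0" "\<rho>\<^sup>2 = 3 / (2 * B)" using B by (auto simp: \<rho>_def)
  define k2 where "k2 = integral Q (bump 2)"
  have k2: "k2 > 0" "integral Q (bump 1) = 3/2 * k2"
    using bump_integral_pos bump_moment by (auto simp: k2_def)
  define M where "M = bump_mean 2 fc \<rho>"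
  define M1 where "M1 = bump_mean 1 fc \<rho>"
  define P where "P i x = integral Q (\<lambda>y. bump 2 y * D (axis i 1) f (x + \<rho> *\<^sub>R y))" for i x
  have contP: "continuous_on UNIV (P i)" for i
    unfolding P_def by (rule integral_continuous_on_param)
      (auto simp: case_prod_unfold intro!: continuous_intros cont_comp[OF contf(2)] cont_comp[OF cont_bump])
  have contM: "continuous_on UNIV M"
    unfolding M_def bump_mean_def[abs_def] by (rule integral_continuous_on_param)
      (auto simp: case_prod_unfold intro!: continuous_intros cont_comp[OF contf(1)] cont_comp[OF cont_bump])
  have ddM: "dd M (axis i 1) x (P i x)" for i x
  proof -
    have "((\<lambda>h. integral Q (\<lambda>y. bump 2 y * fc (x + h *\<^sub>R axis i 1 + \<rho> *\<^sub>R y))) has_real_derivative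
      integral Q (\<lambda>y. bump 2 y * D (axis i 1) f (x + 0 *\<^sub>R axis i 1 + \<rho> *\<^sub>R y))) (at 0 within UNIV)"
    proof (rule leibniz_rule_field_derivative[where U = UNIV])
      show "((\<lambda>h. bump 2 y * (f (x + h *\<^sub>R axis i 1 + \<rho> *\<^sub>R y) + c)) has_real_derivative
        bump 2 y * D (axis i 1) f (x + h *\<^sub>R axis i 1 + \<rho> *\<^sub>R y)) (at h within UNIV)" for h y
      proof -
        have "dd f (axis i 1) (x + \<rho> *\<^sub>R y + h *\<^sub>R axis i 1) (D (axis i 1) f (x + \<rho> *\<^sub>R y + h *\<^sub>R axis i 1))"
          by (rule dd_D[OF smooth]) simp
        then have "((\<lambda>h. f (x + h *\<^sub>R axis i 1 + \<rho> *\<^sub>R y)) has_real_derivative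
          D (axis i 1) f (x + h *\<^sub>R axis i 1 + \<rho> *\<^sub>R y)) (at h)"
          unfolding dd_shift by (simp add: add_ac)
        from DERIV_cmult[OF DERIV_add[OF this DERIV_const[of c]], of "bump 2 y"] show ?thesis by simp
      qed
      show "(\<lambda>y. bump 2 y * (f (x + h *\<^sub>R axis i 1 + \<rho> *\<^sub>R y) + c)) integrable_on Q" for h
        by (intro Q_integrable continuous_intros cont_comp[OF contf(1)])
      show "continuous_on (UNIV \<times> Q) (\<lambda>(h, y). bump 2 y * D (axis i 1) f (x + h *\<^sub>R axis i 1 + \<rho> *\<^sub>R y))"
        unfolding case_prod_unfold
        by (intro continuous_intros cont_comp[OF contf(2)] cont_comp[OF cont_bump])
    qed auto
    then show ?thesis by (simp add: dd_def M_def bump_mean_def P_def)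
  qed
  have P_eq: "P i x = 4 / \<rho> * integral Q (\<lambda>y. bump 1 y * y $ i * fc (x + \<rho> *\<^sub>R y))" for i x
  proof -
    let ?A = "\<lambda>y. bump 2 y * D (axis i 1) f (x + \<rho> *\<^sub>R y)" and ?B = "\<lambda>y. bump 1 y * y $ i * fc (x + \<rho> *\<^sub>R y)"
    have cA: "continuous_on UNIV ?A" and cB: "continuous_on UNIV ?B"
      by (intro continuous_intros cont_comp[OF contf(1)] cont_comp[OF contf(2)])+
    have "integral Q (\<lambda>y. \<rho> * ?A y - 4 * ?B y) = 0"
    proof (rule integral_dd_zero_Q[where G = "\<lambda>y. bump 2 y * fc (x + \<rho> *\<^sub>R y)" and e = "axis i 1"])
      show "dd (\<lambda>y. bump 2 y * fc (x + \<rho> *\<^sub>R y)) (axis i 1) y (\<rho> * ?A y - 4 * ?B y)" for y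
      proof -
        have k: "dd (bump 2) (axis i 1) y (- 2 * real 2 * y $ i * bump 1 y)"
          using dd_bump[of 0 i y] by (simp add: numeral_2_eq_2)
        have "dd fc (axis i 1) z (D (axis i 1) f z + 0)" for z
          by (intro dd_add dd_const dd_D[OF smooth]) simp
        from dd_mult[OF k dd_scaled[OF this]]
        show ?thesis by (rule back_subst[where P = "dd _ (axis i 1) y"]) (simp add: algebra_simps)
      qed
      show "continuous_on UNIV (\<lambda>y. bump 2 y * fc (x + \<rho> *\<^sub>R y))" by (rule cont_fc)
      show "continuous_on UNIV (\<lambda>y. \<rho> * ?A y - 4 * ?B y)" by (intro continuous_intros cA cB)
    qed (simp add: bump_outside)
    then have "\<rho> * P i x = 4 * integral Q ?B"
      using Q_integral_linear[OF cA cB, of \<rho> 4] by (simp add: P_def)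
    then show ?thesis using \<rho> by (simp add: field_simps)
  qed
  have M1M: "M1 x \<le> 3/2 * 1.394 * M x" and M_up: "M x \<le> exp (1/8) * (k2 * fc x)"
    and M_low: "k2 * fc x \<le> exp (1/8) * M x" for x
  proof -
    \<comment> \<open>The values of \<open>\<beta> \<rho>\<^sup>2 / 2\<close> for the first and the second kernel.\<close>
    have e1: "B / (2 * real (Suc 1)) * \<rho>\<^sup>2 / 2 = 3/16" and e2: "B / (2 * real (Suc 2)) * \<rho>\<^sup>2 / 2 = 1/8"
      using B by (simp_all add: \<rho>(2))
    show up: "M x \<le> exp (1/8) * (k2 * fc x)" and low: "k2 * fc x \<le> exp (1/8) * M x"
      using bump_mean_bounds[of 2 \<rho> x] \<rho> unfolding e2 by (simp_all add: M_def k2_def)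
    have "M1 x \<le> exp (3/16) * (3/2 * k2 * fc x)"
      using bump_mean_bounds(1)[of 1 \<rho> x] \<rho> unfolding e1 by (simp add: M1_def k2(2)[unfolded One_nat_def])
    also have "\<dots> = 3/2 * exp (3/16) * (k2 * fc x)" by simp
    also have "\<dots> \<le> 3/2 * exp (3/16) * (exp (1/8) * M x)" by (intro mult_left_mono low) simp
    also have "\<dots> = 3/2 * (exp (3/16) * exp (1/8)) * M x" by simp
    also have "exp (3/16) * exp (1/8) = exp (5/16 :: real)" by (simp flip: exp_add)
    also have "3/2 * exp (5/16) * M x \<le> 3/2 * 1.394 * M x"
    proof -
      have "0 \<le> k2 * fc x" using k2 nonneg[of x] c by simp
      then have "0 \<le> exp (1/8) * M x" using low by linarith
      then have "0 \<le> M x" by (simp add: zero_le_mult_iff)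
      then show ?thesis using exp_five_sixteenth by (intro mult_right_mono) auto
    qed
    finally show "M1 x \<le> 3/2 * 1.394 * M x" .
  qed
  have Mpos: "M x > 0" for x
  proof -
    have "0 < k2 * fc x" using k2 nonneg[of x] c by (simp add: add_nonneg_pos)
    then have "0 < exp (1/8) * M x" using M_low[of x] by linarith
    then show ?thesis by (simp add: zero_less_mult_iff)
  qed
  have grad: "(P 1 x)\<^sup>2 + (P 2 x)\<^sup>2 \<le> 122/5 * B * (M x)\<^sup>2" for x
  proof -
    define n where "n = sqrt ((P 1 x)\<^sup>2 + (P 2 x)\<^sup>2)"
    have n: "n \<ge> 0" "n\<^sup>2 = (P 1 x)\<^sup>2 + (P 2 x)\<^sup>2" by (auto simp: n_def)
    let ?F = "\<lambda>i y. bump 1 y * y $ i * fc (x + \<rho> *\<^sub>R y)"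
    have cF: "continuous_on UNIV (?F i)" for i
      by (intro continuous_intros cont_comp[OF contf(1)])
    have cF1: "continuous_on UNIV (\<lambda>y. bump p y * fc (x + \<rho> *\<^sub>R y))" for p by (rule cont_fc)
    have "P 1 x * integral Q (?F 1) - (- P 2 x) * integral Q (?F 2)
        = integral Q (\<lambda>y. P 1 x * ?F 1 y - (- P 2 x) * ?F 2 y)"
      by (rule Q_integral_linear[OF cF cF, symmetric])
    also have "\<dots> \<le> integral Q (\<lambda>y. (25/24 * n) * (bump 1 y * fc (x + \<rho> *\<^sub>R y)) - (2/3 * n) * (bump 2 y * fc (x + \<rho> *\<^sub>R y)))"
    proof (rule integral_le)
      show "(\<lambda>y. P 1 x * ?F 1 y - (- P 2 x) * ?F 2 y) integrable_on Q"
        by (intro Q_integrable continuous_intros cont_comp[OF contf(1)])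
      show "(\<lambda>y. (25/24 * n) * (bump 1 y * fc (x + \<rho> *\<^sub>R y)) - (2/3 * n) * (bump 2 y * fc (x + \<rho> *\<^sub>R y))) integrable_on Q"
        by (intro Q_integrable continuous_intros cont_comp[OF contf(1)])
      fix y :: "real^2"
      have f0: "0 \<le> bump 1 y * fc (x + \<rho> *\<^sub>R y)" using bump_nonneg nonneg c by (simp add: add_nonneg_nonneg less_imp_le)
      have cs: "P 1 x * y $ 1 + P 2 x * y $ 2 \<le> n * norm y"
      proof (rule power2_le_imp_le)
        have "(norm y)\<^sup>2 = (y $ 1)\<^sup>2 + (y $ 2)\<^sup>2"
          by (simp only: power2_norm_eq_inner inner_2) (simp only: power2_eq_square)
        then show "(P 1 x * y $ 1 + P 2 x * y $ 2)\<^sup>2 \<le> (n * norm y)\<^sup>2"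
          using cauchy_schwarz_2 by (simp only: power_mult_distrib n)
      qed (use n in simp)
      \<comment> \<open>The arithmetic-geometric inequality \<open>2 (3/4) |y| \<le> (3/4)\<^sup>2 + |y|\<^sup>2\<close>, with \<open>3/4\<close> close to the optimum.\<close>
      have "norm y \<le> 25/24 - 2/3 * (1 - y \<bullet> y)"
      proof -
        have "(norm y - 3/4)\<^sup>2 = (norm y)\<^sup>2 - 3/2 * norm y + 9/16"
          by (simp add: power2_eq_square algebra_simps)
        then have "0 \<le> y \<bullet> y - 3/2 * norm y + 9/16"
          using zero_le_power2[of "norm y - 3/4"] by (simp only: power2_norm_eq_inner)
        moreover have "N \<le> 25/24 - 2/3 * (1 - s)" if "0 \<le> s - 3/2 * N + 9/16" for N s :: real
          using that by argo
        ultimately show ?thesis by blast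
      qed
      then have "n * norm y \<le> n * (25/24 - 2/3 * (1 - y \<bullet> y))" using n by (intro mult_left_mono)
      then have "(bump 1 y * fc (x + \<rho> *\<^sub>R y)) * (P 1 x * y $ 1 + P 2 x * y $ 2)
          \<le> (bump 1 y * fc (x + \<rho> *\<^sub>R y)) * (n * (25/24 - 2/3 * (1 - y \<bullet> y)))" (is "?lhs \<le> ?rhs")
        using cs f0 by (intro mult_left_mono) auto
      have "bump 1 y * (1 - y \<bullet> y) = bump 2 y"
        by (simp add: bump_def max_def power2_eq_square)
      moreover have "k * F * (n * (25/24 - 2/3 * q)) = 25/24 * n * (k * F) - 2/3 * n * (k * q * F)"
        for k F q :: real by (simp add: algebra_simps)
      ultimately have "(bump 1 y * fc (x + \<rho> *\<^sub>R y)) * (n * (25/24 - 2/3 * (1 - y \<bullet> y)))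
        = (25/24 * n) * (bump 1 y * fc (x + \<rho> *\<^sub>R y)) - (2/3 * n) * (bump 2 y * fc (x + \<rho> *\<^sub>R y))"
        by metis
      moreover have "P 1 x * ?F 1 y - (- P 2 x) * ?F 2 y = ?lhs" by (simp add: algebra_simps)
      ultimately show "P 1 x * ?F 1 y - (- P 2 x) * ?F 2 y
        \<le> (25/24 * n) * (bump 1 y * fc (x + \<rho> *\<^sub>R y)) - (2/3 * n) * (bump 2 y * fc (x + \<rho> *\<^sub>R y))"
        using \<open>?lhs \<le> ?rhs\<close> by linarith
    qed
    also have "\<dots> = 25/24 * n * M1 x - 2/3 * n * M x"
      using Q_integral_linear[OF cF1[of 1] cF1[of 2], of "25/24 * n" "2/3 * n"]
      by (simp only: M_def M1_def bump_mean_def)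
    also have "\<dots> \<le> n * (1.5115 * M x)"
    proof -
      have "n * M1 x \<le> n * (3/2 * 1.394 * M x)" using n M1M by (intro mult_left_mono)
      moreover have "0 \<le> n * M x" using n Mpos[of x] by simp
      ultimately show ?thesis by (simp add: algebra_simps)
    qed
    finally have X: "P 1 x * integral Q (?F 1) - (- P 2 x) * integral Q (?F 2) \<le> n * (1.5115 * M x)" .
    have "n * n = P 1 x * P 1 x + P 2 x * P 2 x" using n by (simp add: power2_eq_square)
    also have "\<dots> = P 1 x * (4 / \<rho> * integral Q (?F 1)) + P 2 x * (4 / \<rho> * integral Q (?F 2))"
      using P_eq[of 1 x] P_eq[of 2 x] by simp
    also have "\<dots> = 4 / \<rho> * (P 1 x * integral Q (?F 1) - (- P 2 x) * integral Q (?F 2))"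
      by (simp add: algebra_simps)
    also have "\<dots> \<le> 4 / \<rho> * (n * (1.5115 * M x))"
      using X \<rho> by (intro mult_left_mono) auto
    finally have nn: "n * n \<le> n * (4 / \<rho> * (1.5115 * M x))" by (simp add: mult_ac)
    have "n \<le> 4 / \<rho> * (1.5115 * M x)"
    proof (cases "n = 0")
      case True
      then show ?thesis using \<rho> Mpos[of x] by simp
    next
      case False
      then have "0 < n" using n(1) by simp
      then show ?thesis using nn by (rule mult_left_le_imp_le[rotated])
    qed
    then have "n\<^sup>2 \<le> (4 / \<rho> * (1.5115 * M x))\<^sup>2" using n(1) by (intro power_mono)
    also have "\<dots> = 16 * 1.5115\<^sup>2 / \<rho>\<^sup>2 * (M x)\<^sup>2" by (simp add: power_mult_distrib power_divide)
    also have "\<dots> = 16 * 1.5115\<^sup>2 * 2 / 3 * B * (M x)\<^sup>2" using B by (simp add: \<rho>(2))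
    also have "\<dots> \<le> 122/5 * B * (M x)\<^sup>2" using B by (intro mult_right_mono) (auto simp: power2_eq_square)
    finally show ?thesis using n by simp
  qed
  show ?thesis
  proof (intro exI conjI allI)
    show "continuous_on UNIV (\<lambda>x. 1 / k2 * M x)" "continuous_on UNIV (\<lambda>x. 1 / k2 * P i x)" for i
      by (intro continuous_intros contM contP)+
    show "dd (\<lambda>x. 1 / k2 * M x) (axis i 1) x (1 / k2 * P i x)" for i x
      using dd_mult[OF dd_const[of "1 / k2"] ddM] by simp
    show "fc x \<le> exp (1/8) * (1 / k2 * M x)" for x
      using M_low[of x] k2 by (simp add: field_simps)
    show "1 / k2 * M x \<le> exp (1/8) * fc x" for x
      using M_up[of x] k2 by (simp add: field_simps)
    show "(1 / k2 * P 1 x)\<^sup>2 + (1 / k2 * P 2 x)\<^sup>2 \<le> 122/5 * B * (1 / k2 * M x)\<^sup>2" for x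
      using mult_left_mono[OF grad[of x], of "(1 / k2)\<^sup>2"]
      by (simp add: power_mult_distrib power_divide algebra_simps add_divide_distrib)
  qed
qed

end

section \<open>Localized vorticity gradients dominate part of the error\<close>

text \<open>For \<open>F = 1/132 ln (1 + x)\<close> the right-hand side is half of \<open>x\<close> times the derivative of \<open>F\<close>.  The
  logarithm grows slowly enough for this as long as \<open>x\<close> stays below \<open>exp 8 - 1\<close>, and \<open>1/132\<close> is the
  factor that makes it true on this range.\<close>

lemma log_gain:
  fixes x :: real
  assumes "0 \<le> x" "x \<le> exp 8 - 1"
  shows "(1/132 * ln (1 + x))\<^sup>2 \<le> 1/2 * (1/132 * (x / (1 + x)))"
proof -
  define t where "t = ln (1 + x) / 4"
  have t: "0 \<le> t" "t \<le> 2"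
  proof -
    show "0 \<le> t" using assms by (simp add: t_def)
    have "ln (1 + x) \<le> ln (exp 8)" using assms by (subst ln_le_cancel_iff) auto
    then show "t \<le> 2" by (simp add: t_def)
  qed
  have x: "1 + x = exp (4 * t)" using assms by (simp add: t_def)
  have "(1 + (4 * t) / real 4) ^ 4 \<le> exp (4 * t)"
    by (rule exp_ge_one_plus_x_over_n_power_n) (use t in auto)
  then have q: "(1 + t) ^ 4 \<le> 1 + x" using x by simp
  have "16 * t\<^sup>2 * (1 + t) ^ 4 \<le> 66 * ((1 + t) ^ 4 - 1)"
  proof -
    have "t ^ 3 \<le> 2 * t\<^sup>2" "t ^ 4 \<le> 4 * t\<^sup>2" "t ^ 5 \<le> 8 * t\<^sup>2"
    proof -
      have p: "t ^ (2 + k) \<le> 2 ^ k * t\<^sup>2" for k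
      proof -
        have "t ^ (2 + k) = t ^ k * t\<^sup>2" by (simp only: power_add mult.commute)
        also have "\<dots> \<le> 2 ^ k * t\<^sup>2" using t by (intro mult_right_mono power_mono) auto
        finally show ?thesis .
      qed
      show "t ^ 3 \<le> 2 * t\<^sup>2" "t ^ 4 \<le> 4 * t\<^sup>2" "t ^ 5 \<le> 8 * t\<^sup>2"
        using p[of 1] p[of 2] p[of 3] by simp_all
    qed
    moreover have "t\<^sup>2 \<le> 2 * t" using t by (simp add: power2_eq_square mult_right_mono)
    ultimately have "0 \<le> 264 + 380 * t + 200 * t\<^sup>2 - 30 * t ^ 3 - 64 * t ^ 4 - 16 * t ^ 5"
      using t by linarith
    then have "0 \<le> t * (264 + 380 * t + 200 * t\<^sup>2 - 30 * t ^ 3 - 64 * t ^ 4 - 16 * t ^ 5)"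
      using t by simp
    also have "\<dots> = 66 * ((1 + t) ^ 4 - 1) - 16 * t\<^sup>2 * (1 + t) ^ 4"
      by (simp add: power_numeral_reduce algebra_simps)
    finally show ?thesis by simp
  qed
  then have "(16 * t\<^sup>2) \<le> 66 * (1 - 1 / (1 + t) ^ 4)"
    using t by (simp add: field_simps)
  also have "\<dots> \<le> 66 * (1 - 1 / (1 + x))"
    using q t by (simp add: frac_le)
  also have "1 - 1 / (1 + x) = x / (1 + x)" using assms by (simp add: field_simps)
  finally have "(ln (1 + x))\<^sup>2 \<le> 66 * (x / (1 + x))" by (simp add: t_def power_divide)
  moreover have "(1/132 * l)\<^sup>2 \<le> 1/2 * (1/132 * y)" if "l\<^sup>2 \<le> 66 * y" for l y :: real
    using that by (simp add: power2_eq_square)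
  ultimately show ?thesis by blast
qed

lemma ln_one_plus_scaled:
  fixes t c :: real
  assumes "0 \<le> t" "t \<le> 1" "0 \<le> c"
  shows "t * ln (1 + c) \<le> ln (1 + t * c)"
proof -
  have "concave_on {0<..} (ln :: real \<Rightarrow> real)" by (rule ln_concave)
  then have "(1 - t) * ln 1 + t * ln (1 + c) \<le> ln ((1 - t) *\<^sub>R 1 + t *\<^sub>R (1 + c))"
    using assms by (intro concave_onD) auto
  then show ?thesis by (simp add: algebra_simps)
qed

text \<open>Here \<open>\<tau> = \<psi>0 powr (1 - b)\<close>, \<open>\<theta> = g / \<psi>0\<close> with \<open>g = S - \<psi>0\<close>, and \<open>1 + x\<close> is the argument of the
  logarithm \<open>F\<close>.  On the left are the time term and the price of the comparison function, on the right
  the room that is left and the gain from the Laplacian of \<open>g\<close>.  For \<open>\<tau> \<le> 7/10\<close> the time term is small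
  enough; for larger \<open>\<tau>\<close> it is close to \<open>n\<close> only if \<open>\<theta>\<close> is close to \<open>n - 1\<close>, and then \<open>x\<close>, and with
  it the gain, is large.  The constant \<open>244/7\<close> is the product of \<open>122/5\<close> from the comparison function
  and \<open>10/7\<close> from \<open>psi_star\<close>.\<close>

lemma gain_beats_excess:
  fixes n \<tau> \<theta> x \<beta> :: real
  assumes n: "n \<ge> 5" and tau: "0 \<le> \<tau>" "\<tau> \<le> 1" and theta: "0 \<le> \<theta>" "\<theta> \<le> n - 1"
    and x: "0 \<le> x" "\<tau> > 7/10 \<Longrightarrow> (exp 8 - 1) * (exp (- (1/4)) / 2) * (\<theta> / (n - 1)) \<le> x"
  shows "\<tau> * (1 + \<theta>) + 244/7 * \<tau> * \<theta> * (1/132 * (x / (1 + x)))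
    \<le> n - 1 + 2 * (1/132 * ln (1 + x)) * (n * (n - 1))"
proof (cases "\<tau> > 7/10")
  case False
  define y where "y = x / (1 + x)"
  have y: "0 \<le> y" "y \<le> 1" using x(1) by (auto simp: y_def)
  have lny: "y \<le> ln (1 + x)"
  proof -
    have "ln (1 / (1 + x)) \<le> 1 / (1 + x) - 1" using x(1) by (intro ln_le_minus_one) auto
    then show ?thesis using x(1) by (simp add: y_def ln_div field_simps)
  qed
  have "\<tau> * (1 + \<theta>) \<le> 7/10 * n" using False tau theta by (intro mult_mono) auto
  moreover have "244/7 * \<tau> * \<theta> * (1/132 * y) \<le> 122/5 * (n - 1) * (1/132 * y)"
    using False tau theta y by (intro mult_right_mono mult_mono) auto
  moreover have "2 * (1/132 * y) * (n * (n - 1)) \<le> 2 * (1/132 * ln (1 + x)) * (n * (n - 1))"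
    using lny n by (intro mult_right_mono) auto
  moreover have "122/5 * (n - 1) * (1/132 * y) - 2 * (1/132 * y) * (n * (n - 1)) \<le> n - 1 - 7/10 * n"
  proof -
    have "n * n \<ge> 5 * n" using n by (intro mult_right_mono) auto
    then have c: "(n - 1) * (122/5 - 2 * n) \<le> 198/5 * n - 132"
    proof -
      have "(n - 1) * (122/5 - 2 * n) = 132/5 * n - 2 * (n * n) - 122/5" by (simp add: field_simps)
      also have "\<dots> \<le> 198/5 * n - 132" using \<open>n * n \<ge> 5 * n\<close> n by linarith
      finally show ?thesis .
    qed
    have "y * ((n - 1) * (122/5 - 2 * n)) \<le> 198/5 * n - 132"
    proof (cases "(n - 1) * (122/5 - 2 * n) \<le> 0")
      case True
      with y(1) have "y * ((n - 1) * (122/5 - 2 * n)) \<le> 0" by (rule mult_nonneg_nonpos)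
      then show ?thesis using n by linarith
    next
      case False
      then have "y * ((n - 1) * (122/5 - 2 * n)) \<le> 1 * ((n - 1) * (122/5 - 2 * n))"
        using y by (intro mult_right_mono) auto
      then show ?thesis using c by linarith
    qed
    then have "1/132 * (y * ((n - 1) * (122/5 - 2 * n))) \<le> 1/132 * (198/5 * n - 132)"
      by (rule mult_left_mono) simp
    then show ?thesis by (simp add: field_simps)
  qed
  ultimately show ?thesis unfolding y_def by linarith
next
  case True
  define \<rho> :: real where "\<rho> = exp (- (1/4)) / 2"
  define L where "L = ln (1 + x)"
  have "\<theta> / (n - 1) * 7 \<le> L"
  proof -
    have "2 \<le> exp (3/4 :: real)"
      using exp_lower_Taylor_quadratic[of "3/4 :: real"] by (simp add: power2_eq_square)
    then have "2 * exp (1/4 :: real) \<le> exp (3/4) * exp (1/4)" by (intro mult_right_mono) auto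
    also have "\<dots> = exp 1" by (simp flip: exp_add)
    finally have rho: "exp (- 1) \<le> \<rho>"
      by (simp add: \<rho>_def exp_minus field_simps)
    have "\<rho> \<le> 1" 
    proof -
      have "exp (- (1/4)) \<le> exp (0::real)" by (subst exp_le_cancel_iff) simp
      then show ?thesis unfolding \<rho>_def exp_zero by linarith
    qed
    have "exp 7 = exp 8 * exp (- 1 :: real)" by (simp flip: exp_add)
    also have "\<dots> \<le> exp 8 * \<rho>" using rho by (intro mult_left_mono) auto
    also have "\<dots> \<le> 1 + (exp 8 - 1) * \<rho>" using \<open>\<rho> \<le> 1\<close> by (simp add: algebra_simps)
    finally have "exp 7 \<le> 1 + (exp 8 - 1) * \<rho>" .
    moreover have "(0::real) < exp 7" by simp
    ultimately have "0 < 1 + (exp 8 - 1) * \<rho>" by linarith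
    with \<open>exp 7 \<le> 1 + (exp 8 - 1) * \<rho>\<close> have 7: "7 \<le> ln (1 + (exp 8 - 1) * \<rho>)" by (subst ln_ge_iff)
    have r0: "0 \<le> (exp 8 - 1) * \<rho>" by (simp add: \<rho>_def)
    have th: "0 \<le> \<theta> / (n - 1)" "\<theta> / (n - 1) \<le> 1" using theta n by auto
    have "\<theta> / (n - 1) * 7 \<le> \<theta> / (n - 1) * ln (1 + (exp 8 - 1) * \<rho>)"
      using 7 th by (intro mult_left_mono)
    also have "\<dots> \<le> ln (1 + \<theta> / (n - 1) * ((exp 8 - 1) * \<rho>))"
      by (rule ln_one_plus_scaled[OF th r0])
    also have "\<dots> \<le> L"
    proof -
      have "\<theta> / (n - 1) * ((exp 8 - 1) * \<rho>) \<le> x"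
        using x(2)[OF True] by (simp add: \<rho>_def mult_ac)
      moreover have "0 \<le> \<theta> / (n - 1) * ((exp 8 - 1) * \<rho>)" using th(1) r0 by (rule mult_nonneg_nonneg)
      ultimately show ?thesis unfolding L_def by (intro ln_mono) linarith+
    qed
    finally show ?thesis .
  qed
  then have "\<theta> * 7 \<le> (n - 1) * L" using n by (simp add: pos_divide_le_eq mult_ac)
  then have h1: "n * (\<theta> * 7) \<le> n * ((n - 1) * L)" using n by (intro mult_left_mono) auto
  have h2: "\<tau> * (1 + \<theta>) \<le> 1 * (1 + \<theta>)" using tau theta by (intro mult_right_mono) auto
  have h3: "244/7 * \<tau> * \<theta> * (1/132 * (x / (1 + x))) \<le> 244/7 * 1 * \<theta> * (1/132 * 1)"
    using tau theta x(1) by (intro mult_mono) auto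
  have h4: "\<theta> * (1 + 244/924 - 14/132 * n) \<le> n - 2"
  proof (cases "1 + 244/924 - 14/132 * n \<le> 0")
    case True
    with theta(1) have "\<theta> * (1 + 244/924 - 14/132 * n) \<le> 0" by (rule mult_nonneg_nonpos)
    then show ?thesis using n by linarith
  next
    case False
    then have "\<theta> * (1 + 244/924 - 14/132 * n) \<le> (n - 1) * (1 + 244/924 - 14/132 * n)"
      using theta by (intro mult_right_mono) auto
    also have "\<dots> \<le> n - 2"
    proof -
      have "n * n \<ge> 5 * n" using n by (intro mult_right_mono) auto
      moreover have "(n - 1) * (1 + 244/924 - 14/132 * n) = 211/154 * n - 7/66 * (n * n) - 292/231"
        by (simp add: field_simps)
      ultimately show ?thesis using n by linarith
    qed
    finally show ?thesis .
  qed
  have e1: "n * (\<theta> * 7) = 7 * (n * \<theta>)" by simp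
  have e2: "2 * (1/132 * L) * (n * (n - 1)) = 1/66 * (n * ((n - 1) * L))" by simp
  have e3: "\<theta> * (1 + 244/924 - 14/132 * n) = 292/231 * \<theta> - 7/66 * (n * \<theta>)" by (simp add: algebra_simps)
  have e4: "244/7 * 1 * \<theta> * (1/132 * 1) = 61/231 * \<theta>" by simp
  have fin: "A + C \<le> n - 1 + 1/66 * P"
    if "7 * q \<le> P" "A \<le> 1 * (1 + \<theta>)" "C \<le> 61/231 * \<theta>" "292/231 * \<theta> - 7/66 * q \<le> n - 2"
    for A C P q :: real
    using that by argo
  show ?thesis unfolding L_def[symmetric] e2
    by (rule fin[OF h1[unfolded e1] h2 h3[unfolded e4] h4[unfolded e3]])
qed

text \<open>Completing the square twice.  The first square is that of \<open>\<nabla>w + w V / g\<close> with \<open>V = F \<nabla>g\<close>; the second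
  removes the mixed term with the gradient of the comparison function.\<close>

lemma complete_squares:
  fixes g p1 p2 q1 q2 w d1 d2 F Fy Lap \<mu>2 :: real
  assumes g: "g > 0" and Fy: "F\<^sup>2 \<le> 1/2 * Fy" "0 \<le> Fy" and q: "q1\<^sup>2 + q2\<^sup>2 \<le> \<mu>2"
  shows "w\<^sup>2 * (F * Lap - 1/2 * \<mu>2 * (g * Fy))
    \<le> (d1\<^sup>2 + d2\<^sup>2) * g + 2 * w * (d1 * (F * p1) + d2 * (F * p2))
      + w\<^sup>2 * (F * Lap + Fy * ((p1\<^sup>2 + p2\<^sup>2) / g - (p1 * q1 + p2 * q2)))"
proof -
  have "0 \<le> (g * d1 + w * (F * p1))\<^sup>2 + (g * d2 + w * (F * p2))\<^sup>2" by simp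
  also have "\<dots> = g * ((d1\<^sup>2 + d2\<^sup>2) * g + 2 * w * (d1 * (F * p1) + d2 * (F * p2)) + w\<^sup>2 * (F\<^sup>2 * ((p1\<^sup>2 + p2\<^sup>2) / g)))"
    using g by (simp add: field_simps power2_eq_square)
  finally have 1: "0 \<le> (d1\<^sup>2 + d2\<^sup>2) * g + 2 * w * (d1 * (F * p1) + d2 * (F * p2)) + w\<^sup>2 * (F\<^sup>2 * ((p1\<^sup>2 + p2\<^sup>2) / g))"
    using g by (simp add: zero_le_mult_iff)
  have "0 \<le> ((p1 - g * q1)\<^sup>2 + (p2 - g * q2)\<^sup>2) / g" using g by simp
  also have "\<dots> = (p1\<^sup>2 + p2\<^sup>2) / g - 2 * (p1 * q1 + p2 * q2) + g * (q1\<^sup>2 + q2\<^sup>2)"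
    using g by (simp add: field_simps power2_eq_square)
  also have "g * (q1\<^sup>2 + q2\<^sup>2) \<le> g * \<mu>2" using q g by (intro mult_left_mono) auto
  finally have 2: "0 \<le> 1/2 * ((p1\<^sup>2 + p2\<^sup>2) / g) - (p1 * q1 + p2 * q2) + 1/2 * (g * \<mu>2)" by simp
  have alg: "f * A - 1/2 * \<mu>2 * (g * Fy) \<le> Fy * (A - C)"
    if "f * A \<le> 1/2 * Fy * A" "0 \<le> Fy * (1/2 * A - C + 1/2 * (g * \<mu>2))" for f A C :: real
    using that by (simp add: algebra_simps)
  have "F\<^sup>2 * ((p1\<^sup>2 + p2\<^sup>2) / g) \<le> 1/2 * Fy * ((p1\<^sup>2 + p2\<^sup>2) / g)"
    using Fy g by (intro mult_right_mono) auto
  moreover have "0 \<le> Fy * (1/2 * ((p1\<^sup>2 + p2\<^sup>2) / g) - (p1 * q1 + p2 * q2) + 1/2 * (g * \<mu>2))"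
    using 2 Fy by (intro mult_nonneg_nonneg)
  ultimately have "F\<^sup>2 * ((p1\<^sup>2 + p2\<^sup>2) / g) - 1/2 * \<mu>2 * (g * Fy) \<le> Fy * ((p1\<^sup>2 + p2\<^sup>2) / g - (p1 * q1 + p2 * q2))"
    by (rule alg)
  then have "w\<^sup>2 * (F\<^sup>2 * ((p1\<^sup>2 + p2\<^sup>2) / g) - 1/2 * \<mu>2 * (g * Fy)) \<le> w\<^sup>2 * (Fy * ((p1\<^sup>2 + p2\<^sup>2) / g - (p1 * q1 + p2 * q2)))"
    by (intro mult_left_mono) auto
  then show ?thesis using 1 by (simp add: algebra_simps)
qed

context flow
begin

text \<open>The bound \<open>\<psi>0 powr b\<close> for \<open>\<Delta>\<psi>0\<close> is not linear in \<open>\<psi>0\<close>.  It is at most \<open>10/7\<close> times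
  \<open>\<psi>0 + psi_star\<close>, where \<open>psi_star\<close> is the value of \<open>\<psi>0\<close> at which \<open>\<psi>0 powr (1 - b)\<close> is \<open>7/10\<close>.\<close>

definition psi_star :: real where "psi_star = (7/10) powr (1 / (1 - b))"

lemma psi_star: "psi_star > 0" "psi_star powr (1 - b) = 7/10"
  using b by (auto simp: psi_star_def powr_powr)

lemma psi_star_dominates:
  assumes "0 \<le> t"
  shows "t powr b \<le> 10/7 * (t + psi_star)"
proof (cases "t = 0")
  case True
  then show ?thesis using psi_star by simp
next
  case False
  then have t: "t > 0" using assms by simp
  have eq: "s powr b * s powr (1 - b) = s" if "s > 0" for s
    using that by (simp flip: powr_add)
  show ?thesis
  proof (cases "psi_star \<le> t")
    case True
    have "7/10 \<le> t powr (1 - b)"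
      using powr_mono2[of "1 - b" psi_star t] psi_star True b by simp
    then have "t powr b * (7/10) \<le> t powr b * t powr (1 - b)" by (intro mult_left_mono) auto
    then show ?thesis using eq[OF t] psi_star by simp
  next
    case False
    then have "t powr b \<le> psi_star powr b" using t b by (intro powr_mono2) auto
    moreover have "psi_star powr b * (7/10) = psi_star" using eq[OF psi_star(1)] psi_star by simp
    ultimately show ?thesis using t by simp
  qed
qed

lemma laplacian_psi0: "\<psi>0 x \<noteq> 0 \<Longrightarrow> \<bar>laplacian \<psi>0 x\<bar> \<le> C0 / R0\<^sup>2 * \<psi>0 x powr b"
proof -
  assume x: "\<psi>0 x \<noteq> 0"
  then have "\<bar>laplacian \<psi>0 x\<bar> / \<psi>0 x powr b \<le> C0 / R0\<^sup>2"
    using psi0(5) unfolding cutoff_bounds_def b_def by blast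
  moreover have "\<psi>0 x powr b > 0" using x by simp
  ultimately show ?thesis by (simp add: pos_divide_le_eq)
qed

lemma laplacian_psi0_shifted: "\<bar>laplacian \<psi>0 x\<bar> \<le> C0 / R0\<^sup>2 * (10/7) * (\<psi>0 x + psi_star)"
proof -
  let ?A = "{x. \<bar>laplacian \<psi>0 x\<bar> \<le> C0 / R0\<^sup>2 * (10/7) * (\<psi>0 x + psi_star)}"
  let ?S = "closure {x. \<psi>0 x \<noteq> 0}"
  have "closed ?A"
    by (intro closed_Collect_le continuous_intros cont_psi psi0)
  moreover have "{x. \<psi>0 x \<noteq> 0} \<subseteq> ?A"
  proof (intro subsetI CollectI)
    fix x assume x: "x \<in> {x. \<psi>0 x \<noteq> 0}"
    have "\<bar>laplacian \<psi>0 x\<bar> \<le> C0 / R0\<^sup>2 * \<psi>0 x powr b" using x laplacian_psi0 by simp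
    also have "\<dots> \<le> C0 / R0\<^sup>2 * (10/7 * (\<psi>0 x + psi_star))"
      using psi_star_dominates psi0 C0 by (intro mult_left_mono) auto
    finally show "\<bar>laplacian \<psi>0 x\<bar> \<le> C0 / R0\<^sup>2 * (10/7) * (\<psi>0 x + psi_star)" by (simp only: mult.assoc)
  qed
  ultimately have "?S \<subseteq> ?A" by (rule closure_minimal[rotated])
  moreover have "x \<in> ?A" if "x \<notin> ?S"
  proof -
    have 0: "y \<in> - ?S \<Longrightarrow> \<psi>0 y = 0" for y using closure_subset[of "{x. \<psi>0 x \<noteq> 0}"] by blast
    have z: "dx i (\<lambda>_. 0) y = 0" for i and y :: "real^2" by (simp add: D_def frechet_derivative_const)
    have oS: "open (- ?S)" by (simp add: open_Compl)
    have 1: "dx i \<psi>0 y = 0" if "y \<in> - ?S" for i y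
    proof -
      have "dx i \<psi>0 y = dx i (\<lambda>_. 0) y" by (rule D_cong[OF oS that 0])
      then show ?thesis using z by simp
    qed
    have "dx i (dx i \<psi>0) x = 0" for i
    proof -
      have "x \<in> - ?S" using that by simp
      have "dx i (dx i \<psi>0) x = dx i (\<lambda>_. 0) x" by (rule D_cong[OF oS \<open>x \<in> - ?S\<close> 1])
      then show ?thesis using z by simp
    qed
    then show ?thesis using psi0(2)[of x] psi_star C0 by (simp add: laplacian_D)
  qed
  ultimately show ?thesis by blast
qed

lemma powr_b_split:
  assumes "0 < t"
  shows "t powr b * t powr (1 - b) = t"
  using assms by (simp flip: powr_add)

text \<open>The triangle inequality gives this with \<open>n\<^sup>2 + 1\<close> instead of \<open>n\<^sup>2\<close>.  With \<open>g = S - \<psi>0\<close> and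
  \<open>V = F \<nabla>g\<close>, adding the integral of \<open>\<eta> div (\<omega>\<^sup>2 V)\<close>, which is zero, to \<open>\<integral> \<eta> |\<nabla>\<omega>|\<^sup>2 g\<close> and completing squares
  bounds the latter below by \<open>\<integral> \<eta> \<omega>\<^sup>2 (F \<Delta>g - \<dots>)\<close>.  This lowers the coefficient of \<open>\<Delta>g\<close> in the
  error from \<open>1\<close> to \<open>1 - 2 F\<close>, and \<open>F\<close> is large where the error is.\<close>

theorem flux_lower_bound:
  fixes n :: real
  assumes S: "admissible S" and n: "n \<ge> 5"
    and g: "\<And>x. \<psi>0 x \<le> S x" "\<And>x. S x \<le> n * \<psi>0 x"
    and lap: "\<And>x. \<psi>0 x \<noteq> 0 \<Longrightarrow> \<bar>laplacian S x - laplacian \<psi>0 x\<bar> \<le> C0 / R0\<^sup>2 * (n * (n - 1)) * \<psi>0 x powr b"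
  shows "\<nu> * J (\<lambda>z. sq_grad_w z * (\<eta> (fst z) * \<psi>0 (snd z))) - \<nu> * C0 / R0\<^sup>2 * n\<^sup>2 * E_tot \<le> flux S"
proof -
  define B' where "B' = C0 / R0\<^sup>2"
  define B where "B = B' * (10/7)"
  have B': "B' > 0" and B: "B > 0" using C0 R0 by (auto simp: B'_def B_def)
  interpret sup: laplacian_controlled \<psi>0 psi_star B
    using laplacian_psi0_shifted psi0 psi_star B by unfold_locales (auto simp: B_def B'_def)
  obtain h h' where h: "continuous_on UNIV h" "\<And>i. continuous_on UNIV (h' i)"
    and ddh: "\<And>x i. dd h (axis i 1) x (h' i x)"
    and hb: "\<And>x. \<psi>0 x + psi_star \<le> exp (1/8) * h x" "\<And>x. h x \<le> exp (1/8) * (\<psi>0 x + psi_star)"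
      "\<And>x. (h' (1::2) x)\<^sup>2 + (h' 2 x)\<^sup>2 \<le> 122/5 * B * (h x)\<^sup>2"
    using sup.comparison_function by blast
  have hpos: "h x > 0" for x
  proof -
    have "0 < \<psi>0 x + psi_star" using psi0(2)[of x] psi_star by simp
    then have "0 < exp (1/8) * h x" using hb(1)[of x] by linarith
    then show ?thesis by (simp add: zero_less_mult_iff)
  qed
  define g where "g x = S x - \<psi>0 x" for x
  have Ss: "smooth_on S UNIV" using S by (simp add: admissible_def)
  have gs: "smooth_on g UNIV" unfolding g_def[abs_def] by (intro smooth_on_diff Ss psi0) simp
  have g0: "0 \<le> g x" "g x \<le> (n - 1) * \<psi>0 x" for x
    using g[of x] by (auto simp: g_def algebra_simps)
  have lapg: "laplacian g x = laplacian S x - laplacian \<psi>0 x" for x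
  proof -
    have 1: "dx i g = (\<lambda>y. dx i S y - dx i \<psi>0 y)" for i
      unfolding g_def[abs_def] by (rule ext) (rule D_diff[OF _ Ss psi0(1)], auto)
    have "dx i (dx i g) x = dx i (dx i S) x - dx i (dx i \<psi>0) x" for i
      unfolding 1 by (rule D_diff[of UNIV]) (auto intro!: smooth_on_D Ss psi0)
    then show ?thesis by (simp add: laplacian_D)
  qed
  \<comment> \<open>The choice of \<open>\<kappa>\<close> makes \<open>exp 8 - 1\<close> the largest possible value of \<open>X\<close>.\<close>
  define \<kappa> where "\<kappa> = (exp 8 - 1) * exp (- (1/8)) / (n - 1)"
  have \<kappa>: "\<kappa> > 0" using n by (simp add: \<kappa>_def)
  define X where "X x = \<kappa> * g x / h x" for x
  have X: "0 \<le> X x" "X x \<le> exp 8 - 1" for x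
  proof -
    show "0 \<le> X x" using \<kappa> g0 hpos[of x] by (simp add: X_def)
    have "g x \<le> (n - 1) * (exp (1/8) * h x)"
    proof -
      have "\<psi>0 x \<le> exp (1/8) * h x" using hb(1)[of x] psi_star by linarith
      then have "(n - 1) * \<psi>0 x \<le> (n - 1) * (exp (1/8) * h x)" using n by (intro mult_left_mono) auto
      then show ?thesis using g0(2)[of x] by linarith
    qed
    then have "\<kappa> * g x \<le> \<kappa> * ((n - 1) * (exp (1/8) * h x))" using \<kappa> by (intro mult_left_mono) auto
    also have "\<dots> = (exp 8 - 1) * (exp (- (1/8)) * exp (1/8)) * h x" using n by (simp add: \<kappa>_def)
    also have "exp (- (1/8)) * exp (1/8) = (1::real)" by (simp flip: exp_add)
    finally show "X x \<le> exp 8 - 1" using hpos[of x] by (simp add: X_def pos_divide_le_eq)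
  qed
  define F where "F x = 1/132 * ln (1 + X x)" for x
  \<comment> \<open>This is \<open>X\<close> times the derivative of \<open>F\<close> with respect to \<open>X\<close>.\<close>
  define Fy where "Fy x = 1/132 * (X x / (1 + X x))" for x
  have F: "0 \<le> F x" "F x \<le> 1/2" "(F x)\<^sup>2 \<le> 1/2 * Fy x" "0 \<le> Fy x" for x
  proof -
    show "0 \<le> F x" "0 \<le> Fy x" using X[of x] by (auto simp: F_def Fy_def)
    show *: "(F x)\<^sup>2 \<le> 1/2 * Fy x" unfolding F_def Fy_def by (rule log_gain[OF X])
    have "Fy x \<le> 1/132 * 1" unfolding Fy_def using X[of x] by (intro mult_left_mono) auto
    then have "(F x)\<^sup>2 \<le> (1/2)\<^sup>2" using * by (simp add: power2_eq_square)
    then show "F x \<le> 1/2" by (rule power2_le_imp_le) simp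
  qed
  let ?dX = "\<lambda>i x. \<kappa> * dx i g x / h x - \<kappa> * g x * h' i x / (h x)\<^sup>2"
  define V where "V i x = F x * dx i g x" for i x
  define V' where "V' i x = (1/132 * (1 / (1 + X x)) * ?dX i x) * dx i g x + F x * dx i (dx i g) x" for i x
  have ddX: "dd X (axis i 1) x (?dX i x)" for i x
  proof -
    have "dd (\<lambda>x. \<kappa> * g x) (axis i 1) x (0 * g x + \<kappa> * dx i g x)"
      by (intro dd_mult dd_const dd_D[OF gs]) simp
    from dd_divide[OF this ddh] hpos[of x] show ?thesis by (simp add: X_def[abs_def])
  qed
  have ddF: "dd F (axis i 1) x (1/132 * (1 / (1 + X x)) * ?dX i x)" for i x
  proof -
    have "((\<lambda>s. 1/132 * ln (1 + s)) has_real_derivative 1/132 * (1 / (1 + X x))) (at (X x))"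
    proof (rule DERIV_cmult)
      show "((\<lambda>s. ln (1 + s)) has_real_derivative 1 / (1 + X x)) (at (X x))"
        using X(1)[of x] by (auto intro!: derivative_eq_intros)
    qed
    from dd_compose[OF ddX this] show ?thesis by (simp only: F_def[abs_def])
  qed
  have ddV: "dd (V i) (axis i 1) x (V' i x)" for i x
    unfolding V_def[abs_def] V'_def by (intro dd_mult ddF dd_D[of _ UNIV] smooth_on_D gs) auto
  note contg = cont_psi[OF gs]
  have hne: "h x \<noteq> 0" "1 + X x \<noteq> 0" "1 + X x > 0" for x using hpos[of x] X(1)[of x] by auto
  have contX: "continuous_on UNIV X" unfolding X_def[abs_def]
    by (intro continuous_intros contg h ballI hne)
  have contF: "continuous_on UNIV F" unfolding F_def[abs_def]
    by (intro continuous_intros contX ballI hne)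
  have contFy: "continuous_on UNIV Fy" unfolding Fy_def[abs_def]
    by (intro continuous_intros contX ballI hne)
  have contV: "continuous_on UNIV (V i)" "continuous_on UNIV (V' i)" for i
    unfolding V_def[abs_def] V'_def[abs_def]
    by (intro continuous_intros contg h contX contF ballI hne power_not_zero)+
  have gzero: "\<psi>0 x = 0 \<Longrightarrow> g x = 0" for x using g0[of x] by simp
  have dgzero: "g x = 0 \<Longrightarrow> dx i g x = 0" for i x
    by (rule min_zero_grad[OF gs g0(1)])
  have div0: "J (\<lambda>z. \<eta> (fst z) * (2 * w z * (D (es 1) w z * V 1 (snd z) + D (es 2) w z * V 2 (snd z))
      + (w z)\<^sup>2 * (V' 1 (snd z) + V' 2 (snd z)))) = 0"
    by (rule weighted_divergence_zero[OF ddV ddV contV(1) contV(1) contV(2) contV(2)])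
      (use gzero dgzero in \<open>auto simp: V_def\<close>)
  define \<mu>2 where "\<mu>2 = 122/5 * B"
  have point: "(w z)\<^sup>2 * (F x * laplacian g x - 1/2 * \<mu>2 * (g x * Fy x))
    \<le> sq_grad_w z * g x + 2 * w z * (D (es 1) w z * V 1 x + D (es 2) w z * V 2 x)
      + (w z)\<^sup>2 * (V' 1 x + V' 2 x)" for z x
  proof (cases "g x = 0")
    case True
    then have "F x = 0" by (simp add: F_def X_def)
    then show ?thesis using True dgzero[of x] by (simp add: V_def V'_def)
  next
    case False
    then have gp: "g x > 0" using g0(1)[of x] by simp
    have q: "(h' 1 x / h x)\<^sup>2 + (h' 2 x / h x)\<^sup>2 \<le> \<mu>2"
      using hb(3)[of x] hpos[of x] by (simp add: \<mu>2_def power_divide divide_simps flip: add_divide_distrib)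
    have dF: "1/132 * (1 / (1 + X x)) * ?dX i x = Fy x * (dx i g x / g x - h' i x / h x)" for i
    proof -
      have "?dX i x = X x * (dx i g x / g x - h' i x / h x)"
        using gp hpos[of x] by (simp add: X_def field_simps power2_eq_square)
      then show ?thesis by (simp add: Fy_def)
    qed
    have "V' 1 x + V' 2 x = F x * laplacian g x
      + Fy x * (((dx 1 g x)\<^sup>2 + (dx 2 g x)\<^sup>2) / g x - (dx 1 g x * (h' 1 x / h x) + dx 2 g x * (h' 2 x / h x)))"
      unfolding V'_def dF laplacian_D by (simp add: algebra_simps power2_eq_square add_divide_distrib)
    with complete_squares[OF gp F(3,4) q, where w = "w z" and Lap = "laplacian g x"
      and ?d1.0 = "D (es 1) w z" and ?d2.0 = "D (es 2) w z" and ?p1.0 = "dx 1 g x" and ?p2.0 = "dx 2 g x"]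
    show ?thesis by (simp add: V_def)
  qed
  define R1 where "R1 x = F x * laplacian g x - 1/2 * \<mu>2 * (g x * Fy x)" for x
  have contR1: "continuous_on UNIV R1" unfolding R1_def[abs_def]
    by (intro continuous_intros contF contFy contg)
  note csnd = cont_snd[OF contR1] cont_snd[OF contg(1)] cont_snd[OF contV(1)] cont_snd[OF contV(2)]
    cont_snd[OF cont_psi(1)[OF psi0(1)]] cont_snd[OF cont_psi(1)[OF Ss]] cont_snd[OF cont_psi(4)[OF Ss]]
  note cK = continuous_on_subset[OF _ K(3)]
  let ?\<eta> = "\<lambda>z::real \<times> (real^2). \<eta> (fst z)"
  let ?R = "\<lambda>z. ?\<eta> z * ((w z)\<^sup>2 * R1 (snd z))"
  let ?Dv = "\<lambda>z. ?\<eta> z * (2 * w z * (D (es 1) w z * V 1 (snd z) + D (es 2) w z * V 2 (snd z))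
      + (w z)\<^sup>2 * (V' 1 (snd z) + V' 2 (snd z)))"
  let ?G = "\<lambda>z. sq_grad_w z * (?\<eta> z * g (snd z))"
  let ?P = "\<lambda>z. sq_grad_w z * (?\<eta> z * \<psi>0 (snd z))"
  let ?T = "\<lambda>z. 1/2 * (w z)\<^sup>2 * (deriv \<eta> (fst z) * S (snd z) + \<nu> * (?\<eta> z * laplacian S (snd z)))"
  have cR: "continuous_on K ?R" and cD: "continuous_on K ?Dv" and cG: "continuous_on K ?G"
    and cP: "continuous_on K ?P" and cT: "continuous_on K ?T"
    by (intro cK continuous_intros csnd)+
  have "J ?R \<le> J (\<lambda>z. ?G z + ?Dv z)"
  proof (rule J_mono_AE)
    show "set_integrable lborel K ?R" "set_integrable lborel K (\<lambda>z. ?G z + ?Dv z)"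
      by (intro set_integrable_compact K continuous_on_add cR cG cD)+
    show "AE z in lborel. z \<in> K \<longrightarrow> ?R z \<le> ?G z + ?Dv z"
    proof (intro AE_I2 impI)
      fix z
      have "?\<eta> z * ((w z)\<^sup>2 * R1 (snd z)) \<le> ?\<eta> z * (sq_grad_w z * g (snd z)
        + 2 * w z * (D (es 1) w z * V 1 (snd z) + D (es 2) w z * V 2 (snd z))
        + (w z)\<^sup>2 * (V' 1 (snd z) + V' 2 (snd z)))"
        unfolding R1_def by (intro mult_left_mono point eta)
      then show "?R z \<le> ?G z + ?Dv z" by (simp add: algebra_simps)
    qed
  qed
  also have "\<dots> = J ?G" using J_add[OF cG cD] div0 by simp
  finally have RG: "J ?R \<le> J ?G" .
  have "J (\<lambda>z. sq_grad_w z * (?\<eta> z * S (snd z))) = J (\<lambda>z. ?P z + ?G z)"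
    by (rule J_cong) (simp add: g_def algebra_simps)
  then have JS: "J (\<lambda>z. sq_grad_w z * (?\<eta> z * S (snd z))) = J ?P + J ?G"
    using J_add[OF cP cG] by simp
  let ?f = "\<lambda>z. ?T z - \<nu> * ?R z"
  have "J ?f \<le> \<nu> * B' * n\<^sup>2 * E_tot + (\<nu> * B' * n\<^sup>2 - \<nu> * B' * n\<^sup>2) * E_out"
  proof (rule J_le_E)
    show "continuous_on K ?f" by (intro continuous_on_diff continuous_on_mult continuous_on_const cT cR)
    show "AE z in lborel. z \<in> K \<longrightarrow> ?\<eta> z = 0 \<or> \<psi>0 (snd z) = 0 \<longrightarrow> ?f z \<le> 0"
      using laplacian_zero_on_zero_set[OF S] laplacian_zero_on_zero_set[OF admissible_psi0]
    proof eventually_elim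
      case (elim z)
      show ?case
      proof (intro impI)
        assume z: "z \<in> K" and "?\<eta> z = 0 \<or> \<psi>0 (snd z) = 0"
        show "?f z \<le> 0"
        proof (cases "?\<eta> z = 0")
          case True
          then have "deriv \<eta> (fst z) = 0" using deriv_eta_bound[of "fst z"] by simp
          then show ?thesis using True by simp
        next
          case False
          then have p: "\<psi>0 (snd z) = 0" using \<open>_ \<or> _\<close> by simp
          moreover have "S (snd z) = 0" using S p by (simp add: admissible_def)
          ultimately show ?thesis using elim z False gzero[OF p] by (simp add: lapg R1_def)
        qed
      qed
    qed
    fix z assume z: "z \<in> K" "?\<eta> z \<noteq> 0" "\<psi>0 (snd z) \<noteq> 0"
    define x where "x = snd z"
    define t where "t = \<psi>0 x"
    define e where "e = ?\<eta> z"
    have t: "0 < t" "t \<le> 1" using z psi0(2,3)[of x] by (auto simp: t_def x_def)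
    have e: "0 < e" using z eta(2)[of "fst z"] by (simp add: e_def)
    define \<tau> where "\<tau> = t powr (1 - b)"
    define \<theta> where "\<theta> = g x / t"
    have tau: "0 < \<tau>" "\<tau> \<le> 1" using t b by (auto simp: \<tau>_def powr_le1)
    have th: "0 \<le> \<theta>" "\<theta> \<le> n - 1" using g0[of x] t by (auto simp: \<theta>_def t_def pos_divide_le_eq)
    have tb: "t = t powr b * \<tau>" using powr_b_split[OF t(1)] by (simp add: \<tau>_def)
    have gx: "g x = t powr b * (\<tau> * \<theta>)" 
    proof -
      have "g x = t * \<theta>" using t by (simp add: \<theta>_def)
      also have "\<dots> = (t powr b * \<tau>) * \<theta>" by (rule arg_cong[OF tb])
      finally show ?thesis by (simp only: mult.assoc)
    qed
    have Xlow: "(exp 8 - 1) * (exp (- (1/4)) / 2) * (\<theta> / (n - 1)) \<le> X x" if "\<tau> > 7/10"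
    proof -
      have "psi_star \<le> t"
      proof (rule ccontr)
        assume "\<not> psi_star \<le> t"
        then have "\<tau> \<le> psi_star powr (1 - b)" unfolding \<tau>_def using t b by (intro powr_mono2) auto
        then show False using that psi_star by simp
      qed
      then have "h x \<le> exp (1/8) * (2 * t)"
        using hb(2)[of x] by (simp add: t_def mult_left_mono order_trans[OF hb(2)])
      then have "\<kappa> * g x / (exp (1/8) * (2 * t)) \<le> \<kappa> * g x / h x"
        using \<kappa> g0(1)[of x] hpos[of x] t by (intro divide_left_mono) auto
      moreover have "\<kappa> * g x / (exp (1/8) * (2 * t)) = (exp 8 - 1) * (exp (- (1/8)) / exp (1/8) / 2) * (\<theta> / (n - 1))"
        using t n by (simp add: \<kappa>_def \<theta>_def)
      moreover have "exp (- (1/8)) / exp (1/8) = exp (- (1/4) :: real)"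
        by (simp flip: exp_diff)
      ultimately show ?thesis by (simp add: X_def)
    qed
    have key: "\<tau> * (1 + \<theta>) + 244/7 * \<tau> * \<theta> * Fy x \<le> n - 1 + 2 * F x * (n * (n - 1))"
      using gain_beats_excess[OF n less_imp_le[OF tau(1)] tau(2) th X(1)[of x] Xlow]
      by (simp add: F_def Fy_def)
    have time: "deriv \<eta> (fst z) * S x \<le> \<nu> * B' * (e powr b * S x)"
      using time_term_le[of "S x" "fst z"] S by (simp add: B'_def e_def admissible_def abs_le_iff)
    have Sx: "S x = t powr b * (\<tau> * (1 + \<theta>))"
      using gx tb by (simp add: g_def t_def algebra_simps)
    have L0: "laplacian \<psi>0 x \<le> B' * t powr b"
      using laplacian_psi0[of x] z by (simp add: B'_def t_def x_def abs_le_iff)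
    have Lg: "laplacian g x \<le> B' * (n * (n - 1)) * t powr b"
      using lap[of x] z by (simp add: B'_def t_def x_def lapg abs_le_iff)
    have Lg': "(1 - 2 * F x) * laplacian g x \<le> (1 - 2 * F x) * (B' * (n * (n - 1)) * t powr b)"
      using F(2)[of x] by (intro mult_left_mono Lg) auto
    have "laplacian S x - 2 * (F x * laplacian g x - 1/2 * \<mu>2 * (g x * Fy x))
      = laplacian \<psi>0 x + (1 - 2 * F x) * laplacian g x + \<mu>2 * (g x * Fy x)"
      by (simp add: lapg algebra_simps)
    also have "\<dots> \<le> B' * t powr b + (1 - 2 * F x) * (B' * (n * (n - 1)) * t powr b)
       + B' * (244/7) * (t powr b * (\<tau> * \<theta>) * Fy x)"
      using L0 Lg' gx by (simp add: \<mu>2_def B_def mult_ac)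
    finally have sp: "laplacian S x - 2 * (F x * laplacian g x - 1/2 * \<mu>2 * (g x * Fy x))
      \<le> B' * t powr b * (1 + (1 - 2 * F x) * (n * (n - 1)) + 244/7 * \<tau> * \<theta> * Fy x)" (is "?L \<le> ?U")
      by (simp add: algebra_simps)
    have U0: "0 \<le> ?U"
    proof -
      have "0 \<le> (1 - 2 * F x) * (n * (n - 1))" "0 \<le> 244/7 * \<tau> * \<theta> * Fy x"
        using F[of x] n tau th by auto
      then show ?thesis using B' by simp
    qed
    have "e * ?L \<le> e * ?U" using sp e by (intro mult_left_mono) auto
    also have "\<dots> \<le> e powr b * ?U" using eta_le_powr[of "fst z"] U0 by (intro mult_right_mono) (auto simp: e_def)
    finally have sp2: "e * ?L \<le> e powr b * ?U" .
    have "deriv \<eta> (fst z) * S x + \<nu> * (e * ?L) \<le> \<nu> * B' * (e powr b * S x) + \<nu> * (e powr b * ?U)"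
      using time sp2 nu by (intro add_mono mult_left_mono) auto
    also have "\<dots> = \<nu> * B' * (e powr b * t powr b) *
      (\<tau> * (1 + \<theta>) + 1 + (1 - 2 * F x) * (n * (n - 1)) + 244/7 * \<tau> * \<theta> * Fy x)"
      by (simp add: Sx algebra_simps)
    also have "\<dots> \<le> \<nu> * B' * (e powr b * t powr b) * n\<^sup>2"
    proof (rule mult_left_mono)
      show "\<tau> * (1 + \<theta>) + 1 + (1 - 2 * F x) * (n * (n - 1)) + 244/7 * \<tau> * \<theta> * Fy x \<le> n\<^sup>2"
        using key by (simp add: algebra_simps power2_eq_square)
    qed (use nu B' in auto)
    finally have "deriv \<eta> (fst z) * S x + \<nu> * (e * ?L) \<le> \<nu> * B' * n\<^sup>2 * (e powr b * t powr b)"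
      by (simp add: mult_ac)
    then have le: "1/2 * (w z)\<^sup>2 * (deriv \<eta> (fst z) * S x + \<nu> * (e * ?L))
      \<le> 1/2 * (w z)\<^sup>2 * (\<nu> * B' * n\<^sup>2 * (e powr b * t powr b))"
      by (intro mult_left_mono) auto
    have "?f z = 1/2 * (w z)\<^sup>2 * (deriv \<eta> (fst z) * S x + \<nu> * (e * ?L))"
      by (simp add: x_def e_def R1_def algebra_simps)
    also note le
    also have "1/2 * (w z)\<^sup>2 * (\<nu> * B' * n\<^sup>2 * (e powr b * t powr b)) = \<nu> * B' * n\<^sup>2 * e_dens z"
      using e t by (simp add: e_dens_def powr_mult x_def[symmetric] t_def[symmetric] e_def[symmetric])
    finally show "?f z \<le> (if R0 \<le> norm (snd z) then \<nu> * B' * n\<^sup>2 else \<nu> * B' * n\<^sup>2) * e_dens z"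
      by (simp only: if_cancel)
  qed
  then have "J ?T - \<nu> * J ?R \<le> \<nu> * B' * n\<^sup>2 * E_tot"
    using J_diff[OF cT continuous_on_mult[OF continuous_on_const cR], of \<nu>] by (simp add: J_cmult)
  moreover have "\<nu> * J ?R \<le> \<nu> * J ?G" using RG nu by (intro mult_left_mono) auto
  ultimately have "\<nu> * J ?P - \<nu> * B' * n\<^sup>2 * E_tot \<le> \<nu> * (J ?P + J ?G) - J ?T"
    by (simp add: algebra_simps)
  then show ?thesis unfolding enstrophy_balance[OF S] JS B'_def by simp
qed

end

section \<open>Sums of cut-offs\<close>

text \<open>A cut-off may vanish at a point where its Laplacian does not, but not on an open set.\<close>

lemma shrink_to_dichotomy:
  fixes f :: "'i \<Rightarrow> 'a::topological_space \<Rightarrow> real"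
  assumes "finite I" "open V" "V \<noteq> {}" "\<And>j. j \<in> I \<Longrightarrow> continuous_on UNIV (f j)"
  shows "\<exists>W. open W \<and> W \<noteq> {} \<and> W \<subseteq> V \<and> (\<forall>j\<in>I. (\<forall>x\<in>W. f j x \<noteq> 0) \<or> (\<forall>x\<in>W. f j x = 0))"
  using assms
proof (induction I rule: finite_induct)
  case empty
  show ?case
  proof (intro exI[of _ V] conjI ballI)
    show "open V" "V \<noteq> {}" by (rule empty.prems)+
  qed simp_all
next
  case (insert i I)
  have "\<exists>W. open W \<and> W \<noteq> {} \<and> W \<subseteq> V \<and> (\<forall>j\<in>I. (\<forall>x\<in>W. f j x \<noteq> 0) \<or> (\<forall>x\<in>W. f j x = 0))"
    by (rule insert.IH[OF insert.prems(1,2)]) (rule insert.prems(3), simp)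
  then obtain W where W: "open W" "W \<noteq> {}" "W \<subseteq> V" "\<forall>j\<in>I. (\<forall>x\<in>W. f j x \<noteq> 0) \<or> (\<forall>x\<in>W. f j x = 0)"
    by (elim exE conjE)
  show ?case
  proof (cases "\<exists>x\<in>W. f i x \<noteq> 0")
    case True
    have "open {x. f i x \<noteq> 0}"
      by (rule open_Collect_neq[OF insert.prems(3) continuous_on_const]) simp
    with W(1) have "open (W \<inter> {x. f i x \<noteq> 0})" by (rule open_Int)
    moreover have "(\<forall>x\<in>W \<inter> {x. f i x \<noteq> 0}. f j x \<noteq> 0) \<or> (\<forall>x\<in>W \<inter> {x. f i x \<noteq> 0}. f j x = 0)"
      if "j \<in> insert i I" for j
    proof (cases "j = i")
      case False
      then have "j \<in> I" using that by simp
      then show ?thesis using W(4) by (metis Int_iff)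
    qed simp
    moreover have "W \<inter> {x. f i x \<noteq> 0} \<noteq> {}" "W \<inter> {x. f i x \<noteq> 0} \<subseteq> V" using True W(3) by auto
    ultimately show ?thesis by (intro exI[of _ "W \<inter> {x. f i x \<noteq> 0}"]) (intro conjI ballI)
  next
    case False
    then have "(\<forall>x\<in>W. f j x \<noteq> 0) \<or> (\<forall>x\<in>W. f j x = 0)" if "j \<in> insert i I" for j
      using W(4) that by (cases "j = i") simp_all
    then show ?thesis using W(1-3) by (intro exI[of _ W] conjI ballI)
  qed
qed

lemma laplacian_cong_ev:
  assumes "\<forall>\<^sub>F y in nhds x. f y = g y"
  shows "laplacian f x = laplacian g x"
proof -
  have ev: "\<forall>\<^sub>F y in nhds x. \<forall>\<^sub>F z in nhds y. f z = g z"
    using assms by (simp add: eventually_eventually)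
  have 1: "\<forall>\<^sub>F y in nhds x. D (axis i 1) f y = D (axis i 1) g y" for i
    using ev by (rule eventually_mono) (simp add: D_def frechet_derivative_cong_ev)
  have "D (axis i 1) (D (axis i 1) f) x = D (axis i 1) (D (axis i 1) g) x" for i
    using frechet_derivative_cong_ev[OF 1[of i]] by (simp add: D_def[of "axis i 1" "D (axis i 1) _"])
  then show ?thesis by (simp add: laplacian_D)
qed

lemma laplacian_zero: "laplacian (\<lambda>_. c) x = 0"
proof -
  have z: "D (axis i 1) (\<lambda>_. c) = (\<lambda>_. 0)" for i and c :: real
    by (rule ext) (simp add: D_def frechet_derivative_const)
  show ?thesis unfolding laplacian_D z by simp
qed

context flow
begin

lemma laplacian_sum:
  assumes "finite I" "\<And>j. j \<in> I \<Longrightarrow> smooth_on (\<psi> j) UNIV"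
  shows "laplacian (\<lambda>x. \<Sum>j\<in>I. \<psi> j x) x = (\<Sum>j\<in>I. laplacian (\<psi> j) x)"
proof -
  have 1: "dx i (\<lambda>x. \<Sum>j\<in>I. \<psi> j x) = (\<lambda>x. \<Sum>j\<in>I. dx i (\<psi> j) x)" for i
    by (rule ext) (rule D_sum[of UNIV], use assms in auto)
  have "dx i (dx i (\<lambda>x. \<Sum>j\<in>I. \<psi> j x)) x = (\<Sum>j\<in>I. dx i (dx i (\<psi> j)) x)" for i
    unfolding 1 by (rule D_sum[of UNIV]) (use assms in \<open>auto intro!: smooth_on_D\<close>)
  then show ?thesis by (simp add: laplacian_D sum.distrib)
qed

text \<open>At a point near which one of the cut-offs coincides with \<open>\<psi>0\<close>, at most \<open>M - 1\<close> of them have a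
  Laplacian of the size \<open>C0 / r\<^sup>2\<close>.  Such points need only be dense.\<close>

lemma sum_of_cutoffs:
  fixes \<psi> :: "nat \<Rightarrow> real^2 \<Rightarrow> real" and M :: real
  assumes I: "finite I" and s: "\<And>j. j \<in> I \<Longrightarrow> smooth_on (\<psi> j) UNIV"
    and le: "\<And>j x. j \<in> I \<Longrightarrow> 0 \<le> \<psi> j x \<and> \<psi> j x \<le> \<psi>0 x"
    and cb: "\<And>j. j \<in> I \<Longrightarrow> cutoff_bounds \<delta> C0 r (\<psi> j)" and r: "0 < r"
    and U: "open U"
    and good: "\<And>V. open V \<Longrightarrow> V \<noteq> {} \<Longrightarrow> V \<subseteq> U \<Longrightarrow> (\<forall>x\<in>V. \<psi>0 x \<noteq> 0) \<Longrightarrow>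
      \<exists>x\<in>V. (\<exists>i\<in>I. \<forall>\<^sub>F y in nhds x. \<psi> i y = \<psi>0 y) \<and> real (card {j\<in>I. \<psi> j x \<noteq> 0}) \<le> M"
    and x: "x \<in> closure U" "\<psi>0 x \<noteq> 0"
  defines "S \<equiv> \<lambda>x. \<Sum>j\<in>I. \<psi> j x"
  shows "\<psi>0 x \<le> S x" "S x \<le> M * \<psi>0 x"
    "\<bar>laplacian S x - laplacian \<psi>0 x\<bar> \<le> (M - 1) * (C0 / r\<^sup>2) * \<psi>0 x powr b"
proof -
  have Ss: "smooth_on S UNIV" unfolding S_def by (intro smooth_on_sum I s) auto
  define P where "P x \<longleftrightarrow> \<psi>0 x \<le> S x \<and> S x \<le> M * \<psi>0 x \<and>
    \<bar>laplacian S x - laplacian \<psi>0 x\<bar> \<le> (M - 1) * (C0 / r\<^sup>2) * \<psi>0 x powr b" for x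
  define N where "N = {x. \<psi>0 x \<noteq> 0}"
  have oN: "open N" unfolding N_def
    by (intro open_Collect_neq cont_psi psi0 continuous_intros)
  have NP: "0 < \<psi>0 y" if "y \<in> N" for y using that psi0(2)[of y] by (simp add: N_def)
  \<comment> \<open>The set of exceptions is open, so it would contain one of the good points.\<close>
  define Bad where "Bad = {y\<in>N. \<not> P y}"
  have "open Bad"
  proof -
    have c0: "continuous_on N \<psi>0" "continuous_on N S" "continuous_on N (laplacian S)" "continuous_on N (laplacian \<psi>0)"
      using cont_psi[OF Ss] cont_psi[OF psi0(1)] by (auto intro: continuous_on_subset)
    have c1: "continuous_on N (\<lambda>x. \<psi>0 x powr b)"
      by (intro continuous_intros c0) (use NP in force)
    have *: "open {y\<in>N. f y < h y}" if "continuous_on N f" "continuous_on N h" for f h :: "real^2 \<Rightarrow> real"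
    proof -
      have "{y\<in>N. f y < h y} = (\<lambda>y. h y - f y) -` {0<..} \<inter> N" by auto
      moreover have "open ((\<lambda>y. h y - f y) -` {0<..} \<inter> N)"
        using continuous_on_open_vimage[OF oN, of "\<lambda>y. h y - f y"] that by (auto intro: continuous_on_diff)
      ultimately show ?thesis by simp
    qed
    have eqB: "Bad = {y\<in>N. S y < \<psi>0 y} \<union> {y\<in>N. M * \<psi>0 y < S y}
      \<union> {y\<in>N. (M - 1) * (C0 / r\<^sup>2) * \<psi>0 y powr b < \<bar>laplacian S y - laplacian \<psi>0 y\<bar>}"
      unfolding Bad_def P_def by auto
    show ?thesis unfolding eqB
      by (intro open_Un * c0 continuous_on_mult[OF continuous_on_const c0(1)]
          continuous_on_mult[OF continuous_on_const c1] continuous_on_rabs continuous_on_diff)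
  qed
  have "P x"
  proof (rule ccontr)
    assume "\<not> P x"
    then have "x \<in> Bad" using x by (simp add: Bad_def N_def)
    then have "Bad \<inter> U \<noteq> {}" using x(1) \<open>open Bad\<close> open_Int_closure_eq_empty by blast
    then obtain W where W: "open W" "W \<noteq> {}" "W \<subseteq> Bad \<inter> U"
      and dich: "\<forall>j\<in>I. (\<forall>x\<in>W. \<psi> j x \<noteq> 0) \<or> (\<forall>x\<in>W. \<psi> j x = 0)"
      using shrink_to_dichotomy[OF I, of "Bad \<inter> U" \<psi>] \<open>open Bad\<close> U cont_psi(1)[OF s] by (metis open_Int)
    obtain y i where y: "y \<in> W" and i: "i \<in> I" "\<forall>\<^sub>F z in nhds y. \<psi> i z = \<psi>0 z"
      and card: "real (card {j\<in>I. \<psi> j y \<noteq> 0}) \<le> M"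
      using good[of W] W by (force simp: Bad_def N_def)
    have ip: "\<psi> i y = \<psi>0 y" using i(2) eventually_nhds_x_imp_x by blast
    have p0: "0 < \<psi>0 y" using y W NP by (auto simp: Bad_def)
    define A where "A = {j\<in>I. \<psi> j y \<noteq> 0}"
    have A: "finite A" "i \<in> A" "A \<subseteq> I" using I i ip p0 by (auto simp: A_def)
    have cA: "real (card (A - {i})) \<le> M - 1"
    proof -
      have "card A = Suc (card (A - {i}))" using A card.remove by metis
      then show ?thesis using card by (simp add: A_def)
    qed
    have "S y = (\<Sum>j\<in>A. \<psi> j y)" unfolding S_def A_def by (rule sum.mono_neutral_right) (use I in auto)
    then have Sy: "S y = \<psi>0 y + (\<Sum>j\<in>A - {i}. \<psi> j y)" using A ip by (simp add: sum.remove)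
    have s0: "0 \<le> (\<Sum>j\<in>A - {i}. \<psi> j y)" using le A by (intro sum_nonneg) auto
    have "(\<Sum>j\<in>A - {i}. \<psi> j y) \<le> (\<Sum>j\<in>A - {i}. \<psi>0 y)" using le A by (intro sum_mono) auto
    also have "\<dots> \<le> (M - 1) * \<psi>0 y" using cA p0 by (simp add: mult_right_mono)
    finally have s1: "S y \<le> M * \<psi>0 y" using Sy by (simp add: algebra_simps)
    have lz: "laplacian (\<psi> j) y = 0" if "j \<in> I - A" for j
    proof -
      have "\<psi> j y = 0" "j \<in> I" using that by (auto simp: A_def)
      then have "\<forall>x\<in>W. \<psi> j x = 0" using dich y by blast
      then have "\<forall>\<^sub>F z in nhds y. \<psi> j z = 0"
        by (intro eventually_open_eq[OF W(1) y]) simp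
      then show ?thesis using laplacian_cong_ev[of "\<psi> j" "\<lambda>_. 0" y] laplacian_zero by simp
    qed
    have "laplacian S y = (\<Sum>j\<in>I. laplacian (\<psi> j) y)" unfolding S_def by (rule laplacian_sum[OF I s])
    also have "\<dots> = (\<Sum>j\<in>A. laplacian (\<psi> j) y)" using A I lz by (intro sum.mono_neutral_right) auto
    also have "\<dots> = laplacian (\<psi> i) y + (\<Sum>j\<in>A - {i}. laplacian (\<psi> j) y)" using A by (simp add: sum.remove)
    also have "laplacian (\<psi> i) y = laplacian \<psi>0 y" by (rule laplacian_cong_ev[OF i(2)])
    finally have "\<bar>laplacian S y - laplacian \<psi>0 y\<bar> \<le> (\<Sum>j\<in>A - {i}. \<bar>laplacian (\<psi> j) y\<bar>)" by simp
    also have "\<dots> \<le> (\<Sum>j\<in>A - {i}. C0 / r\<^sup>2 * \<psi>0 y powr b)"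
    proof (rule sum_mono)
      fix j assume j: "j \<in> A - {i}"
      then have nz: "\<psi> j y \<noteq> 0" "j \<in> I" by (auto simp: A_def)
      then have "\<bar>laplacian (\<psi> j) y\<bar> / \<psi> j y powr b \<le> C0 / r\<^sup>2"
        using cb unfolding cutoff_bounds_def b_def by blast
      then have "\<bar>laplacian (\<psi> j) y\<bar> \<le> C0 / r\<^sup>2 * \<psi> j y powr b"
        using nz by (simp add: pos_divide_le_eq)
      also have "\<dots> \<le> C0 / r\<^sup>2 * \<psi>0 y powr b"
        using le[OF nz(2), of y] b C0 by (intro mult_left_mono powr_mono2) auto
      finally show "\<bar>laplacian (\<psi> j) y\<bar> \<le> C0 / r\<^sup>2 * \<psi>0 y powr b" .
    qed
    also have "\<dots> = real (card (A - {i})) * (C0 / r\<^sup>2 * \<psi>0 y powr b)" by simp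
    also have "\<dots> \<le> (M - 1) * (C0 / r\<^sup>2 * \<psi>0 y powr b)" using cA C0 by (intro mult_right_mono) auto
    finally have "P y" using s0 s1 Sy by (simp add: P_def mult.assoc)
    then show False using y W by (auto simp: Bad_def)
  qed
  then show "\<psi>0 x \<le> S x" "S x \<le> M * \<psi>0 x"
    "\<bar>laplacian S x - laplacian \<psi>0 x\<bar> \<le> (M - 1) * (C0 / r\<^sup>2) * \<psi>0 x powr b"
    by (auto simp: P_def)
qed

lemma flux_sum:
  assumes "finite I" "\<And>j. j \<in> I \<Longrightarrow> admissible (\<psi> j)"
  shows "admissible (\<lambda>x. \<Sum>j\<in>I. \<psi> j x)" "flux (\<lambda>x. \<Sum>j\<in>I. \<psi> j x) = (\<Sum>j\<in>I. flux (\<psi> j))"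
proof -
  have s: "smooth_on (\<psi> j) UNIV" if "j \<in> I" for j using assms(2)[OF that] by (simp add: admissible_def)
  show "admissible (\<lambda>x. \<Sum>j\<in>I. \<psi> j x)"
    using assms by (auto simp: admissible_def intro!: smooth_on_sum sum_nonneg sum.neutral)
  have 1: "dx i (\<lambda>x. \<Sum>j\<in>I. \<psi> j x) x = (\<Sum>j\<in>I. dx i (\<psi> j) x)" for i x
    by (rule D_sum[of UNIV]) (use assms s in auto)
  define h where "h j z = 1/2 * (w z)\<^sup>2 * (\<eta> (fst z) * (v 1 z * dx 1 (\<psi> j) (snd z) + v 2 z * dx 2 (\<psi> j) (snd z)))" for j z
  have c: "continuous_on K (h j)" if "j \<in> I" for j
    unfolding h_def[abs_def]
    by (intro continuous_on_subset[OF _ K(3)] continuous_intros cont_snd cont_psi s[OF that])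
  have "flux (\<lambda>x. \<Sum>j\<in>I. \<psi> j x) = J (\<lambda>z. \<Sum>j\<in>I. h j z)"
    unfolding flux_def 1 h_def
    by (rule arg_cong[where f = J], rule ext) (simp add: sum_distrib_left sum.distrib distrib_left)
  also have "\<dots> = (\<Sum>j\<in>I. J (h j))" by (rule J_sum[OF assms(1) c])
  finally show "flux (\<lambda>x. \<Sum>j\<in>I. \<psi> j x) = (\<Sum>j\<in>I. flux (\<psi> j))"
    unfolding flux_def h_def[abs_def] .
qed

definition P_tot :: real where "P_tot = J (\<lambda>z. sq_grad_w z * (\<eta> (fst z) * \<psi>0 (snd z)))"

text \<open>Time derivative and Laplacian enter \<open>enstrophy_balance\<close> with either sign, so both bounds come from
  the same estimate of their absolute values.\<close>

lemma flux_bounds: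
  assumes S: "admissible S" and M: "\<And>x. \<psi>0 x \<le> S x" "\<And>x. S x \<le> M * \<psi>0 x"
    and W: "\<And>x. \<psi>0 x \<noteq> 0 \<Longrightarrow>
      S x + R0\<^sup>2 / C0 * \<bar>laplacian S x\<bar> \<le> (if R0 \<le> norm x then wo else wi) * \<psi>0 x powr b"
  shows "\<nu> * P_tot - \<nu> * (C0 / R0\<^sup>2) * (wi * E_tot + (wo - wi) * E_out) \<le> flux S"
    and "flux S \<le> \<nu> * (M * P_tot) + \<nu> * (C0 / R0\<^sup>2) * (wi * E_tot + (wo - wi) * E_out)"
proof -
  let ?B = "C0 / R0\<^sup>2"
  let ?\<eta> = "\<lambda>z::real \<times> (real^2). \<eta> (fst z)"
  let ?T = "\<lambda>z. 1/2 * (w z)\<^sup>2 * (deriv \<eta> (fst z) * S (snd z) + \<nu> * (?\<eta> z * laplacian S (snd z)))"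
  have Ss: "smooth_on S UNIV" using S by (simp add: admissible_def)
  note csnd = cont_snd[OF cont_psi(1)[OF psi0(1)]] cont_snd[OF cont_psi(1)[OF Ss]] cont_snd[OF cont_psi(4)[OF Ss]]
  have cT: "continuous_on K ?T" by (intro continuous_on_subset[OF _ K(3)] continuous_intros csnd)
  have B: "?B > 0" using C0 R0 by simp
  have main: "J (\<lambda>z. s * ?T z) \<le> \<nu> * ?B * wi * E_tot + (\<nu> * ?B * wo - \<nu> * ?B * wi) * E_out"
    if s: "\<bar>s\<bar> = 1" for s :: real
  proof (rule J_le_E)
    show "continuous_on K (\<lambda>z. s * ?T z)" by (intro continuous_on_mult continuous_on_const cT)
    show "AE z in lborel. z \<in> K \<longrightarrow> ?\<eta> z = 0 \<or> \<psi>0 (snd z) = 0 \<longrightarrow> s * ?T z \<le> 0"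
      using laplacian_zero_on_zero_set[OF S]
    proof eventually_elim
      case (elim z)
      show ?case
      proof (intro impI)
        assume z: "z \<in> K" and zz: "?\<eta> z = 0 \<or> \<psi>0 (snd z) = 0"
        show "s * ?T z \<le> 0"
        proof (cases "?\<eta> z = 0")
          case True
          then have "deriv \<eta> (fst z) = 0" using deriv_eta_bound[of "fst z"] by simp
          then show ?thesis using True by simp
        next
          case False
          then have p: "\<psi>0 (snd z) = 0" using zz by simp
          moreover have "S (snd z) = 0" using S p by (simp add: admissible_def)
          ultimately show ?thesis using elim z False by simp
        qed
      qed
    qed
    fix z assume z: "z \<in> K" "?\<eta> z \<noteq> 0" "\<psi>0 (snd z) \<noteq> 0"
    define x where "x = snd z"
    define wx where "wx = (if R0 \<le> norm x then wo else wi)"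
    have S0: "0 \<le> S x" using S by (simp add: admissible_def)
    have "\<bar>deriv \<eta> (fst z) * S x + \<nu> * (?\<eta> z * laplacian S x)\<bar>
      \<le> \<bar>deriv \<eta> (fst z) * S x\<bar> + \<nu> * (?\<eta> z * \<bar>laplacian S x\<bar>)"
    proof -
      have "\<bar>\<nu> * (?\<eta> z * laplacian S x)\<bar> = \<nu> * (?\<eta> z * \<bar>laplacian S x\<bar>)"
        using nu eta(2)[of "fst z"] by (simp add: abs_mult)
      then show ?thesis
        using abs_triangle_ineq[of "deriv \<eta> (fst z) * S x" "\<nu> * (?\<eta> z * laplacian S x)"] by linarith
    qed
    also have "\<dots> \<le> \<nu> * C0 / R0\<^sup>2 * (?\<eta> z powr b * S x) + \<nu> * (?\<eta> z powr b * \<bar>laplacian S x\<bar>)"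
      using nu by (intro add_mono time_term_le[OF S0] mult_left_mono mult_right_mono eta_le_powr) auto
    also have "\<dots> = \<nu> * ?B * ?\<eta> z powr b * (S x + R0\<^sup>2 / C0 * \<bar>laplacian S x\<bar>)"
      using C0 R0 by (simp add: field_simps)
    also have "\<dots> \<le> \<nu> * ?B * ?\<eta> z powr b * (wx * \<psi>0 x powr b)"
      using W[of x] z nu C0 by (intro mult_left_mono) (auto simp: x_def wx_def)
    finally have "\<bar>deriv \<eta> (fst z) * S x + \<nu> * (?\<eta> z * laplacian S x)\<bar> \<le> \<nu> * ?B * wx * (?\<eta> z * \<psi>0 x) powr b"
      using eta(2)[of "fst z"] psi0(2)[of x] by (simp add: powr_mult mult_ac)
    then have le: "1/2 * (w z)\<^sup>2 * \<bar>deriv \<eta> (fst z) * S x + \<nu> * (?\<eta> z * laplacian S x)\<bar>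
      \<le> 1/2 * (w z)\<^sup>2 * (\<nu> * ?B * wx * (?\<eta> z * \<psi>0 x) powr b)"
      by (intro mult_left_mono) auto
    have "s * ?T z \<le> \<bar>s * ?T z\<bar>" by simp
    also have "\<dots> = 1/2 * (w z)\<^sup>2 * \<bar>deriv \<eta> (fst z) * S x + \<nu> * (?\<eta> z * laplacian S x)\<bar>"
      using s by (simp add: abs_mult x_def)
    also note le
    also have "1/2 * (w z)\<^sup>2 * (\<nu> * ?B * wx * (?\<eta> z * \<psi>0 x) powr b) = \<nu> * ?B * wx * e_dens z"
      unfolding e_dens_def x_def by (simp only: mult_ac)
    finally show "s * ?T z \<le> (if R0 \<le> norm (snd z) then \<nu> * ?B * wo else \<nu> * ?B * wi) * e_dens z"
      by (auto simp: wx_def x_def split: if_splits)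
  qed
  have eqE: "\<nu> * ?B * wi * E_tot + (\<nu> * ?B * wo - \<nu> * ?B * wi) * E_out = \<nu> * ?B * (wi * E_tot + (wo - wi) * E_out)"
    by (simp add: algebra_simps)
  have T1: "J ?T \<le> \<nu> * ?B * (wi * E_tot + (wo - wi) * E_out)" using main[of 1] unfolding eqE J_cmult by simp
  have T2: "- J ?T \<le> \<nu> * ?B * (wi * E_tot + (wo - wi) * E_out)" using main[of "- 1"] unfolding eqE J_cmult by simp
  let ?P = "\<lambda>z. sq_grad_w z * (?\<eta> z * \<psi>0 (snd z))"
  let ?PS = "\<lambda>z. sq_grad_w z * (?\<eta> z * S (snd z))"
  have cP: "continuous_on K ?P" "continuous_on K ?PS"
    by (intro continuous_on_subset[OF _ K(3)] continuous_intros csnd)+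
  have P1: "P_tot \<le> J ?PS" unfolding P_tot_def
    using cP M(1) eta(2) by (intro J_mono_AE set_integrable_compact K) (auto intro!: mult_left_mono)
  have "J ?PS \<le> J (\<lambda>z. M * ?P z)"
  proof (rule J_mono_AE)
    show "set_integrable lborel K ?PS" "set_integrable lborel K (\<lambda>z. M * ?P z)"
      by (rule set_integrable_compact[OF K(1) cP(2)])
        (rule set_integrable_compact[OF K(1) continuous_on_mult[OF continuous_on_const cP(1)]])
    show "AE z in lborel. z \<in> K \<longrightarrow> ?PS z \<le> M * ?P z"
    proof (intro AE_I2 impI)
    fix z
    have "sq_grad_w z * (?\<eta> z * S (snd z)) \<le> sq_grad_w z * (?\<eta> z * (M * \<psi>0 (snd z)))"
      using M(2) eta(2) by (intro mult_left_mono) auto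
    then show "?PS z \<le> M * ?P z" by (simp add: mult_ac)
    qed
  qed
  then have P2: "J ?PS \<le> M * P_tot" unfolding J_cmult P_tot_def .
  have "\<nu> * P_tot \<le> \<nu> * J ?PS" "\<nu> * J ?PS \<le> \<nu> * (M * P_tot)"
    using P1 P2 nu by (auto intro!: mult_left_mono)
  then show "\<nu> * P_tot - \<nu> * (C0 / R0\<^sup>2) * (wi * E_tot + (wo - wi) * E_out) \<le> flux S"
    and "flux S \<le> \<nu> * (M * P_tot) + \<nu> * (C0 / R0\<^sup>2) * (wi * E_tot + (wo - wi) * E_out)"
    using T1 T2 unfolding enstrophy_balance[OF S] by linarith+
qed

end

section \<open>Geometry of the coverings\<close>

lemma vec2_decompose:
  fixes z p :: "real^2"
  assumes "p \<noteq> 0"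
  defines "q \<equiv> vector [- p $ 2, p $ 1] :: real^2"
  shows "(p \<bullet> p) *\<^sub>R z = (z \<bullet> p) *\<^sub>R p + (z \<bullet> q) *\<^sub>R q" "q \<bullet> q = p \<bullet> p" "p \<bullet> q = 0"
  by (simp_all add: vec_eq_iff forall_2 inner_2 q_def algebra_simps)

lemma finite_circle_inter:
  fixes p :: "real^2"
  assumes "p \<noteq> 0 \<or> \<rho> \<noteq> R"
  shows "finite (sphere 0 R \<inter> sphere p \<rho>)"
proof (cases "p = 0")
  case True
  then have "sphere 0 R \<inter> sphere p \<rho> = {}" using assms by auto
  then show ?thesis by simp
next
  case False
  define q where "q = (vector [- p $ 2, p $ 1] :: real^2)"
  define k where "k = (R\<^sup>2 + p \<bullet> p - \<rho>\<^sup>2) / 2"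
  define d where "d = sqrt ((p \<bullet> p) * R\<^sup>2 - k\<^sup>2)"
  define f where "f s = (1 / (p \<bullet> p)) *\<^sub>R (k *\<^sub>R p + s *\<^sub>R q)" for s
  note dec = vec2_decompose[OF False, folded q_def]
  have "z \<in> f ` {d, - d}" if "z \<in> sphere 0 R \<inter> sphere p \<rho>" for z
  proof -
    have zR: "z \<bullet> z = R\<^sup>2" using that by (auto simp: power2_norm_eq_inner[symmetric])
    have "(norm (p - z))\<^sup>2 = \<rho>\<^sup>2" using that by (auto simp: dist_norm)
    then have zk: "z \<bullet> p = k"
      using zR by (simp add: power2_norm_eq_inner k_def inner_diff_left inner_diff_right inner_commute)
    have zf: "z = f (z \<bullet> q)"
      using arg_cong[OF dec(1)[of z], of "\<lambda>v. (1 / (p \<bullet> p)) *\<^sub>R v"] False by (simp add: f_def zk)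
    have "(p \<bullet> p) * (z \<bullet> z) = z \<bullet> ((p \<bullet> p) *\<^sub>R z)" by simp
    also have "\<dots> = k\<^sup>2 + (z \<bullet> q)\<^sup>2" unfolding dec(1) by (simp add: inner_add_right zk power2_eq_square)
    finally have "(z \<bullet> q)\<^sup>2 = (p \<bullet> p) * R\<^sup>2 - k\<^sup>2" using zR by simp
    then have "\<bar>z \<bullet> q\<bar> = d" unfolding d_def by (metis real_sqrt_abs)
    then have "z \<bullet> q \<in> {d, - d}" by auto
    then show ?thesis using zf by blast
  qed
  then have "sphere 0 R \<inter> sphere p \<rho> \<subseteq> f ` {d, - d}" by blast
  then show ?thesis by (rule finite_subset) simp
qed

text \<open>If finitely many discs cover the circle of radius \<open>R\<close>, then the open discs cover a dense part of
  it: near a point missed by all of them the circle would consist of finitely many intersection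
  points.\<close>

lemma dense_directions:
  fixes x :: "nat \<Rightarrow> real^2"
  assumes R: "R > 0" and I: "finite I" and ne: "\<And>j. j \<in> I \<Longrightarrow> x j \<noteq> 0 \<or> \<rho> \<noteq> R"
    and cover: "sphere 0 R \<subseteq> (\<Union>j\<in>I. cball (x j) \<rho>)" and z: "z \<in> sphere 0 R" and \<epsilon>: "\<epsilon> > 0"
  shows "\<exists>z'\<in>sphere 0 R. dist z z' < \<epsilon> \<and> (\<exists>j\<in>I. z' \<in> ball (x j) \<rho>)"
proof (rule ccontr)
  assume no: "\<not> ?thesis"
  have "sphere 0 R \<inter> ball z \<epsilon> \<subseteq> (\<Union>j\<in>I. sphere 0 R \<inter> sphere (x j) \<rho>)"
  proof
    fix y assume y: "y \<in> sphere 0 R \<inter> ball z \<epsilon>"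
    then obtain j where "j \<in> I" "y \<in> cball (x j) \<rho>" using cover by blast
    moreover have "y \<notin> ball (x j) \<rho>" using no y \<open>j \<in> I\<close> by auto
    ultimately show "y \<in> (\<Union>j\<in>I. sphere 0 R \<inter> sphere (x j) \<rho>)" using y by auto
  qed
  moreover have "finite (\<Union>j\<in>I. sphere 0 R \<inter> sphere (x j) \<rho>)"
    using I ne finite_circle_inter by blast
  ultimately have fin: "finite (sphere 0 R \<inter> ball z \<epsilon>)" using finite_subset by blast
  have "connected (sphere (0 :: real^2) R)" by (rule connected_sphere) simp
  moreover have "\<not> (\<exists>a. sphere (0 :: real^2) R = {a})"
  proof
    assume "\<exists>a. sphere (0 :: real^2) R = {a}"
    then obtain a where a: "sphere (0 :: real^2) R = {a}" by blast
    have "z \<in> {a}" "- z \<in> {a}" using z unfolding a[symmetric] by simp_all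
    then have "z = - z" by simp
    then have "z + z = 0" by (metis add.right_inverse)
    then have "2 *\<^sub>R z = 0" by (simp only: scaleR_2)
    then have "z = 0" by simp
    then show False using z R by simp
  qed
  ultimately have "z islimpt sphere 0 R" using z connected_imp_perfect by blast
  then show False using fin \<epsilon> by (simp add: islimpt_eq_infinite_ball)
qed

lemma sphere_covered:
  fixes x :: "nat \<Rightarrow> real^2"
  assumes "R > 0" "finite I" "ball 0 R \<subseteq> (\<Union>j\<in>I. cball (x j) \<rho>)"
  shows "sphere 0 R \<subseteq> (\<Union>j\<in>I. cball (x j) \<rho>)"
proof -
  have "closed (\<Union>j\<in>I. cball (x j) \<rho>)" using assms(2) by (intro closed_UN) auto
  then have "closure (ball 0 R) \<subseteq> (\<Union>j\<in>I. cball (x j) \<rho>)" using assms(3) by (rule closure_minimal[rotated])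
  then show ?thesis using assms(1) by auto
qed

text \<open>Finitely many open sets that meet at a point of the rim also meet at nearby points inside.\<close>

lemma multiplicity_on_sphere:
  fixes A :: "nat \<Rightarrow> (real^2) set"
  assumes "R > 0" "finite I" "\<And>j. j \<in> I \<Longrightarrow> open (A j)" "z \<in> sphere 0 R"
    and m: "\<And>y. y \<in> ball 0 R \<Longrightarrow> real (card {j\<in>I. y \<in> A j}) \<le> M"
  shows "real (card {j\<in>I. z \<in> A j}) \<le> M"
proof -
  define V where "V = (\<Inter>j\<in>{j\<in>I. z \<in> A j}. A j)"
  have "open V" "z \<in> V" unfolding V_def using assms by (auto intro!: open_INT)
  moreover have "z \<in> closure (ball 0 R)" using assms by auto
  ultimately have "V \<inter> ball 0 R \<noteq> {}" using open_Int_closure_eq_empty by blast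
  then obtain y where y: "y \<in> V" "y \<in> ball 0 R" by blast
  then have "{j\<in>I. z \<in> A j} \<subseteq> {j\<in>I. y \<in> A j}" by (auto simp: V_def)
  then have "card {j\<in>I. z \<in> A j} \<le> card {j\<in>I. y \<in> A j}" using assms(2) by (intro card_mono) auto
  then show ?thesis using m[OF y(2)] by linarith
qed

text \<open>A cut-off supported in a ball around \<open>p\<close> that reaches a point beyond the rim also reaches the point
  of the rim below it.\<close>

lemma radial_projection_closer:
  fixes z p :: "real^2"
  assumes "norm z = R" "norm p \<le> R" "1 \<le> s"
  shows "dist p z \<le> dist p (s *\<^sub>R z)"
proof -
  have zp: "z \<bullet> p \<le> R\<^sup>2"
    using norm_cauchy_schwarz[of z p] mult_left_mono[OF assms(2), of R] assms(1) norm_ge_zero[of z]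
    by (simp add: power2_eq_square)
  have zz: "z \<bullet> z = R\<^sup>2" using assms(1) by (simp add: power2_norm_eq_inner[symmetric])
  have "(dist p (s *\<^sub>R z))\<^sup>2 - (dist p z)\<^sup>2 = (s - 1) * ((s + 1) * R\<^sup>2 - 2 * (z \<bullet> p))"
    by (simp add: dist_norm power2_norm_eq_inner inner_diff_left inner_diff_right inner_commute[of p z] zz algebra_simps)
  moreover have "0 \<le> (s - 1) * ((s + 1) * R\<^sup>2 - 2 * (z \<bullet> p))"
  proof (intro mult_nonneg_nonneg)
    have "2 * R\<^sup>2 \<le> (s + 1) * R\<^sup>2" using assms(3) by (intro mult_right_mono) auto
    then show "0 \<le> (s + 1) * R\<^sup>2 - 2 * (z \<bullet> p)" using zp by linarith
  qed (use assms in simp)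
  ultimately have "(dist p z)\<^sup>2 \<le> (dist p (s *\<^sub>R z))\<^sup>2" by linarith
  then show ?thesis by (rule power2_le_imp_le) simp
qed

definition dir :: "real \<Rightarrow> real^2 \<Rightarrow> real^2" where "dir R x = (R / norm x) *\<^sub>R x"

lemma dir:
  assumes "R > 0" "R \<le> norm x"
  shows "norm (dir R x) = R" "x = (norm x / R) *\<^sub>R dir R x" "1 \<le> norm x / R"
  using assms by (auto simp: dir_def)

lemma cone_part_iff:
  assumes "R > 0" "R \<le> norm x" "norm x \<le> 2 * R"
  shows "x \<in> cone_part R A \<longleftrightarrow> dir R x \<in> A"
proof
  assume "x \<in> cone_part R A"
  then obtain s y where y: "x = s *\<^sub>R y" "norm y = R" "y \<in> A" "1 \<le> s" by (auto simp: cone_part_def)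
  then have "dir R x = y" using assms by (simp add: dir_def)
  then show "dir R x \<in> A" using y by simp
next
  assume "dir R x \<in> A"
  then show "x \<in> cone_part R A" unfolding cone_part_def
    using dir[OF assms(1,2)] assms by (intro CollectI exI[of _ "norm x / R"] exI[of _ "dir R x"]) (auto simp: pos_divide_le_eq)
qed

lemma continuous_dir: "x \<noteq> 0 \<Longrightarrow> isCont (dir R) x"
  unfolding dir_def[abs_def] by (intro continuous_intros) auto

lemma dir_near:
  assumes "R > 0" "x \<noteq> 0" "open A" "dir R x \<in> A"
  shows "\<forall>\<^sub>F y in nhds x. dir R y \<in> A"
proof -
  have "(dir R \<longlongrightarrow> dir R x) (nhds x)" using continuous_dir[OF assms(2)] tendsto_nhds_iff isContD
    by (metis)
  then show ?thesis using assms(3,4) topological_tendstoD by blast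
qed

lemma outer_closure: "R > 0 \<Longrightarrow> R \<le> norm x \<Longrightarrow> x \<in> closure {y :: real^2. R < norm y}"
proof (rule closure_approachable[THEN iffD2], intro allI impI)
  fix e :: real assume "R > 0" "R \<le> norm x" "0 < e"
  define s where "s = e / (2 * norm x)"
  have "0 < norm x" using \<open>R > 0\<close> \<open>R \<le> norm x\<close> by linarith
  then have s: "s > 0" using \<open>0 < e\<close> unfolding s_def by (intro divide_pos_pos mult_pos_pos) auto
  have "norm ((1 + s) *\<^sub>R x) = norm x + s * norm x"
  proof -
    have "norm ((1 + s) *\<^sub>R x) = (1 + s) * norm x" using s by simp
    then show ?thesis by (simp add: distrib_right)
  qed
  moreover have "0 < s * norm x" using s \<open>0 < norm x\<close> by simp
  ultimately have "norm x < norm ((1 + s) *\<^sub>R x)" by linarith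
  moreover have "dist ((1 + s) *\<^sub>R x) x = s * norm x" using s by (simp add: dist_norm algebra_simps)
  ultimately show "\<exists>y\<in>{y. R < norm y}. dist y x < e"
    using \<open>R \<le> norm x\<close> \<open>R > 0\<close> \<open>0 < e\<close> by (intro bexI[of _ "(1 + s) *\<^sub>R x"]) (auto simp: s_def)
qed

lemma dense_annulus:
  fixes x :: "nat \<Rightarrow> real^2"
  assumes "R > 0" "finite I" "\<And>j. j \<in> I \<Longrightarrow> x j \<noteq> 0 \<or> \<rho> \<noteq> R"
    and "sphere 0 R \<subseteq> (\<Union>j\<in>I. cball (x j) \<rho>)"
    and V: "open V" "V \<noteq> {}" "V \<subseteq> {y. R < norm y}"
  shows "\<exists>y\<in>V. \<exists>j\<in>I. dir R y \<in> ball (x j) \<rho>"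
proof -
  obtain y where y: "y \<in> V" using V by blast
  then have n: "R < norm y" using V by auto
  define s where "s = norm y / R"
  have "0 < norm y" using n assms(1) by linarith
  then have s: "s > 0" using assms(1) by (simp add: s_def)
  have sy: "y = s *\<^sub>R dir R y" using dir(2)[of R y] assms(1) n by (simp add: s_def)
  obtain e where e: "e > 0" "ball y e \<subseteq> V" using V(1) y openE by blast
  have z: "dir R y \<in> sphere 0 R" using dir[of R y] assms(1) n by simp
  obtain z' where z': "z' \<in> sphere 0 R" "dist (dir R y) z' < e / s" "\<exists>j\<in>I. z' \<in> ball (x j) \<rho>"
    using dense_directions[OF assms(1-4) z divide_pos_pos[OF e(1) s]] by blast
  have "dist y (s *\<^sub>R z') = s * dist (dir R y) z'"
  proof -
    have "dist y (s *\<^sub>R z') = dist (s *\<^sub>R dir R y) (s *\<^sub>R z')" using sy by simp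
    also have "\<dots> = norm (s *\<^sub>R (dir R y - z'))" by (simp add: dist_norm scaleR_diff_right)
    also have "\<dots> = s * dist (dir R y) z'" using s by (simp add: dist_norm)
    finally show ?thesis .
  qed
  then have "s *\<^sub>R z' \<in> V" using e s z'(2) by (auto simp: pos_less_divide_eq mult.commute)
  moreover have "dir R (s *\<^sub>R z') = z'" using z'(1) s assms(1) by (simp add: dir_def)
  ultimately show ?thesis using z'(3) by metis
qed

text \<open>If \<open>z\<close> lies in all doubled discs, then it lies in the one whose disc contains the antipode \<open>- z\<close>,
  so \<open>2 R < 3 r\<close>.  If it misses at most one, then one of the two points of the circle perpendicular to \<open>z\<close>
  plays this role, unless a single disc contains both of them.\<close>

lemma rim_multiplicity:
  fixes x :: "nat \<Rightarrow> real^2"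
  assumes R: "R > 0" and r: "0 < r" "r \<le> R" and cover: "sphere 0 R \<subseteq> (\<Union>j\<in>{1..n}. cball (x j) r)"
    and z: "norm z = R"
  defines "N \<equiv> {j\<in>{1..n}. z \<in> ball (x j) (2 * r)}"
  shows "card N = n \<Longrightarrow> (R / r)\<^sup>2 < 9/4" and "n \<le> card N + 1 \<Longrightarrow> (R / r)\<^sup>2 < 9/2"
proof -
  have ratio: "(R / r)\<^sup>2 < c" if "R\<^sup>2 < c * r\<^sup>2" for c
    using that r by (simp add: power_divide pos_divide_less_eq)
  have N: "N \<subseteq> {1..n}" "finite N" by (auto simp: N_def)
  show "(R / r)\<^sup>2 < 9/4" if "card N = n"
  proof -
    have eq: "N = {1..n}" using N that by (intro card_subset_eq) auto
    have "- z \<in> sphere 0 R" using z by simp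
    then have "- z \<in> (\<Union>j\<in>{1..n}. cball (x j) r)" by (rule subsetD[OF cover])
    then obtain j where j: "j \<in> {1..n}" "- z \<in> cball (x j) r" by (elim UN_E)
    have "j \<in> N" unfolding eq by (rule j(1))
    then have "dist (x j) z < 2 * r" unfolding N_def by simp
    moreover have "dist z (- z) = 2 * R"
    proof -
      have "z - - z = 2 *\<^sub>R z" by (simp add: scaleR_2)
      then show ?thesis using z by (simp add: dist_norm)
    qed
    ultimately have "2 * R < 3 * r" using j dist_triangle[of z "- z" "x j"] by (simp add: dist_commute)
    then have "(2 * R)\<^sup>2 < (3 * r)\<^sup>2" using R by (intro power_strict_mono) auto
    then show ?thesis by (intro ratio) (simp add: power_mult_distrib)
  qed
  show "(R / r)\<^sup>2 < 9/2" if "n \<le> card N + 1"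
  proof -
    define q where "q = (vector [- z $ 2, z $ 1] :: real^2)"
    have z0: "z \<noteq> 0" using z R by auto
    note dec = vec2_decompose[OF z0, folded q_def]
    have zz: "z \<bullet> z = R\<^sup>2" using z by (simp add: power2_norm_eq_inner[symmetric])
    have nq: "norm q = R" using dec(2) zz R by (simp add: norm_eq_sqrt_inner)
    have far: "(dist z w)\<^sup>2 = 2 * R\<^sup>2" if "w = q \<or> w = - q" for w
      using that dec zz by (auto simp: dist_norm power2_norm_eq_inner inner_diff_left inner_diff_right
          inner_add_left inner_add_right inner_commute[of q z])
    have "q \<in> sphere 0 R" "- q \<in> sphere 0 R" using nq by simp_all
    then obtain i j where i: "i \<in> {1..n}" "q \<in> cball (x i) r" and j: "j \<in> {1..n}" "- q \<in> cball (x j) r"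
      using cover by blast
    have near: "(R / r)\<^sup>2 < 9/2" if k: "k \<in> N" "w \<in> cball (x k) r" "w = q \<or> w = - q" for k w
    proof -
      have "dist z w < 3 * r" using k dist_triangle[of z w "x k"] by (auto simp: N_def dist_commute)
      then have "(dist z w)\<^sup>2 < (3 * r)\<^sup>2" by (intro power_strict_mono) auto
      then show ?thesis using far[OF k(3)] by (intro ratio) (simp add: power_mult_distrib)
    qed
    show ?thesis
    proof (cases "i \<in> N \<or> j \<in> N")
      case True
      then show ?thesis using near i j by blast
    next
      case False
      have "i = j"
      proof (rule ccontr)
        assume "i \<noteq> j"
        have "N \<union> {i, j} \<subseteq> {1..n}" using N i j by auto
        then have "card (N \<union> {i, j}) \<le> n" using card_mono[of "{1..n}"] by fastforce
        moreover have "card (N \<union> {i, j}) = card N + 2" using False \<open>i \<noteq> j\<close> N(2) by (subst card_Un_disjoint) auto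
        ultimately show False using that by linarith
      qed
      moreover have "dist q (- q) = 2 * R"
      proof -
        have "q - - q = 2 *\<^sub>R q" by (simp add: scaleR_2)
        then show ?thesis using nq by (simp add: dist_norm)
      qed
      ultimately have "2 * R \<le> 2 * r" using i j dist_triangle[of q "- q" "x i"] by (simp add: dist_commute)
      then have "R / r = 1" using r by simp
      then show ?thesis by simp
    qed
  qed
qed

text \<open>The two points of the circle perpendicular to the first centre are at distance at least \<open>R\<close> from it,
  so a smaller second disc would have to contain both of these antipodes.\<close>

lemma two_discs:
  fixes x :: "nat \<Rightarrow> real^2"
  assumes R: "R > 0" and r: "0 < r" and cover: "sphere 0 R \<subseteq> (\<Union>j\<in>{1..2}. cball (x j) r)"
  shows "R \<le> r"
proof (rule ccontr)
  assume "\<not> R \<le> r"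
  obtain q where q: "norm q = R" "x 1 \<bullet> q = 0"
  proof (cases "x 1 = 0")
    case True
    show thesis by (rule that[of "R *\<^sub>R axis 1 1"]) (use R True in simp_all)
  next
    case False
    define q where "q = (vector [- x 1 $ 2, x 1 $ 1] :: real^2)"
    note dec = vec2_decompose[OF False, folded q_def]
    have "q \<noteq> 0" using dec(2) False by auto
    then have "norm ((R / norm q) *\<^sub>R q) = R" using R by simp
    moreover have "x 1 \<bullet> ((R / norm q) *\<^sub>R q) = 0" using dec(3) by simp
    ultimately show thesis using that by blast
  qed
  have 1: "w \<notin> cball (x 1) r" if "w = q \<or> w = - q" for w
  proof
    assume "w \<in> cball (x 1) r"
    then have "(dist (x 1) w)\<^sup>2 \<le> r\<^sup>2" by (intro power_mono) auto
    moreover have "q \<bullet> q = R\<^sup>2" using q by (simp add: power2_norm_eq_inner[symmetric])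
    then have "(dist (x 1) w)\<^sup>2 = (x 1 \<bullet> x 1) + R\<^sup>2"
      using that q(2) by (auto simp: dist_norm power2_norm_eq_inner inner_diff_left inner_diff_right
          inner_add_left inner_add_right inner_commute[of q "x (Suc 0)"])
    moreover have "r\<^sup>2 < R\<^sup>2" using \<open>\<not> R \<le> r\<close> r by (intro power_strict_mono) auto
    ultimately show False using inner_ge_zero[of "x 1"] by linarith
  qed
  have "w \<in> cball (x 2) r" if w: "w = q \<or> w = - q" for w
  proof -
    have "w \<in> sphere 0 R" using w q(1) by auto
    then obtain j where j: "j \<in> {1..2}" "w \<in> cball (x j) r" using cover by blast
    then have "j = 1 \<or> j = 2" by auto
    then show ?thesis using 1[OF w] j by auto
  qed
  then have "dist (x 2) q \<le> r" "dist (x 2) (- q) \<le> r" by auto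
  moreover have "dist q (- q) = 2 * R"
  proof -
    have "q - - q = 2 *\<^sub>R q" by (simp add: scaleR_2)
    then show ?thesis using q by (simp add: dist_norm)
  qed
  ultimately show False using dist_triangle[of q "- q" "x 2"] \<open>\<not> R \<le> r\<close> by (simp add: dist_commute)
qed

text \<open>The hole of a shell that covers the origin lies inside \<open>ball 0 R0\<close> and does not contain the origin,
  hence \<open>2 r < R0\<close>.  As the centre of that shell must lie in another one and the ball is connected, two of the
  enlarged shells overlap.\<close>

lemma shell_covering_facts:
  fixes y :: "nat \<Rightarrow> real^2"
  assumes R0: "R0 > 0" and r: "r > 0" and cov: "optimal_shell_covering K1 K2 R0 r m y"
  shows "2 * r < R0" "4 < (R0 / r)\<^sup>2" "5 \<le> m" "2 \<le> K2"
proof -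
  have sub: "ball (y i) r \<subseteq> ball 0 R0" if "i \<in> {1..m}" for i using cov that by (simp add: optimal_shell_covering_def)
  have cover: "ball 0 R0 \<subseteq> (\<Union>i\<in>{1..m}. shell (y i) (2 * r) r)" and mR: "(R0 / r)\<^sup>2 \<le> real m"
    and mult: "\<And>z. z \<in> ball 0 R0 \<Longrightarrow> real (card {i\<in>{1..m}. z \<in> shell (y i) (4 * r) (r / 2)}) \<le> K2"
    using cov by (auto simp: optimal_shell_covering_def)
  have "0 \<in> ball (0 :: real^2) R0" using R0 by simp
  then obtain i where i: "i \<in> {1..m}" "0 \<in> shell (y i) (2 * r) r" using cover by blast
  then have ni: "r < norm (y i)" by (simp add: shell_def)
  have "norm (y i) + r \<le> R0"
  proof -
    have "ball (y i) r \<subseteq> ball 0 R0" by (rule sub[OF i(1)])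
    then have "cball (y i) r \<subseteq> cball 0 R0" using r R0 closure_mono[of "ball (y i) r" "ball 0 R0"] by simp
    then show ?thesis using r R0 by (simp add: cball_subset_cball_iff)
  qed
  then show R: "2 * r < R0" using ni by linarith
  then have "2 < R0 / r" using r by (simp add: pos_less_divide_eq)
  then have "2\<^sup>2 < (R0 / r)\<^sup>2" by (intro power_strict_mono) auto
  then show a: "4 < (R0 / r)\<^sup>2" by simp
  then have "4 < real m" using mR by linarith
  then show "5 \<le> m" by simp
  let ?A = "shell (y i) (4 * r) (r / 2)" and ?B = "\<Union>j\<in>{1..m} - {i}. shell (y j) (4 * r) (r / 2)"
  have os: "open (shell p s t)" for p s t
  proof -
    have "shell p s t = (ball p s) \<inter> (- cball p t)" by (auto simp: shell_def)
    then show ?thesis by (auto intro: open_Int)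
  qed
  have cup: "ball 0 R0 \<subseteq> ?A \<union> ?B"
  proof
    fix z :: "real^2" assume "z \<in> ball 0 R0"
    then obtain j where "j \<in> {1..m}" "z \<in> shell (y j) (2 * r) r" using cover by blast
    then have "z \<in> shell (y j) (4 * r) (r / 2)" using r by (auto simp: shell_def)
    then show "z \<in> ?A \<union> ?B" using \<open>j \<in> {1..m}\<close> by auto
  qed
  have yi: "y i \<in> ball 0 R0" by (rule subsetD[OF sub[OF i(1)]]) (use r in simp)
  have "y i \<notin> ?A" using r by (auto simp: shell_def)
  then have "y i \<in> ?B" using subsetD[OF cup yi] by (simp only: Un_iff simp_thms)
  moreover have "0 \<in> ?A" using i(2) r by (auto simp: shell_def)
  moreover have "connected (ball (0 :: real^2) R0)" by (rule convex_connected) simp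
  moreover have "open ?B" by (intro open_UN ballI os)
  ultimately have "?A \<inter> ?B \<inter> ball 0 R0 \<noteq> {}"
    using connectedD[OF _ os _ _ cup] yi \<open>0 \<in> ball 0 R0\<close> by (metis IntI emptyE)
  then have "\<exists>z. z \<in> ?A \<inter> ?B \<inter> ball 0 R0" by (subst ex_in_conv)
  then obtain z where z0: "z \<in> ?A" "z \<in> ?B" "z \<in> ball 0 R0" by (elim exE IntE) (rule that)
  from z0(2) obtain j where j: "j \<in> {1..m} - {i}" "z \<in> shell (y j) (4 * r) (r / 2)" by (rule UN_E)
  have "{i, j} \<subseteq> {k\<in>{1..m}. z \<in> shell (y k) (4 * r) (r / 2)}" using i(1) j z0(1) by simp
  then have "card {i, j} \<le> card {k\<in>{1..m}. z \<in> shell (y k) (4 * r) (r / 2)}" by (intro card_mono) auto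
  moreover have "card {i, j} = 2" using j(1) by auto
  ultimately show "2 \<le> K2" using mult[OF z0(3)] by linarith
qed

section \<open>Flux bounds for optimal coverings\<close>

lemma open_shell: "open (shell x s t)"
proof -
  have "shell x s t = ball x s \<inter> (- cball x t)" by (auto simp: shell_def)
  then show ?thesis by (auto intro: open_Int)
qed

lemma test_function_support: "test_function U f \<Longrightarrow> f x \<noteq> 0 \<Longrightarrow> x \<in> U"
  unfolding test_function_def using closure_subset[of "{x. f x \<noteq> 0}"] by blast

text \<open>In the regimes of \<open>rim_multiplicity\<close> the overlap at the rim is at most \<open>M\<close>, and then the weight
  beyond the rim stays below \<open>n K\<close>.  The surplus \<open>a / (5 K)\<close> is what a shell covering with \<open>K2 \<ge> m \<ge> 5\<close>
  consumes.\<close>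

lemma ball_weights:
  fixes a K n M :: real
  assumes a: "1 \<le> a" "a \<le> n" and K: "2 \<le> K" and n: "n = 1 \<or> (n = 2 \<and> a = 1) \<or> 3 \<le> n"
    and M: "M = (if a < 9/4 then min K n else if a < 9/2 then min K (n - 1) else min K (n - 2))"
  defines "d \<equiv> n * K - ((M + 1) + (M - 1) * a)"
  shows "0 \<le> d" "5 \<le> K \<Longrightarrow> a / (5 * K) \<le> d"
proof -
  have cross: "a / (5 * K) \<le> d" if "5 \<le> K" "a \<le> 25 * d" "0 \<le> d"
  proof -
    have "d * 5 \<le> d * K" using that(1,3) by (intro mult_left_mono)
    then have "a \<le> 5 * (d * K)" using that(2) by linarith
    then show ?thesis using that(1) by (simp add: pos_divide_le_eq mult_ac)
  qed
  have nK: "k * K \<le> n * K" if "k \<le> n" for k using that K by (intro mult_right_mono) auto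
  have nK': "n * k \<le> n * K" if "k \<le> K" for k using that a by (intro mult_left_mono) auto
  have "0 \<le> d \<and> (5 \<le> K \<longrightarrow> a / (5 * K) \<le> d)"
  proof (cases "a < 9/4")
    case True
    then have M: "M = min K n" using M by simp
    show ?thesis
    proof (cases "K \<le> n")
      case KM: True
      have d: "d = n * K - (K + 1) - (K - 1) * a" using KM by (simp add: d_def M)
      have "(K - 1) * a \<le> (K - 1) * (9/4)" using True K by (intro mult_left_mono) auto
      then have d1: "n * K - (K + 1) - (K - 1) * (9/4) \<le> d" unfolding d by linarith
      moreover have "(K - 1) * (9/4) = 9/4 * K - 9/4" by (simp add: field_simps)
      ultimately have d1: "n * K - (K + 1) - (9/4 * K - 9/4) \<le> d" by linarith
      have 5: "1 \<le> d" if "5 \<le> K"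
      proof -
        have "5 * K \<le> n * K" using that KM by (intro nK) simp
        then show ?thesis using d1 that by linarith
      qed
      have 3: "0 \<le> d" if "3 \<le> n"
        using d1 nK[OF that] 5 K by (cases "5 \<le> K") linarith+
      have 2: "0 \<le> d" if "n = 2" "a = 1" using that KM K by (simp add: d)
      have "0 \<le> d" using n KM K 2 3 by auto
      then show ?thesis using cross 5 True by auto
    next
      case False
      then have d: "d = n * K - (n + 1) - (n - 1) * a" by (simp add: d_def M)
      consider "n = 1" | "n = 2" "a = 1" | "3 \<le> n" using n by blast
      then show ?thesis
      proof cases
        case 1
        then have "a = 1" using a by linarith
        then show ?thesis using 1 K cross by (auto simp: d)
      next
        case 2
        then show ?thesis using K cross by (auto simp: d)
      next
        case 3
        have "(n - 1) * a \<le> (n - 1) * (9/4)" using True 3 by (intro mult_left_mono) auto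
        then have d1: "n * K - (n + 1) - (n - 1) * (9/4) \<le> d" unfolding d by linarith
        have "0 \<le> (n - 3) * (4 * n - 1)" using 3 by simp
        then have "0 \<le> d" using d1 nK'[of n] False by (simp add: field_simps)
        moreover have "1 \<le> d" if "5 \<le> K"
        proof -
          have "(n - 1) * (9/4) = 9/4 * n - 9/4" by (simp add: field_simps)
          then show ?thesis using d1 nK'[OF that] 3 by linarith
        qed
        ultimately show ?thesis using cross True by auto
      qed
    qed
  next
    case a94: False
    then have n3: "3 \<le> n" using n a by linarith
    show ?thesis
    proof (cases "a < 9/2")
      case True
      then have M: "M = min K (n - 1)" using M a94 by simp
      show ?thesis
      proof (cases "K \<le> n - 1")
        case KM: True
        have d: "d = n * K - (K + 1) - (K - 1) * a" using KM by (simp add: d_def M)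
        have "(K - 1) * a \<le> (K - 1) * n" using a K by (intro mult_left_mono) auto
        then have 0: "0 \<le> d" unfolding d using KM by (simp add: algebra_simps)
        have "(K - 1) * a \<le> (K - 1) * (9/2)" using True K by (intro mult_left_mono) auto
        moreover have "(K - 1) * (9/2) = 9/2 * K - 9/2" by (simp add: field_simps)
        ultimately have "1 \<le> d" if "5 \<le> K" unfolding d using nK[of 6] KM that by linarith
        then show ?thesis using cross 0 True by auto
      next
        case False
        then have d: "d = n * K - n - (n - 2) * a" by (simp add: d_def M)
        have "(n - 2) * a \<le> (n - 2) * n" using a n3 by (intro mult_left_mono) auto
        then have 0: "0 \<le> d" unfolding d using nK'[of "n - 1"] False by (simp add: algebra_simps)
        have "(n - 2) * a \<le> (n - 2) * (9/2)" using True n3 by (intro mult_left_mono) auto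
        then have d1: "n * K - n - (n - 2) * (9/2) \<le> d" unfolding d by linarith
        have "1 \<le> d" if "5 \<le> K"
        proof (cases "6 \<le> n")
          case True
          have "0 \<le> (n - 6) * (2 * n - 1)" using True by simp
          then show ?thesis using d1 nK'[of "n - 1"] False by (simp add: field_simps)
        next
          case False
          have "(n - 2) * (9/2) = 9/2 * n - 9" by (simp add: field_simps)
          then show ?thesis using d1 nK'[OF that] False by linarith
        qed
        then show ?thesis using cross 0 True by auto
      qed
    next
      case False
      then have M: "M = min K (n - 2)" using M a94 by simp
      show ?thesis
      proof (cases "K \<le> n - 2")
        case KM: True
        have d: "d = n * K - (K + 1) - (K - 1) * a" using KM by (simp add: d_def M)
        have "(K - 1) * a \<le> (K - 1) * n" using a K by (intro mult_left_mono) auto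
        then have d1: "n - K - 1 \<le> d" unfolding d by (simp add: algebra_simps)
        have "a / (5 * K) \<le> d" if K5: "5 \<le> K"
        proof -
          have "0 \<le> (K - 5) * (n - 2 - K)" using K5 KM by simp
          then have "n \<le> 5 * (K * (n - K - 1))" using KM K5 by (simp add: algebra_simps)
          then have "a \<le> (n - K - 1) * (5 * K)" using a by (simp add: algebra_simps)
          then have "a / (5 * K) \<le> n - K - 1" using K5 by (simp add: pos_divide_le_eq)
          then show ?thesis using d1 by linarith
        qed
        then show ?thesis using d1 KM by auto
      next
        case KM: False
        then have d: "d = n * K - (n - 1) - (n - 3) * a" by (simp add: d_def M)
        have "(n - 3) * a \<le> (n - 3) * n" using a n3 by (intro mult_left_mono) auto
        then have "n * K - (n - 1) - (n - 3) * n \<le> d" unfolding d by linarith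
        moreover have "n * (n - 2) \<le> n * K" using KM by (intro nK') simp
        ultimately have d1: "1 \<le> d" by (simp add: algebra_simps)
        have "a / (5 * K) \<le> d" if K5: "5 \<le> K"
        proof -
          have "a \<le> 5 * K" using a KM K5 by linarith
          then have "a / (5 * K) \<le> 1" using K5 by simp
          then show ?thesis using d1 by linarith
        qed
        then show ?thesis using d1 by auto
      qed
    qed
  qed
  then show "0 \<le> d" "5 \<le> K \<Longrightarrow> a / (5 * K) \<le> d" by auto
qed

context flow
begin

text \<open>Inside, \<open>\<psi>0 = 1\<close> and its Laplacian vanishes; beyond the rim \<open>\<Delta>\<psi>0\<close> costs one more unit, but the
  overlap \<open>Mo\<close> may be smaller there.\<close>

lemma cover_weights:
  fixes \<psi> :: "nat \<Rightarrow> real^2 \<Rightarrow> real" and M Mo r :: real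
  assumes I: "finite I" and s: "\<And>j. j \<in> I \<Longrightarrow> smooth_on (\<psi> j) UNIV"
    and le: "\<And>j x. j \<in> I \<Longrightarrow> 0 \<le> \<psi> j x \<and> \<psi> j x \<le> \<psi>0 x"
    and cb: "\<And>j. j \<in> I \<Longrightarrow> cutoff_bounds \<delta> C0 r (\<psi> j)" and r: "0 < r" and M: "Mo \<le> M"
    and inner: "\<And>V. open V \<Longrightarrow> V \<noteq> {} \<Longrightarrow> V \<subseteq> ball 0 R0 \<Longrightarrow>
      \<exists>x\<in>V. (\<exists>i\<in>I. \<forall>\<^sub>F y in nhds x. \<psi> i y = \<psi>0 y) \<and> real (card {j\<in>I. \<psi> j x \<noteq> 0}) \<le> M"
    and outer: "\<And>V. open V \<Longrightarrow> V \<noteq> {} \<Longrightarrow> V \<subseteq> {x. R0 < norm x} \<Longrightarrow> (\<forall>x\<in>V. \<psi>0 x \<noteq> 0) \<Longrightarrow>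
      \<exists>x\<in>V. (\<exists>i\<in>I. \<forall>\<^sub>F y in nhds x. \<psi> i y = \<psi>0 y) \<and> real (card {j\<in>I. \<psi> j x \<noteq> 0}) \<le> Mo"
  defines "S \<equiv> \<lambda>x. \<Sum>j\<in>I. \<psi> j x" and "a \<equiv> (R0 / r)\<^sup>2"
  shows "admissible S" "\<psi>0 x \<le> S x" "S x \<le> M * \<psi>0 x"
    and "\<psi>0 x \<noteq> 0 \<Longrightarrow> \<bar>laplacian S x - laplacian \<psi>0 x\<bar> \<le> (M - 1) * (C0 / r\<^sup>2) * \<psi>0 x powr b"
    and "\<psi>0 x \<noteq> 0 \<Longrightarrow> S x + R0\<^sup>2 / C0 * \<bar>laplacian S x\<bar>
      \<le> (if R0 \<le> norm x then (Mo + 1) + (Mo - 1) * a else M + (M - 1) * a) * \<psi>0 x powr b"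
proof -
  have adm: "admissible (\<psi> j)" if "j \<in> I" for j
    unfolding admissible_def
  proof (intro conjI allI impI)
    fix x show "0 \<le> \<psi> j x" using le[OF that] by blast
    assume "\<psi>0 x = 0" then show "\<psi> j x = 0" using le[OF that, of x] by linarith
  qed (rule s[OF that])
  show S: "admissible S" unfolding S_def by (rule flux_sum(1)[OF I adm])
  have inn: "\<psi>0 x \<le> S x" "S x \<le> M * \<psi>0 x"
    "\<bar>laplacian S x - laplacian \<psi>0 x\<bar> \<le> (M - 1) * (C0 / r\<^sup>2) * \<psi>0 x powr b"
    if "norm x < R0" "\<psi>0 x \<noteq> 0" for x
  proof -
    have "x \<in> ball 0 R0" using that by simp
    then have "x \<in> closure (ball 0 R0)" using closure_subset by blast
    note * = sum_of_cutoffs[OF I s le cb r open_ball inner this that(2)]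
    show "\<psi>0 x \<le> S x" "S x \<le> M * \<psi>0 x"
      "\<bar>laplacian S x - laplacian \<psi>0 x\<bar> \<le> (M - 1) * (C0 / r\<^sup>2) * \<psi>0 x powr b"
      unfolding S_def by (rule *; assumption)+
  qed
  have out: "\<psi>0 x \<le> S x" "S x \<le> Mo * \<psi>0 x"
    "\<bar>laplacian S x - laplacian \<psi>0 x\<bar> \<le> (Mo - 1) * (C0 / r\<^sup>2) * \<psi>0 x powr b"
    if "R0 \<le> norm x" "\<psi>0 x \<noteq> 0" for x
  proof -
    have o: "open {x :: real^2. R0 < norm x}" by (intro open_Collect_less continuous_intros)
    note * = sum_of_cutoffs[OF I s le cb r o outer outer_closure[OF R0 that(1)] that(2)]
    show "\<psi>0 x \<le> S x" "S x \<le> Mo * \<psi>0 x"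
      "\<bar>laplacian S x - laplacian \<psi>0 x\<bar> \<le> (Mo - 1) * (C0 / r\<^sup>2) * \<psi>0 x powr b"
      unfolding S_def by (rule *; assumption)+
  qed
  have z: "S x = 0" if "\<psi>0 x = 0" for x using S that by (simp add: admissible_def)
  show "\<psi>0 x \<le> S x" using inn(1)[of x] out(1)[of x] z[of x] by (cases "\<psi>0 x = 0"; cases "R0 \<le> norm x") auto
  have MM: "Mo * \<psi>0 x \<le> M * \<psi>0 x" using M psi0(2) by (intro mult_right_mono)
  show "S x \<le> M * \<psi>0 x"
    using inn(2)[of x] out(2)[of x] z[of x] MM by (cases "\<psi>0 x = 0"; cases "R0 \<le> norm x") auto
  assume nz: "\<psi>0 x \<noteq> 0"
  have "(Mo - 1) * (C0 / r\<^sup>2) * \<psi>0 x powr b \<le> (M - 1) * (C0 / r\<^sup>2) * \<psi>0 x powr b"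
    using M C0 r by (intro mult_right_mono) auto
  then show "\<bar>laplacian S x - laplacian \<psi>0 x\<bar> \<le> (M - 1) * (C0 / r\<^sup>2) * \<psi>0 x powr b"
    using inn(3)[OF _ nz] out(3)[OF _ nz] by (cases "R0 \<le> norm x") auto
  have pb: "\<psi>0 x \<le> \<psi>0 x powr b"
    using powr_mono'[of b 1 "\<psi>0 x"] psi0(2,3)[of x] b nz by simp
  have p: "0 < \<psi>0 x" using nz psi0(2)[of x] by linarith
  have key: "S x + R0\<^sup>2 / C0 * \<bar>laplacian S x\<bar> \<le> (N + k + (N - 1) * a) * \<psi>0 x powr b"
    if h: "\<psi>0 x \<le> S x" "S x \<le> N * \<psi>0 x" "\<bar>laplacian S x - laplacian \<psi>0 x\<bar> \<le> (N - 1) * (C0 / r\<^sup>2) * \<psi>0 x powr b"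
      and l: "\<bar>laplacian \<psi>0 x\<bar> \<le> k * (C0 / R0\<^sup>2) * \<psi>0 x powr b" for N k
  proof -
    have "1 * \<psi>0 x \<le> N * \<psi>0 x" using h by linarith
    then have "1 \<le> N" using p by (rule mult_right_le_imp_le)
    then have "N * \<psi>0 x \<le> N * \<psi>0 x powr b" using pb by (intro mult_left_mono) auto
    moreover have "R0\<^sup>2 / C0 * \<bar>laplacian S x\<bar>
      \<le> R0\<^sup>2 / C0 * (k * (C0 / R0\<^sup>2) * \<psi>0 x powr b + (N - 1) * (C0 / r\<^sup>2) * \<psi>0 x powr b)"
      using h(3) l C0 by (intro mult_left_mono) auto
    moreover have "R0\<^sup>2 / C0 * (k * (C0 / R0\<^sup>2) * \<psi>0 x powr b + (N - 1) * (C0 / r\<^sup>2) * \<psi>0 x powr b)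
      = (k + (N - 1) * a) * \<psi>0 x powr b"
    proof -
      have "R0\<^sup>2 / C0 * (k * (C0 / R0\<^sup>2)) = k" "R0\<^sup>2 / C0 * ((N - 1) * (C0 / r\<^sup>2)) = (N - 1) * a"
        using C0 R0 r by (simp_all add: a_def power_divide)
      then show ?thesis by (metis (no_types, lifting) distrib_left distrib_right mult.assoc)
    qed
    ultimately show ?thesis using h(2) by (simp add: distrib_right)
  qed
  show "S x + R0\<^sup>2 / C0 * \<bar>laplacian S x\<bar>
      \<le> (if R0 \<le> norm x then (Mo + 1) + (Mo - 1) * a else M + (M - 1) * a) * \<psi>0 x powr b"
  proof (cases "R0 \<le> norm x")
    case True
    have "\<bar>laplacian \<psi>0 x\<bar> \<le> 1 * (C0 / R0\<^sup>2) * \<psi>0 x powr b" using laplacian_psi0[OF nz] by simp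
    from key[OF out[OF True nz] this] show ?thesis using True by simp
  next
    case False
    then have x: "norm x < R0" by simp
    have "\<forall>\<^sub>F y in nhds x. \<psi>0 y = 1"
      using eventually_nhds_in_open[of "ball 0 R0" x] x by (auto elim!: eventually_mono intro: psi0(4))
    then have "laplacian \<psi>0 x = 0" using laplacian_cong_ev[of \<psi>0 "\<lambda>_. 1" x] laplacian_zero by simp
    then have "\<bar>laplacian \<psi>0 x\<bar> \<le> 0 * (C0 / R0\<^sup>2) * \<psi>0 x powr b" by simp
    from key[OF inn[OF x nz] this] show ?thesis using False by simp
  qed
qed

lemma equals_psi0_near:
  assumes "open A" "R0 < norm x" "\<psi>0 x \<noteq> 0" "dir R0 x \<in> A" "\<And>y. y \<in> cone_part R0 A \<Longrightarrow> \<psi> y = \<psi>0 y"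
  shows "\<forall>\<^sub>F y in nhds x. \<psi> y = \<psi>0 y"
proof -
  have x0: "x \<noteq> 0" using assms(2) R0 by auto
  have "test_function (ball 0 (2 * R0)) \<psi>0" using main by (simp add: main_cutoff_def)
  then have "x \<in> ball 0 (2 * R0)" using assms(3) by (rule test_function_support)
  moreover have "open {x :: real^2. R0 < norm x}" by (intro open_Collect_less continuous_intros)
  ultimately have "\<forall>\<^sub>F y in nhds x. y \<in> ball 0 (2 * R0)" "\<forall>\<^sub>F y in nhds x. y \<in> {x. R0 < norm x}"
    using assms(2) by (intro eventually_nhds_in_open; simp)+
  with dir_near[OF R0 x0 assms(1,4)] show ?thesis
  proof eventually_elim
    case (elim y)
    then show ?case using cone_part_iff[of R0 y A] R0 by (intro assms(5)) auto
  qed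
qed

lemma P_tot_nonneg: "0 \<le> P_tot"
  unfolding P_tot_def J_def set_lebesgue_integral_def
  using eta(2) psi0(2) by (intro integral_nonneg_AE) (auto intro!: mult_nonneg_nonneg)

text \<open>A ball of the covering that contains a point of the rim is not contained in \<open>ball 0 R0\<close>, so its
  cut-off coincides with \<open>\<psi>0\<close> near the ray beyond that point.  The surplus of the weights beyond the rim is kept
  as \<open>D\<close>.\<close>

lemma ball_cover_flux:
  fixes x :: "nat \<Rightarrow> real^2" and \<psi> :: "nat \<Rightarrow> real^2 \<Rightarrow> real"
  assumes r: "r \<le> R0" and cov: "optimal_ball_covering K1 K2 R0 r n x" and K2: "2 \<le> K2"
    and cut: "\<forall>i\<in>{1..n}. ball_cutoff \<delta> C0 R0 \<psi>0 (x i) r (\<psi> i)"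
  defines "a \<equiv> (R0 / r)\<^sup>2"
  shows "0 < r" "1 \<le> a" "\<And>i. i \<in> {1..n} \<Longrightarrow> admissible (\<psi> i)"
    and "\<exists>D. 0 \<le> D \<and> (5 \<le> K2 \<longrightarrow> a / (5 * K2) \<le> D) \<and>
      \<nu> * (P_tot - C0 / R0\<^sup>2 * (real n * K2 * E_tot - D * E_out)) \<le> (\<Sum>i=1..n. flux (\<psi> i)) \<and>
      (\<Sum>i=1..n. flux (\<psi> i)) \<le> \<nu> * (K2 * P_tot + C0 / R0\<^sup>2 * (real n * K2 * E_tot))"
proof -
  let ?I = "{1..n}"
  have xin: "norm (x i) < R0" if "i \<in> ?I" for i using cov that by (simp add: optimal_ball_covering_def)
  have cover: "ball 0 R0 \<subseteq> (\<Union>i\<in>?I. ball (x i) r)" and na: "a \<le> real n"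
    and mult: "\<And>y. y \<in> ball 0 R0 \<Longrightarrow> real (card {i\<in>?I. y \<in> ball (x i) (2 * r)}) \<le> K2"
    using cov by (auto simp: optimal_ball_covering_def a_def)
  have "0 \<in> ball (0 :: real^2) R0" using R0 by simp
  then have "0 \<in> (\<Union>i\<in>?I. ball (x i) r)" by (rule subsetD[OF cover])
  then obtain i0 where i0: "i0 \<in> ?I" "0 \<in> ball (x i0) r" by (rule UN_E)
  have "0 \<le> dist (x i0) 0" by (rule zero_le_dist)
  then show r0: "0 < r" using i0(2) unfolding mem_ball by linarith
  then have "1 \<le> R0 / r" using r by (simp add: pos_le_divide_eq)
  then have "1\<^sup>2 \<le> (R0 / r)\<^sup>2" by (intro power_mono) auto
  then show a1: "1 \<le> a" by (simp add: a_def)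
  have s: "smooth_on (\<psi> j) UNIV" if "j \<in> ?I" for j using bspec[OF cut that] by (simp add: ball_cutoff_def)
  have le: "0 \<le> \<psi> j y \<and> \<psi> j y \<le> \<psi>0 y" if "j \<in> ?I" for j y using bspec[OF cut that] by (simp add: ball_cutoff_def)
  have cb: "cutoff_bounds \<delta> C0 r (\<psi> j)" if "j \<in> ?I" for j using bspec[OF cut that] by (simp add: ball_cutoff_def)
  have one: "\<psi> j y = 1" if "j \<in> ?I" "y \<in> ball (x j) r \<inter> ball 0 R0" for j y
    using bspec[OF cut that(1)] that(2) unfolding ball_cutoff_def by blast
  have proper: "y \<in> ball (x j) (2 * r)" if "j \<in> ?I" "ball (x j) r \<subset> ball 0 R0" "\<psi> j y \<noteq> 0" for j y
    using bspec[OF cut that(1)] that(2) test_function_support[of "ball (x j) (2 * r)" "\<psi> j" y, OF _ that(3)] unfolding ball_cutoff_def by simp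
  have improper: "\<forall>y\<in>cone_part R0 (cball (x j) r). \<psi> j y = \<psi>0 y"
      "\<forall>y\<in>ball 0 R0 - ball (x j) (2 * r). \<psi> j y = 0"
      "\<forall>y. R0 \<le> norm y \<and> norm y \<le> 2 * R0 \<and> y \<notin> cone_part R0 (ball (x j) (2 * r)) \<longrightarrow> \<psi> j y = 0"
    if "j \<in> ?I" "\<not> ball (x j) r \<subset> ball 0 R0" for j
    using bspec[OF cut that(1)] that(2) unfolding ball_cutoff_def by simp_all
  show adm: "admissible (\<psi> i)" if "i \<in> ?I" for i
    unfolding admissible_def
  proof (intro conjI allI impI)
    fix y show "0 \<le> \<psi> i y" using le[OF that] by blast
    assume "\<psi>0 y = 0" then show "\<psi> i y = 0" using le[OF that, of y] by linarith
  qed (rule s[OF that])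
  have card_le: "card {j\<in>?I. Q j} \<le> n" for Q
  proof -
    have "card {j\<in>?I. Q j} \<le> card ?I" by (intro card_mono) auto
    then show ?thesis by simp
  qed
  have inner: "\<exists>y\<in>V. (\<exists>i\<in>?I. \<forall>\<^sub>F z in nhds y. \<psi> i z = \<psi>0 z) \<and> real (card {j\<in>?I. \<psi> j y \<noteq> 0}) \<le> min K2 (real n)"
    if V: "open V" "V \<noteq> {}" "V \<subseteq> ball 0 R0" for V
  proof -
    obtain y where y: "y \<in> V" using V(2) by blast
    then have yb: "y \<in> ball 0 R0" using V(3) by blast
    obtain i where i: "i \<in> ?I" "y \<in> ball (x i) r" using subsetD[OF cover yb] by (rule UN_E)
    have "\<forall>\<^sub>F z in nhds y. z \<in> ball (x i) r \<inter> ball 0 R0" using i yb by (intro eventually_nhds_in_open) auto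
    then have "\<forall>\<^sub>F z in nhds y. \<psi> i z = \<psi>0 z"
      by (rule eventually_mono) (use one[OF i(1)] psi0(4) in simp)
    moreover have "{j\<in>?I. \<psi> j y \<noteq> 0} \<subseteq> {j\<in>?I. y \<in> ball (x j) (2 * r)}"
    proof (intro Collect_mono impI conjI; elim conjE)
      fix j assume j: "j \<in> ?I" "\<psi> j y \<noteq> 0"
      show "y \<in> ball (x j) (2 * r)"
      proof (rule ccontr)
        assume no: "y \<notin> ball (x j) (2 * r)"
        then have "\<not> ball (x j) r \<subset> ball 0 R0" using proper[OF j(1) _ j(2)] by (metis (no_types))
        then show False using improper(2)[OF j(1)] no yb j(2) by simp
      qed
    qed
    then have "card {j\<in>?I. \<psi> j y \<noteq> 0} \<le> card {j\<in>?I. y \<in> ball (x j) (2 * r)}" by (intro card_mono) auto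
    then have "real (card {j\<in>?I. \<psi> j y \<noteq> 0}) \<le> min K2 (real n)"
      using mult[OF yb] card_le[of "\<lambda>j. \<psi> j y \<noteq> 0"] by simp
    ultimately show ?thesis using y i(1) by blast
  qed
  have sph: "sphere 0 R0 \<subseteq> (\<Union>j\<in>?I. cball (x j) r)"
  proof (rule sphere_covered[OF R0])
    show "ball 0 R0 \<subseteq> (\<Union>j\<in>?I. cball (x j) r)"
      by (rule order_trans[OF cover]) (intro UN_mono order_refl ball_subset_cball)
  qed simp
  define Mo where "Mo = (if a < 9/4 then min K2 (real n) else if a < 9/2 then min K2 (real n - 1) else min K2 (real n - 2))"
  have outer: "\<exists>y\<in>V. (\<exists>i\<in>?I. \<forall>\<^sub>F z in nhds y. \<psi> i z = \<psi>0 z) \<and> real (card {j\<in>?I. \<psi> j y \<noteq> 0}) \<le> Mo"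
    if V: "open V" "V \<noteq> {}" "V \<subseteq> {x. R0 < norm x}" "\<forall>x\<in>V. \<psi>0 x \<noteq> 0" for V
  proof -
    have V2: "norm y < 2 * R0" if "y \<in> V" for y
    proof -
      have "test_function (ball 0 (2 * R0)) \<psi>0" using main by (simp add: main_cutoff_def)
      moreover have "\<psi>0 y \<noteq> 0" using V(4) that by blast
      ultimately have "y \<in> ball 0 (2 * R0)" by (rule test_function_support)
      then show ?thesis by simp
    qed
    have "\<exists>y\<in>V. \<exists>i\<in>?I. \<forall>\<^sub>F z in nhds y. \<psi> i z = \<psi>0 z"
    \<comment> \<open>Unless one of the discs is bounded by the rim itself, the open discs meet a dense set of directions.\<close>
    proof (cases "\<exists>i\<in>?I. x i = 0 \<and> r = R0")
      case True
      then obtain i where i: "i \<in> ?I" "x i = 0" "r = R0" by blast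
      have "\<not> ball (x i) r \<subset> ball 0 R0" using i by simp
      note imp = improper(1)[OF i(1) this]
      have "\<psi> i z = \<psi>0 z" if "z \<in> V" for z
      proof -
        have z: "R0 \<le> norm z" "norm z \<le> 2 * R0" using V(3) V2[OF that] that by auto
        have "norm (dir R0 z) \<le> R0" using dir(1)[OF R0 z(1)] by simp
        then have "z \<in> cone_part R0 (cball (x i) r)" using cone_part_iff[OF R0 z] i by simp
        then show ?thesis using imp by blast
      qed
      moreover obtain y where "y \<in> V" using V(2) by blast
      ultimately show ?thesis using eventually_nhds_in_open[OF V(1)] i(1) by (metis (mono_tags, lifting) eventually_mono)
    next
      case False
      then have "x j \<noteq> 0 \<or> r \<noteq> R0" if "j \<in> ?I" for j using that by blast
      then obtain y i where y: "y \<in> V" "i \<in> ?I" "dir R0 y \<in> ball (x i) r"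
        using dense_annulus[OF R0 finite_atLeastAtMost _ sph V(1,2,3)] by blast
      have yn: "R0 < norm y" using V(3) y(1) by blast
      have "dir R0 y \<notin> ball 0 R0" using dir(1)[OF R0, of y] yn by simp
      then have "\<not> ball (x i) r \<subset> ball 0 R0" using y(3) by blast
      note imp = improper(1)[OF y(2) this]
      have "cone_part R0 (ball (x i) r) \<subseteq> cone_part R0 (cball (x i) r)"
        unfolding cone_part_def using ball_subset_cball by blast
      then have "\<forall>\<^sub>F z in nhds y. \<psi> i z = \<psi>0 z"
        using imp V(4) y yn by (intro equals_psi0_near[of "ball (x i) r"]) auto
      then show ?thesis using y by blast
    qed
    then obtain y i where y: "y \<in> V" "i \<in> ?I" "\<forall>\<^sub>F z in nhds y. \<psi> i z = \<psi>0 z" by blast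
    have yn: "R0 < norm y" "norm y < 2 * R0" using V(3) V2 y(1) by auto
    let ?z = "dir R0 y"
    note dy = dir[OF R0, of y]
    have zn: "norm ?z = R0" using dy yn by simp
    have "{j\<in>?I. \<psi> j y \<noteq> 0} \<subseteq> {j\<in>?I. ?z \<in> ball (x j) (2 * r)}"
    proof (intro Collect_mono impI conjI; elim conjE)
      fix j assume j: "j \<in> ?I" "\<psi> j y \<noteq> 0"
      show "?z \<in> ball (x j) (2 * r)"
      proof (cases "ball (x j) r \<subset> ball 0 R0")
        case True
        have "dist (x j) y < 2 * r" using proper[OF j(1) True j(2)] by simp
        moreover have "dist (x j) ?z \<le> dist (x j) y"
          using radial_projection_closer[OF zn, of "x j" "norm y / R0"] xin[OF j(1)] dy yn by simp
        ultimately show ?thesis by simp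
      next
        case False
        have "y \<in> cone_part R0 (ball (x j) (2 * r))" using spec[OF improper(3)[OF j(1) False], of y] j(2) yn by simp
        then show ?thesis using cone_part_iff[OF R0, of y] yn by simp
      qed
    qed
    then have c1: "card {j\<in>?I. \<psi> j y \<noteq> 0} \<le> card {j\<in>?I. ?z \<in> ball (x j) (2 * r)}" (is "?c \<le> ?N") by (intro card_mono) auto
    have c2: "real ?N \<le> K2"
    proof (rule multiplicity_on_sphere[OF R0 finite_atLeastAtMost])
      show "open (ball (x j) (2 * r))" for j by (rule open_ball)
      show "?z \<in> sphere 0 R0" using zn by simp
    qed (rule mult)
    have c3: "?N \<le> n" by (rule card_le)
    note rim = rim_multiplicity[OF R0 r0 r sph zn, folded a_def]
    have "real ?c \<le> Mo"
    proof -
      have "9/4 \<le> a \<Longrightarrow> ?N + 1 \<le> n" using rim(1) c3 by linarith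
      moreover have "9/2 \<le> a \<Longrightarrow> ?N + 2 \<le> n" using rim(2) by linarith
      ultimately have "real ?N \<le> Mo" using c2 c3 by (auto simp: Mo_def)
      then show ?thesis using c1 by linarith
    qed
    then show ?thesis using y by blast
  qed
  define S where "S = (\<lambda>y. \<Sum>j\<in>?I. \<psi> j y)"
  define M where "M = min K2 (real n)"
  have MM: "Mo \<le> M" by (auto simp: Mo_def M_def)
  note cw = cover_weights[OF finite_atLeastAtMost s le cb r0 MM inner[folded M_def] outer]
  have adS: "admissible S" unfolding S_def by (rule cw(1); assumption)
  have S1: "\<psi>0 y \<le> S y" for y unfolding S_def by (rule cw(2); assumption)
  have S2: "S y \<le> M * \<psi>0 y" for y unfolding S_def by (rule cw(3); assumption)
  have S3: "S y + R0\<^sup>2 / C0 * \<bar>laplacian S y\<bar>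
      \<le> (if R0 \<le> norm y then (Mo + 1) + (Mo - 1) * a else M + (M - 1) * a) * \<psi>0 y powr b"
    if "\<psi>0 y \<noteq> 0" for y unfolding S_def a_def by (rule cw(5)) (assumption | rule that)+
  note fb = flux_bounds[OF adS S1 S2 S3]
  define D where "D = real n * K2 - ((Mo + 1) + (Mo - 1) * a)"
  have n3: "real n = 1 \<or> (real n = 2 \<and> a = 1) \<or> 3 \<le> real n"
  proof -
    have "n = 0 \<or> n = 1 \<or> n = 2 \<or> 3 \<le> n" by linarith
    moreover have "n \<noteq> 0" using i0 by auto
    moreover have "a = 1" if "n = 2"
    proof -
      have "R0 \<le> r" using two_discs[OF R0 r0, of x] sph that by simp
      then have "r = R0" using r by simp
      then show ?thesis using R0 by (simp add: a_def)
    qed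
    ultimately show ?thesis by auto
  qed
  have D0: "0 \<le> D" and D5: "5 \<le> K2 \<Longrightarrow> a / (5 * K2) \<le> D"
    using ball_weights[OF a1 na K2 n3 Mo_def] by (auto simp: D_def)
  have "M + (M - 1) * a \<le> real n * K2"
  proof -
    have n1: "1 \<le> M" "M \<le> real n" "M \<le> K2" using na a1 K2 by (auto simp: M_def)
    then have "(M - 1) * a \<le> (M - 1) * real n" using na by (intro mult_left_mono) auto
    moreover have "real n * M \<le> real n * K2" using n1 by (intro mult_left_mono) auto
    moreover have "(M - 1) * real n = real n * M - real n" by (simp add: algebra_simps)
    ultimately show ?thesis using n1 by linarith
  qed
  then have "(M + (M - 1) * a) * (E_tot - E_out) \<le> real n * K2 * (E_tot - E_out)"
    using E_bounds by (intro mult_right_mono) auto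
  then have err: "(M + (M - 1) * a) * E_tot + ((Mo + 1) + (Mo - 1) * a - (M + (M - 1) * a)) * E_out
    \<le> real n * K2 * E_tot - D * E_out"
    unfolding D_def by (simp add: algebra_simps)
  have nB: "0 < \<nu> * (C0 / R0\<^sup>2)" using nu C0 R0 by simp
  have err': "\<nu> * (C0 / R0\<^sup>2) * ((M + (M - 1) * a) * E_tot + ((Mo + 1) + (Mo - 1) * a - (M + (M - 1) * a)) * E_out)
    \<le> \<nu> * (C0 / R0\<^sup>2) * (real n * K2 * E_tot - D * E_out)"
    using err nB by (intro mult_left_mono) auto
  have "\<nu> * (C0 / R0\<^sup>2) * (real n * K2 * E_tot - D * E_out) \<le> \<nu> * (C0 / R0\<^sup>2) * (real n * K2 * E_tot)"
    using nB D0 E_bounds by (intro mult_left_mono) auto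
  moreover have "\<nu> * (M * P_tot) \<le> \<nu> * (K2 * P_tot)"
    using nu P_tot_nonneg by (intro mult_left_mono mult_right_mono) (auto simp: M_def)
  moreover have "flux S = (\<Sum>i=1..n. flux (\<psi> i))" unfolding S_def by (rule flux_sum(2)[OF _ adm]) auto
  moreover have "\<nu> * P_tot - \<nu> * (C0 / R0\<^sup>2) * ((M + (M - 1) * a) * E_tot + ((Mo + 1) + (Mo - 1) * a - (M + (M - 1) * a)) * E_out) \<le> flux S"
    by (rule fb(1))
  moreover have "flux S \<le> \<nu> * (M * P_tot) + \<nu> * (C0 / R0\<^sup>2) * ((M + (M - 1) * a) * E_tot + ((Mo + 1) + (Mo - 1) * a - (M + (M - 1) * a)) * E_out)"
    by (rule fb(2))
  ultimately have "\<nu> * P_tot - \<nu> * (C0 / R0\<^sup>2) * (real n * K2 * E_tot - D * E_out) \<le> (\<Sum>i=1..n. flux (\<psi> i))"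
    "(\<Sum>i=1..n. flux (\<psi> i)) \<le> \<nu> * (K2 * P_tot) + \<nu> * (C0 / R0\<^sup>2) * (real n * K2 * E_tot)"
    using err' by linarith+
  then show "\<exists>D. 0 \<le> D \<and> (5 \<le> K2 \<longrightarrow> a / (5 * K2) \<le> D) \<and>
      \<nu> * (P_tot - C0 / R0\<^sup>2 * (real n * K2 * E_tot - D * E_out)) \<le> (\<Sum>i=1..n. flux (\<psi> i)) \<and>
      (\<Sum>i=1..n. flux (\<psi> i)) \<le> \<nu> * (K2 * P_tot + C0 / R0\<^sup>2 * (real n * K2 * E_tot))"
    using D0 D5 by (intro exI[of _ D]) (simp add: right_diff_distrib distrib_left mult.assoc)
qed

text \<open>As \<open>2 r < R0\<close>, the circles of radius \<open>2 r\<close> never coincide with the rim, and the inner discs lie inside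
  \<open>ball 0 R0\<close>; so beyond the rim a shell behaves like a disc of radius \<open>2 r\<close>.  For \<open>K2 \<ge> m\<close> all shells may
  overlap, which costs \<open>E_out\<close> in the upper bound and calls for \<open>flux_lower_bound\<close> in the lower one.\<close>

lemma shell_cover_flux:
  fixes y :: "nat \<Rightarrow> real^2" and \<psi> :: "nat \<Rightarrow> real^2 \<Rightarrow> real"
  assumes cov: "optimal_shell_covering K1 K2 R0 r m y"
    and cut: "\<forall>i\<in>{1..m}. shell_cutoff \<delta> C0 R0 \<psi>0 (y i) r (\<psi> i)"
  shows "0 < r" "5 \<le> m" "2 \<le> K2" "\<And>i. i \<in> {1..m} \<Longrightarrow> admissible (\<psi> i)"
    and "\<nu> * (P_tot - C0 / R0\<^sup>2 * (real m * K2 * E_tot)) \<le> (\<Sum>i=1..m. flux (\<psi> i))"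
    and "(\<Sum>i=1..m. flux (\<psi> i))
      \<le> \<nu> * (K2 * P_tot + C0 / R0\<^sup>2 * (real m * K2 * E_tot + (if real m \<le> K2 then E_out else 0)))"
proof -
  let ?I = "{1..m}"
  have cover: "ball 0 R0 \<subseteq> (\<Union>i\<in>?I. shell (y i) (2 * r) r)"
    and sub: "\<And>i. i \<in> ?I \<Longrightarrow> ball (y i) r \<subseteq> ball 0 R0"
    and mult: "\<And>z. z \<in> ball 0 R0 \<Longrightarrow> real (card {i\<in>?I. z \<in> shell (y i) (4 * r) (r / 2)}) \<le> K2"
    using cov by (auto simp: optimal_shell_covering_def)
  have "0 \<in> ball (0 :: real^2) R0" using R0 by simp
  then have "0 \<in> (\<Union>i\<in>?I. shell (y i) (2 * r) r)" by (rule subsetD[OF cover])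
  then obtain i0 where "i0 \<in> ?I" "0 \<in> shell (y i0) (2 * r) r" by (rule UN_E)
  then have "r < dist (y i0) 0" "dist (y i0) 0 < 2 * r" by (auto simp: shell_def)
  then show r0: "0 < r" by linarith
  note facts = shell_covering_facts[OF R0 r0 cov]
  show m5: "5 \<le> m" and K2: "2 \<le> K2" by (rule facts)+
  define a where "a = (R0 / r)\<^sup>2"
  have am: "a \<le> real m" using cov by (simp add: optimal_shell_covering_def a_def)
  have a1: "1 \<le> a" using facts(2) by (simp add: a_def)
  have s: "smooth_on (\<psi> j) UNIV" if "j \<in> ?I" for j using bspec[OF cut that] by (simp add: shell_cutoff_def)
  have le: "0 \<le> \<psi> j z \<and> \<psi> j z \<le> \<psi>0 z" if "j \<in> ?I" for j z using bspec[OF cut that] by (simp add: shell_cutoff_def)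
  have cb: "cutoff_bounds \<delta> C0 r (\<psi> j)" if "j \<in> ?I" for j using bspec[OF cut that] by (simp add: shell_cutoff_def)
  have one: "\<psi> j z = 1" if "j \<in> ?I" "z \<in> shell (y j) (2 * r) r \<inter> ball 0 R0" for j z
    using bspec[OF cut that(1)] that(2) unfolding shell_cutoff_def by blast
  have proper: "z \<in> shell (y j) (4 * r) (r / 2)"
    if "j \<in> ?I" "shell (y j) (2 * r) r \<subseteq> ball 0 R0" "\<psi> j z \<noteq> 0" for j z
    using bspec[OF cut that(1)] that(2) test_function_support[of "shell (y j) (4 * r) (r / 2)" "\<psi> j" z, OF _ that(3)]
    unfolding shell_cutoff_def by simp
  have improper: "\<forall>z\<in>cone_part R0 (ball (y j) (2 * r)). \<psi> j z = \<psi>0 z"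
      "\<forall>z\<in>ball 0 R0 - shell (y j) (4 * r) (r / 2). \<psi> j z = 0"
      "\<forall>z. R0 \<le> norm z \<and> norm z \<le> 2 * R0 \<and> z \<notin> cone_part R0 (ball (y j) (4 * r)) \<longrightarrow> \<psi> j z = 0"
    if "j \<in> ?I" "\<not> shell (y j) (2 * r) r \<subseteq> ball 0 R0" for j
    using bspec[OF cut that(1)] that(2) unfolding shell_cutoff_def by simp_all
  show adm: "admissible (\<psi> i)" if "i \<in> ?I" for i
    unfolding admissible_def
  proof (intro conjI allI impI)
    fix z show "0 \<le> \<psi> i z" using le[OF that] by blast
    assume "\<psi>0 z = 0" then show "\<psi> i z = 0" using le[OF that, of z] by linarith
  qed (rule s[OF that])
  have far: "r < dist (y j) z" if "j \<in> ?I" "R0 < norm z" for j z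
  proof (rule ccontr)
    assume "\<not> r < dist (y j) z"
    then have "z \<in> cball (y j) r" by simp
    moreover have "cball (y j) r \<subseteq> cball 0 R0"
      using closure_mono[OF sub[OF that(1)]] r0 R0 by simp
    ultimately have "z \<in> cball 0 R0" by blast
    then show False using that(2) by simp
  qed
  have far': "r \<le> dist (y j) z" if "j \<in> ?I" "norm z = R0" for j z
  proof (rule ccontr)
    assume "\<not> r \<le> dist (y j) z"
    then have "z \<in> ball (y j) r" by simp
    then have "z \<in> ball 0 R0" by (rule subsetD[OF sub[OF that(1)]])
    then show False using that(2) by simp
  qed
  define M where "M = (if real m \<le> K2 then real m else min K2 (real m - 1))"
  have count: "real (card {j\<in>?I. Q j}) \<le> M" if "real (card {j\<in>?I. Q j}) \<le> K2" for Q
  proof -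
    have "card {j\<in>?I. Q j} \<le> card ?I" by (intro card_mono) auto
    then have "card {j\<in>?I. Q j} \<le> m" by simp
    moreover have "card {j\<in>?I. Q j} \<noteq> m" if "\<not> real m \<le> K2"
      using that \<open>real (card {j\<in>?I. Q j}) \<le> K2\<close> by linarith
    ultimately have "card {j\<in>?I. Q j} \<le> m" "\<not> real m \<le> K2 \<Longrightarrow> card {j\<in>?I. Q j} + 1 \<le> m" by linarith+
    then have "real (card {j\<in>?I. Q j}) \<le> real m" "\<not> real m \<le> K2 \<Longrightarrow> real (card {j\<in>?I. Q j}) \<le> real m - 1"
      by linarith+
    then show ?thesis using that unfolding M_def by (cases "real m \<le> K2") (simp_all only: if_True if_False min.bounded_iff simp_thms)
  qed
  have inner: "\<exists>z\<in>V. (\<exists>i\<in>?I. \<forall>\<^sub>F w in nhds z. \<psi> i w = \<psi>0 w) \<and> real (card {j\<in>?I. \<psi> j z \<noteq> 0}) \<le> M"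
    if V: "open V" "V \<noteq> {}" "V \<subseteq> ball 0 R0" for V
  proof -
    obtain z where z: "z \<in> V" using V(2) by blast
    then have zb: "z \<in> ball 0 R0" using V(3) by blast
    obtain i where i: "i \<in> ?I" "z \<in> shell (y i) (2 * r) r" using subsetD[OF cover zb] by (rule UN_E)
    have "\<forall>\<^sub>F w in nhds z. w \<in> shell (y i) (2 * r) r \<inter> ball 0 R0"
      using i zb by (intro eventually_nhds_in_open open_Int open_shell) auto
    then have "\<forall>\<^sub>F w in nhds z. \<psi> i w = \<psi>0 w"
      by (rule eventually_mono) (use one[OF i(1)] psi0(4) in simp)
    moreover have "{j\<in>?I. \<psi> j z \<noteq> 0} \<subseteq> {j\<in>?I. z \<in> shell (y j) (4 * r) (r / 2)}"
    proof (intro Collect_mono impI conjI; elim conjE)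
      fix j assume j: "j \<in> ?I" "\<psi> j z \<noteq> 0"
      show "z \<in> shell (y j) (4 * r) (r / 2)"
      proof (rule ccontr)
        assume no: "z \<notin> shell (y j) (4 * r) (r / 2)"
        then have "\<not> shell (y j) (2 * r) r \<subseteq> ball 0 R0" using proper[OF j(1) _ j(2)] by (metis (no_types))
        then show False using improper(2)[OF j(1)] no zb j(2) by simp
      qed
    qed
    then have "card {j\<in>?I. \<psi> j z \<noteq> 0} \<le> card {j\<in>?I. z \<in> shell (y j) (4 * r) (r / 2)}" by (intro card_mono) auto
    then have "real (card {j\<in>?I. \<psi> j z \<noteq> 0}) \<le> M" using mult[OF zb] by (intro count) linarith
    ultimately show ?thesis using z i(1) by blast
  qed
  have sph: "sphere 0 R0 \<subseteq> (\<Union>j\<in>?I. cball (y j) (2 * r))"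
  proof (rule sphere_covered[OF R0])
    show "ball 0 R0 \<subseteq> (\<Union>j\<in>?I. cball (y j) (2 * r))"
      by (rule order_trans[OF cover]) (intro UN_mono order_refl, auto simp: shell_def)
  qed simp
  have outer: "\<exists>z\<in>V. (\<exists>i\<in>?I. \<forall>\<^sub>F w in nhds z. \<psi> i w = \<psi>0 w) \<and> real (card {j\<in>?I. \<psi> j z \<noteq> 0}) \<le> M"
    if V: "open V" "V \<noteq> {}" "V \<subseteq> {x. R0 < norm x}" "\<forall>x\<in>V. \<psi>0 x \<noteq> 0" for V
  proof -
    have V2: "norm z < 2 * R0" if "z \<in> V" for z
    proof -
      have "test_function (ball 0 (2 * R0)) \<psi>0" using main by (simp add: main_cutoff_def)
      moreover have "\<psi>0 z \<noteq> 0" using V(4) that by blast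
      ultimately have "z \<in> ball 0 (2 * R0)" by (rule test_function_support)
      then show ?thesis by simp
    qed
    have "y j \<noteq> 0 \<or> 2 * r \<noteq> R0" for j using facts(1) by linarith
    then obtain z i where z: "z \<in> V" "i \<in> ?I" "dir R0 z \<in> ball (y i) (2 * r)"
      using dense_annulus[OF R0 finite_atLeastAtMost _ sph V(1,2,3)] by blast
    have zn: "R0 < norm z" "norm z < 2 * R0" using V(3) V2 z(1) by auto
    let ?z = "dir R0 z"
    note dz = dir[OF R0, of z]
    have dn: "norm ?z = R0" using dz zn by simp
    have imp: "\<not> shell (y i) (2 * r) r \<subseteq> ball 0 R0"
    proof
      assume all: "shell (y i) (2 * r) r \<subseteq> ball 0 R0"
      have "?z \<in> closure {x. R0 < norm x}" using dn by (intro outer_closure[OF R0]) simp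
      then have "ball (y i) (2 * r) \<inter> {x. R0 < norm x} \<noteq> {}"
        using z(3) open_Int_closure_eq_empty[OF open_ball] by blast
      then obtain p where p: "p \<in> ball (y i) (2 * r)" "R0 < norm p" by blast
      then have "p \<in> shell (y i) (2 * r) r" using far[OF z(2)] by (simp add: shell_def)
      then have "p \<in> ball 0 R0" by (rule subsetD[OF all])
      then show False using p(2) by simp
    qed
    have ev: "\<forall>\<^sub>F w in nhds z. \<psi> i w = \<psi>0 w"
    proof (rule equals_psi0_near[OF open_ball zn(1) _ z(3)])
      show "\<psi>0 z \<noteq> 0" using V(4) z(1) by blast
    qed (use improper(1)[OF z(2) imp] in blast)
    have "{j\<in>?I. \<psi> j z \<noteq> 0} \<subseteq> {j\<in>?I. ?z \<in> shell (y j) (4 * r) (r / 2)}"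
    proof (intro Collect_mono impI conjI; elim conjE)
      fix j assume j: "j \<in> ?I" "\<psi> j z \<noteq> 0"
      have "dist (y j) ?z < 4 * r"
      proof (cases "shell (y j) (2 * r) r \<subseteq> ball 0 R0")
        case True
        have "dist (y j) z < 4 * r" using proper[OF j(1) True j(2)] by (simp add: shell_def)
        moreover have "y j \<in> ball 0 R0" by (rule subsetD[OF sub[OF j(1)]]) (use r0 in simp)
        then have "dist (y j) ?z \<le> dist (y j) z"
          using radial_projection_closer[OF dn, of "y j" "norm z / R0"] dz zn by simp
        ultimately show ?thesis by simp
      next
        case False
        have "z \<in> cone_part R0 (ball (y j) (4 * r))"
          using spec[OF improper(3)[OF j(1) False], of z] j(2) zn by simp
        then show ?thesis using cone_part_iff[OF R0, of z] zn by simp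
      qed
      then show "?z \<in> shell (y j) (4 * r) (r / 2)" using far'[OF j(1) dn] r0 by (simp add: shell_def)
    qed
    then have "card {j\<in>?I. \<psi> j z \<noteq> 0} \<le> card {j\<in>?I. ?z \<in> shell (y j) (4 * r) (r / 2)}" (is "?c \<le> ?N")
      by (intro card_mono) auto
    moreover have "real ?N \<le> K2"
    proof (rule multiplicity_on_sphere[OF R0 finite_atLeastAtMost])
      show "open (shell (y j) (4 * r) (r / 2))" for j by (rule open_shell)
      show "?z \<in> sphere 0 R0" using dn by simp
    qed (rule mult)
    ultimately have "real ?c \<le> M" by (intro count) linarith
    then show ?thesis using z ev by blast
  qed
  define S where "S = (\<lambda>z. \<Sum>j\<in>?I. \<psi> j z)"
  note cw = cover_weights[OF finite_atLeastAtMost s le cb r0 order_refl inner outer]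
  have adS: "admissible S" unfolding S_def by (rule cw(1); assumption)
  have S1: "\<psi>0 z \<le> S z" for z unfolding S_def by (rule cw(2); assumption)
  have S2: "S z \<le> M * \<psi>0 z" for z unfolding S_def by (rule cw(3); assumption)
  have Slap: "\<bar>laplacian S z - laplacian \<psi>0 z\<bar> \<le> (M - 1) * (C0 / r\<^sup>2) * \<psi>0 z powr b" if "\<psi>0 z \<noteq> 0" for z
    unfolding S_def by (rule cw(4)) (assumption | rule that)+
  have S3: "S z + R0\<^sup>2 / C0 * \<bar>laplacian S z\<bar>
      \<le> (if R0 \<le> norm z then (M + 1) + (M - 1) * a else M + (M - 1) * a) * \<psi>0 z powr b"
    if "\<psi>0 z \<noteq> 0" for z unfolding S_def a_def by (rule cw(5)) (assumption | rule that)+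
  note fb = flux_bounds[OF adS S1 S2 S3]
  have fS: "flux S = (\<Sum>i=1..m. flux (\<psi> i))" unfolding S_def by (rule flux_sum(2)[OF _ adm]) auto
  have M1: "1 \<le> M" "M \<le> K2" "M \<le> real m" using K2 m5 by (auto simp: M_def)
  have Ma: "(M - 1) * a \<le> real m * M - real m"
  proof -
    have "(M - 1) * a \<le> (M - 1) * real m" using am M1 by (intro mult_left_mono) auto
    then show ?thesis by (simp add: algebra_simps)
  qed
  have mM: "real m * M \<le> real m * K2" using M1 by (intro mult_left_mono) auto
  have nB: "0 < \<nu> * (C0 / R0\<^sup>2)" using nu C0 R0 by simp
  define e where "e = (if real m \<le> K2 then 1 else 0 :: real)"
  have "(M + 1) + (M - 1) * a \<le> real m * K2 + e"
  proof (cases "real m \<le> K2")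
    case True
    then have "e = 1" by (simp add: e_def)
    then show ?thesis using Ma mM M1 by linarith
  next
    case False
    then have "e = 0" "M \<le> real m - 1" by (simp_all add: e_def M_def)
    then show ?thesis using Ma mM by linarith
  qed
  then have 1: "((M + 1) + (M - 1) * a) * E_out \<le> (real m * K2 + e) * E_out"
    using E_bounds by (intro mult_right_mono) auto
  have "M + (M - 1) * a \<le> real m * K2" using Ma mM M1 by linarith
  then have 2: "(M + (M - 1) * a) * (E_tot - E_out) \<le> real m * K2 * (E_tot - E_out)"
    using E_bounds by (intro mult_right_mono) auto
  have err: "(M + (M - 1) * a) * E_tot + ((M + 1) + (M - 1) * a - (M + (M - 1) * a)) * E_out
    \<le> real m * K2 * E_tot + e * E_out" using 1 2 by (simp add: algebra_simps)
  have err': "\<nu> * (C0 / R0\<^sup>2) * ((M + (M - 1) * a) * E_tot + ((M + 1) + (M - 1) * a - (M + (M - 1) * a)) * E_out)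
    \<le> \<nu> * (C0 / R0\<^sup>2) * (real m * K2 * E_tot + e * E_out)"
    using err nB by (intro mult_left_mono) auto
  have "\<nu> * (M * P_tot) \<le> \<nu> * (K2 * P_tot)"
    using nu P_tot_nonneg M1 by (intro mult_left_mono mult_right_mono) auto
  then have "flux S \<le> \<nu> * (K2 * P_tot) + \<nu> * (C0 / R0\<^sup>2) * (real m * K2 * E_tot + e * E_out)"
    using fb(2) err' by linarith
  also have "\<dots> = \<nu> * (K2 * P_tot + C0 / R0\<^sup>2 * (real m * K2 * E_tot + e * E_out))"
    by (simp only: distrib_left mult.assoc)
  also have "e * E_out = (if real m \<le> K2 then E_out else 0)" by (simp add: e_def)
  finally show "(\<Sum>i=1..m. flux (\<psi> i))
      \<le> \<nu> * (K2 * P_tot + C0 / R0\<^sup>2 * (real m * K2 * E_tot + (if real m \<le> K2 then E_out else 0)))"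
    unfolding fS .
  have "\<nu> * P_tot - \<nu> * (C0 / R0\<^sup>2) * (real m * K2 * E_tot) \<le> flux S"
  proof (cases "real m \<le> K2")
    case False
    then have "e = 0" by (simp add: e_def)
    then show ?thesis using fb(1) err' by simp
  next
    case True
    then have M: "M = real m" by (simp add: M_def)
    have "\<nu> * P_tot - \<nu> * C0 / R0\<^sup>2 * (real m)\<^sup>2 * E_tot \<le> flux S"
      unfolding P_tot_def
    proof (rule flux_lower_bound[OF adS])
      show "5 \<le> real m" using m5 by simp
      show "\<psi>0 z \<le> S z" for z by (rule S1)
      show "S z \<le> real m * \<psi>0 z" for z using S2[of z] unfolding M .
      show "\<bar>laplacian S z - laplacian \<psi>0 z\<bar> \<le> C0 / R0\<^sup>2 * (real m * (real m - 1)) * \<psi>0 z powr b"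
        if "\<psi>0 z \<noteq> 0" for z
      proof -
        have "(real m - 1) * (C0 / r\<^sup>2) = C0 / R0\<^sup>2 * (a * (real m - 1))"
          using R0 r0 by (simp add: a_def power_divide)
        also have "\<dots> \<le> C0 / R0\<^sup>2 * (real m * (real m - 1))"
          using am m5 C0 by (intro mult_left_mono mult_right_mono) auto
        finally have "(real m - 1) * (C0 / r\<^sup>2) * \<psi>0 z powr b \<le> C0 / R0\<^sup>2 * (real m * (real m - 1)) * \<psi>0 z powr b"
          by (rule mult_right_mono) simp
        then show ?thesis using Slap[OF that] unfolding M by linarith
      qed
    qed
    moreover have "\<nu> * C0 / R0\<^sup>2 * (real m)\<^sup>2 * E_tot \<le> \<nu> * (C0 / R0\<^sup>2) * (real m * K2 * E_tot)"
    proof -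
      have "real m * real m * E_tot \<le> real m * K2 * E_tot"
        using True E_bounds by (intro mult_right_mono mult_left_mono) auto
      then have "\<nu> * (C0 / R0\<^sup>2) * (real m * real m * E_tot) \<le> \<nu> * (C0 / R0\<^sup>2) * (real m * K2 * E_tot)"
        using nB by (intro mult_left_mono) auto
      then show ?thesis by (simp add: power2_eq_square mult.assoc)
    qed
    ultimately show ?thesis by linarith
  qed
  also have "\<nu> * P_tot - \<nu> * (C0 / R0\<^sup>2) * (real m * K2 * E_tot) = \<nu> * (P_tot - C0 / R0\<^sup>2 * (real m * K2 * E_tot))"
    by (simp only: right_diff_distrib mult.assoc)
  finally show "\<nu> * (P_tot - C0 / R0\<^sup>2 * (real m * K2 * E_tot)) \<le> (\<Sum>i=1..m. flux (\<psi> i))"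
    unfolding fS .
qed

end

section \<open>From the fluxes to the ratio of the averages\<close>

text \<open>The lower bound, and the upper bound when \<open>m > K2\<close>, follow by dividing the flux bounds.  When \<open>m \<le> K2\<close>
  the term \<open>Eo\<close> has to be compensated.  If \<open>as \<le> ab\<close>, the surplus \<open>d\<close> does this; otherwise the balls are larger
  than the smallness assumption for the shells requires, and the unused part of \<open>G P\<close> pays for
  \<open>as - ab\<close>.\<close>

lemma covering_ratio:
  fixes \<nu> P E Eo B K1 K2 G ab as n m Fb Fs d :: real
  assumes pos: "0 < \<nu>" "0 < P" "0 \<le> Eo" "Eo \<le> E" "0 < B" and K: "1 < K1" "2 \<le> K2" and G: "0 < G" "G < 1"
    and n: "1 \<le> ab" "ab \<le> n" "n \<le> K1 * ab" and m: "1 \<le> as" "as \<le> m" "m \<le> K1 * as" "5 \<le> m"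
    and small: "B * K1 * K2 * E * ab \<le> G * P" "B * K1 * K2 * E * as \<le> G * P"
    and d: "0 \<le> d" "5 \<le> K2 \<longrightarrow> ab / (5 * K2) \<le> d"
    and Fb: "\<nu> * (P - B * (n * K2 * E - d * Eo)) \<le> Fb" "Fb \<le> \<nu> * (K2 * P + B * (n * K2 * E))"
    and Fs: "\<nu> * (P - B * (m * K2 * E)) \<le> Fs"
      "Fs \<le> \<nu> * (K2 * P + B * (m * K2 * E + (if m \<le> K2 then Eo else 0)))"
  defines "c0 \<equiv> (1 - G) / K1" and "c1 \<equiv> K2 * (1 + G / (K1 * K2))"
  shows "c0 / c1 * (ab / as) \<le> (Fs / m) / (Fb / n)" "(Fs / m) / (Fb / n) \<le> c1 / c0 * (ab / as)"
proof -
  define X where "X = B * K2 * E"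
  have X0: "0 \<le> X" using pos K by (simp add: X_def)
  have X: "K1 * ab * X \<le> G * P" "K1 * as * X \<le> G * P" using small by (simp_all add: X_def mult_ac)
  have nX: "n * X \<le> G * P" using mult_right_mono[OF n(3) X0] X(1) by linarith
  have mX: "m * X \<le> G * P" using mult_right_mono[OF m(3) X0] X(2) by linarith
  have c1: "c1 = K2 + G / K1" using K by (simp add: c1_def distrib_left)
  have c0p: "0 < c0" and c1p: "0 < c1" using G K unfolding c0_def c1 by (simp_all add: add_pos_pos)
  have K1X: "X \<le> G * P / (K1 * s)" if "1 \<le> s" "K1 * s * X \<le> G * P" for s
    using that K by (simp add: pos_le_divide_eq mult_ac)
  have up: "K2 * P / k + X \<le> c1 * P / s" if "1 \<le> s" "s \<le> k" "K1 * s * X \<le> G * P" for s k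
  proof -
    have "K2 * P / k \<le> K2 * P / s" using that K pos by (intro divide_left_mono) auto
    moreover have "c1 * P / s = K2 * P / s + G * P / (K1 * s)" unfolding c1 using K that(1) by (simp add: field_simps)
    ultimately show ?thesis using K1X[OF that(1,3)] by linarith
  qed
  have low: "c0 * P / s \<le> (1 - G) * P / k" if "1 \<le> s" "0 < k" "k \<le> K1 * s" for s k
  proof -
    have "c0 * P / s = (1 - G) * P / (K1 * s)" unfolding c0_def using K by simp
    also have "\<dots> \<le> (1 - G) * P / k" using that G pos K by (intro divide_left_mono) auto
    finally show ?thesis .
  qed
  define f where "f = P - n * X + B * d * Eo"
  have f: "P - B * (n * K2 * E - d * Eo) = f" by (simp add: f_def X_def algebra_simps)
  have Bd: "0 \<le> B * d * Eo" using pos d by simp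
  have fP: "(1 - G) * P \<le> f" using nX Bd by (simp add: f_def algebra_simps)
  have f0: "0 < f" using fP pos G by (smt (verit) mult_pos_pos)
  have Fb1: "\<nu> * f \<le> Fb" using Fb(1) unfolding f .
  have "0 < \<nu> * f" using pos f0 by simp
  then have Fb0: "0 < Fb / n" using Fb1 n by (intro divide_pos_pos) linarith+
  have Fb2: "Fb / n \<le> \<nu> * (c1 * P / ab)"
  proof -
    have "Fb / n \<le> \<nu> * (K2 * P + n * X) / n" using Fb(2) n by (intro divide_right_mono) (auto simp: X_def mult_ac)
    also have "\<dots> = \<nu> * (K2 * P / n + X)" using n by (simp add: field_simps)
    also have "\<dots> \<le> \<nu> * (c1 * P / ab)" using pos n X by (intro mult_left_mono up) auto
    finally show ?thesis .
  qed
  have Fs1: "\<nu> * (c0 * P / as) \<le> Fs / m"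
  proof -
    have "\<nu> * (c0 * P / as) \<le> \<nu> * ((1 - G) * P / m)" using pos m by (intro mult_left_mono low) auto
    also have "\<dots> \<le> \<nu> * ((P - m * X) / m)"
      using pos m mX by (intro mult_left_mono divide_right_mono) (auto simp: algebra_simps)
    also have "\<dots> = \<nu> * (P - B * (m * K2 * E)) / m" by (simp add: X_def mult_ac)
    also have "\<dots> \<le> Fs / m" using Fs(1) m by (intro divide_right_mono) auto
    finally show ?thesis .
  qed
  have "c0 / c1 * (ab / as) * (Fb / n) \<le> c0 / c1 * (ab / as) * (\<nu> * (c1 * P / ab))"
    using Fb2 c0p c1p n m by (intro mult_left_mono) auto
  also have "\<dots> = \<nu> * (c0 * P / as)" using c1p n by simp
  also note Fs1
  finally show "c0 / c1 * (ab / as) \<le> (Fs / m) / (Fb / n)" using Fb0 by (simp only: pos_le_divide_eq)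
  define q where "q = (if m \<le> K2 then Eo else 0)"
  have Fs2: "Fs / m \<le> \<nu> * (c1 * P / as + B * q / m)"
  proof -
    have "Fs / m \<le> \<nu> * (K2 * P + m * X + B * q) / m"
      using Fs(2) m by (intro divide_right_mono) (auto simp: X_def q_def algebra_simps)
    also have "\<dots> = \<nu> * (K2 * P / m + X + B * q / m)" using m by (simp add: field_simps)
    also have "\<dots> \<le> \<nu> * (c1 * P / as + B * q / m)" using pos m X by (intro mult_left_mono add_right_mono up) auto
    finally show ?thesis .
  qed
  have key: "(1 - G) * (as * (B * q / m)) \<le> c1 * (f - (1 - G) * P)"
  proof (cases "m \<le> K2")
    case False
    then show ?thesis using fP c1p by (simp add: q_def)
  next
    case True
    then have K5: "5 \<le> K2" using m by linarith
    have Y: "0 \<le> B * Eo" using pos by simp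
    have "(1 - G) * (as * (B * q / m)) \<le> 1 * (as * (B * q / m))"
      using G m True Y by (intro mult_right_mono) (auto simp: q_def)
    also have "\<dots> \<le> as * (B * Eo) / 5"
    proof -
      have "as * (B * Eo) / m \<le> as * (B * Eo) / 5" using m Y by (intro divide_left_mono) auto
      then show ?thesis using True by (simp add: q_def)
    qed
    finally have 1: "(1 - G) * (as * (B * q / m)) \<le> as * (B * Eo) / 5" .
    have 2: "ab * (B * Eo) / 5 \<le> K2 * (B * d * Eo)"
    proof -
      have "ab \<le> 5 * (K2 * d)" using d(2) K5 by (simp add: pos_divide_le_eq mult_ac)
      then have "ab * (B * Eo) \<le> 5 * (K2 * d) * (B * Eo)" using Y by (rule mult_right_mono)
      then show ?thesis by (simp add: mult_ac)
    qed
    have 3: "(as - ab) * (B * Eo) / 5 \<le> K2 * (G * P - n * X)"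
    proof (cases "as \<le> ab")
      case True
      then have "(as - ab) * (B * Eo) \<le> 0" using Y by (intro mult_nonpos_nonneg) auto
      moreover have "0 \<le> K2 * (G * P - n * X)" using nX K by simp
      ultimately show ?thesis by linarith
    next
      case False
      have EX: "B * Eo \<le> X"
      proof -
        have "B * Eo * 1 \<le> B * E * K2" using pos K by (intro mult_mono) auto
        then show ?thesis by (simp add: X_def mult_ac)
      qed
      have fifth: "t / 5 \<le> t" if "0 \<le> t" for t :: real using that by simp
      have "(as - ab) * (B * Eo) / 5 \<le> (as - ab) * (B * Eo)"
        by (rule fifth, rule mult_nonneg_nonneg) (use False Y in simp_all)
      also have "\<dots> \<le> 1 * ((as - ab) * X)" using EX False by (simp add: mult_left_mono)
      also have "\<dots> \<le> K1 * ((as - ab) * X)" using K False X0 by (intro mult_right_mono) auto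
      also have "\<dots> \<le> 1 * (G * P - n * X)"
        using X(2) mult_right_mono[OF n(3) X0] by (simp add: algebra_simps)
      also have "\<dots> \<le> K2 * (G * P - n * X)" using nX K by (intro mult_right_mono) auto
      finally show ?thesis .
    qed
    have "f - (1 - G) * P = (G * P - n * X) + B * d * Eo" by (simp add: f_def algebra_simps)
    then have "K2 * (f - (1 - G) * P) = K2 * (G * P - n * X) + K2 * (B * d * Eo)" by (simp add: distrib_left)
    moreover have "as * (B * Eo) / 5 = (as - ab) * (B * Eo) / 5 + ab * (B * Eo) / 5" by (simp add: field_simps)
    ultimately have "(1 - G) * (as * (B * q / m)) \<le> K2 * (f - (1 - G) * P)" using 1 2 3 by linarith
    also have "\<dots> \<le> c1 * (f - (1 - G) * P)" using fP G K unfolding c1 by (intro mult_right_mono) auto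
    finally show ?thesis .
  qed
  have "c1 * P / as + B * q / m \<le> c1 * f / ((1 - G) * as)"
  proof -
    have "(c1 * P / as + B * q / m) * ((1 - G) * as) = (1 - G) * (c1 * P) + (1 - G) * (as * (B * q / m))"
      using m by (simp add: distrib_right)
    also have "\<dots> \<le> c1 * f" using key by (simp add: algebra_simps)
    finally show ?thesis using G m by (simp add: pos_le_divide_eq)
  qed
  then have "\<nu> * (c1 * P / as + B * q / m) \<le> \<nu> * (c1 * f / ((1 - G) * as))" using pos by (intro mult_left_mono) auto
  then have "Fs / m \<le> \<nu> * (c1 * f / ((1 - G) * as))" using Fs2 by linarith
  also have "\<dots> = c1 / c0 * (ab / as) * (\<nu> * f / (K1 * ab))" using n K by (simp add: c0_def)
  also have "\<dots> \<le> c1 / c0 * (ab / as) * (Fb / n)"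
  proof (intro mult_left_mono)
    have "\<nu> * f / (K1 * ab) \<le> \<nu> * f / n" using n K \<open>0 < \<nu> * f\<close> by (intro divide_left_mono) auto
    also have "\<dots> \<le> Fb / n" using Fb1 n by (intro divide_right_mono) auto
    finally show "\<nu> * f / (K1 * ab) \<le> Fb / n" .
  qed (use c0p c1p n m in simp)
  finally show "(Fs / m) / (Fb / n) \<le> c1 / c0 * (ab / as)" using Fb0 by (simp only: pos_divide_le_eq)
qed

context flow
begin

lemma averages:
  shows "E0_avg \<delta> R0 T \<Omega> u (spacetime_cutoff \<eta> \<psi>0) = E_tot / (T * R0\<^sup>2)"
    and "P0_avg R0 T \<Omega> u (spacetime_cutoff \<eta> \<psi>0) = P_tot / (T * R0\<^sup>2)"
proof -
  have "spacetime_integral T \<Omega> (\<lambda>t x. 1/2 * \<bar>vorticity u t x\<bar>\<^sup>2 * spacetime_cutoff \<eta> \<psi>0 t x powr (2 * \<delta> - 1)) = E_tot"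
  proof (subst spacetime_integral_J)
    fix z assume "z \<notin> K"
    then show "1/2 * \<bar>vorticity u (fst z) (snd z)\<bar>\<^sup>2 * spacetime_cutoff \<eta> \<psi>0 (fst z) (snd z) powr (2 * \<delta> - 1) = 0"
      using K_zero[of z] by (auto simp: spacetime_cutoff_def)
  qed (simp add: E_tot_def e_dens_def[abs_def] w_def b_def spacetime_cutoff_def)
  then show "E0_avg \<delta> R0 T \<Omega> u (spacetime_cutoff \<eta> \<psi>0) = E_tot / (T * R0\<^sup>2)" by (simp add: E0_avg_def)
  have "spacetime_integral T \<Omega> (\<lambda>t x. (norm (grad (vorticity u t) x))\<^sup>2 * spacetime_cutoff \<eta> \<psi>0 t x) = P_tot"
  proof (subst spacetime_integral_J)
    fix z assume "z \<notin> K"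
    then show "(norm (grad (vorticity u (fst z)) (snd z)))\<^sup>2 * spacetime_cutoff \<eta> \<psi>0 (fst z) (snd z) = 0"
      using K_zero[of z] by (auto simp: spacetime_cutoff_def)
  next
    have "(norm (grad (vorticity u (fst z)) (snd z)))\<^sup>2 = sq_grad_w z" if "z \<in> K" for z
    proof -
      have "grad (vorticity u (fst z)) (snd z) $ i = D (es i) w z" for i
      proof -
        have "w differentiable (at (fst z, snd z))"
          using smooth_onD(2)[OF vort(2), of z] that K(3) by auto
        moreover have "(\<lambda>y. w (fst z, y)) = vorticity u (fst z)" by (simp add: w_def)
        ultimately show ?thesis using slice_grad[of w "fst z" "snd z" i] by simp
      qed
      then show ?thesis unfolding power2_norm_eq_inner inner_2 by (simp add: power2_eq_square)
    qed
    then show "J (\<lambda>z. (norm (grad (vorticity u (fst z)) (snd z)))\<^sup>2 * spacetime_cutoff \<eta> \<psi>0 (fst z) (snd z)) = P_tot"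
      unfolding P_tot_def spacetime_cutoff_def by (intro J_cong) simp
  qed
  then show "P0_avg R0 T \<Omega> u (spacetime_cutoff \<eta> \<psi>0) = P_tot / (T * R0\<^sup>2)" by (simp add: P0_avg_def)
qed

lemma mean_flux_eq:
  assumes "\<And>i. i \<in> {1..n} \<Longrightarrow> admissible (\<psi> i)"
  shows "mean_flux T \<Omega> u \<eta> n \<psi> = (\<Sum>i=1..n. flux (\<psi> i)) / real n / T"
proof -
  have "(\<Sum>i=1..n. local_flux T \<Omega> u (spacetime_cutoff \<eta> (\<psi> i))) = (\<Sum>i=1..n. 1 / T * flux (\<psi> i))"
    by (intro sum.cong refl local_flux_eq assms)
  then show ?thesis by (simp add: mean_flux_def sum_divide_distrib mult.commute)
qed

end

theorem mainTheorem5: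
  fixes \<nu> R0 \<delta> C0 K1 K2 T \<gamma> c \<sigma>0 R R2 c0\<gamma> c1\<gamma> E0 P0 \<Psi>ball \<Psi>shell :: real
    and \<Omega> :: "(real^2) set"
    and u :: "real \<Rightarrow> real^2 \<Rightarrow> real^2"
    and p :: "real \<Rightarrow> real^2 \<Rightarrow> real"
    and \<eta> :: "real \<Rightarrow> real"
    and \<psi>0 :: "real^2 \<Rightarrow> real"
    and \<phi>0 :: "real \<Rightarrow> real^2 \<Rightarrow> real"
    and n m :: nat
    and x y :: "nat \<Rightarrow> real^2"
    and \<psi>b \<psi>s :: "nat \<Rightarrow> real^2 \<Rightarrow> real"
  assumes "\<nu> > 0"
    and "open \<Omega>" "connected \<Omega>" "bounded \<Omega>"
    and "R0 > 0" "ball 0 (3 * R0) \<subseteq> \<Omega>"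
    and "NSE_solution \<nu> \<Omega> u p"
    and "1/2 \<le> \<delta>" "\<delta> < 1" "C0 > 0" "K1 > 1" "K2 > 1"
    and "main_cutoff \<delta> C0 R0 \<psi>0"
    and "time_cutoff \<delta> C0 T \<eta>"
    and "\<phi>0 = spacetime_cutoff \<eta> \<psi>0"
    and "E0 = E0_avg \<delta> R0 T \<Omega> u \<phi>0"
    and "P0 = P0_avg R0 T \<Omega> u \<phi>0"
    and "P0 > 0"
    and "\<sigma>0 = sqrt (E0 / P0)"
    and "c = 1 / sqrt (C0 * K1 * K2)"
    and "0 < \<gamma>" "\<gamma> < 1"
    and "T \<ge> R0\<^sup>2 / \<nu>"
    and "\<sigma>0 < c * \<gamma> * R0"
    and "R \<in> {1 / (c * \<gamma>) * \<sigma>0 .. R0}"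
    and "R2 \<in> {1 / (c * \<gamma>) * \<sigma>0 .. R0}"
    and "optimal_ball_covering K1 K2 R0 R n x"
    and "\<forall>i\<in>{1..n}. ball_cutoff \<delta> C0 R0 \<psi>0 (x i) R (\<psi>b i)"
    and "optimal_shell_covering K1 K2 R0 R2 m y"
    and "\<forall>i\<in>{1..m}. shell_cutoff \<delta> C0 R0 \<psi>0 (y i) R2 (\<psi>s i)"
    and "\<Psi>ball = mean_flux T \<Omega> u \<eta> n \<psi>b"
    and "\<Psi>shell = mean_flux T \<Omega> u \<eta> m \<psi>s"
    and "c0\<gamma> = (1 - \<gamma>\<^sup>2) / K1"
    and "c1\<gamma> = K2 * (1 + \<gamma>\<^sup>2 / (K1 * K2))"
  shows "(c0\<gamma> / c1\<gamma> * (R2 / R)\<^sup>2 \<le> \<Psi>shell / \<Psi>ball \<and>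
          \<Psi>shell / \<Psi>ball \<le> c1\<gamma> / c0\<gamma> * (R2 / R)\<^sup>2) \<and>
         (\<forall>k::int. R2 = 2 powi k * R \<longrightarrow>
            c0\<gamma> / c1\<gamma> * 2 powi (2 * k) \<le> \<Psi>shell / \<Psi>ball \<and>
            \<Psi>shell / \<Psi>ball \<le> c1\<gamma> / c0\<gamma> * 2 powi (2 * k))"
proof -
  interpret flow \<nu> R0 \<delta> C0 T \<Omega> u p \<eta> \<psi>0
    by unfold_locales (use assms in auto)
  have R: "R \<le> R0" "1 / (c * \<gamma>) * \<sigma>0 \<le> R" and R2: "R2 \<le> R0" "1 / (c * \<gamma>) * \<sigma>0 \<le> R2" using assms(25,26) by auto
  note sh = shell_cover_flux[OF assms(29,30)]
  have K2: "2 \<le> K2" by (rule sh(3))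
  note ba = ball_cover_flux[OF R(1) assms(27) K2 assms(28)]
  obtain D where D: "0 \<le> D" "5 \<le> K2 \<longrightarrow> (R0 / R)\<^sup>2 / (5 * K2) \<le> D"
    "\<nu> * (P_tot - C0 / R0\<^sup>2 * (real n * K2 * E_tot - D * E_out)) \<le> (\<Sum>i=1..n. flux (\<psi>b i))"
    "(\<Sum>i=1..n. flux (\<psi>b i)) \<le> \<nu> * (K2 * P_tot + C0 / R0\<^sup>2 * (real n * K2 * E_tot))"
    using ba(4) by blast
  have RP: "0 < R" "0 < R2" by (rule ba(1)) (rule sh(1))
  have TR: "0 < T * R0\<^sup>2" using T_pos R0 by simp
  have E0: "E0 = E_tot / (T * R0\<^sup>2)" and P0: "P0 = P_tot / (T * R0\<^sup>2)"
    unfolding assms(15,16,17) by (rule averages)+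
  have P: "0 < P_tot" using assms(18) TR unfolding P0 by (simp add: zero_less_divide_iff)
  have EP: "E0 / P0 = E_tot / P_tot" unfolding E0 P0 using T_pos R0 by simp
  have E: "0 \<le> E_tot" using E_bounds by linarith
  have small: "C0 / R0\<^sup>2 * K1 * K2 * E_tot * (R0 / r)\<^sup>2 \<le> \<gamma>\<^sup>2 * P_tot"
    if r: "0 < r" "1 / (c * \<gamma>) * \<sigma>0 \<le> r" for r
  proof -
    have k: "0 < C0 * K1 * K2" using C0 assms(11,12) by simp
    then have c: "0 < c" "c\<^sup>2 = 1 / (C0 * K1 * K2)" using assms(20) by (simp_all add: power_divide)
    have cg: "0 < c * \<gamma>" using c assms(21) by simp
    have "\<sigma>0 \<le> c * \<gamma> * r"
    proof -
      have "\<sigma>0 / (c * \<gamma>) \<le> r" using r(2) by simp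
      then show ?thesis using cg by (simp only: pos_divide_le_eq mult.commute)
    qed
    moreover have "0 \<le> \<sigma>0" unfolding assms(19) EP using E P by simp
    ultimately have "\<sigma>0\<^sup>2 \<le> (c * \<gamma> * r)\<^sup>2" by (rule power_mono)
    moreover have "\<sigma>0\<^sup>2 = E_tot / P_tot" unfolding assms(19) EP using E P by simp
    ultimately have "E_tot / P_tot \<le> \<gamma>\<^sup>2 * r\<^sup>2 / (C0 * K1 * K2)" using c by (simp add: power_mult_distrib)
    then have "E_tot * (C0 * K1 * K2) \<le> \<gamma>\<^sup>2 * r\<^sup>2 * P_tot"
      using P k by (simp add: pos_divide_le_eq pos_le_divide_eq mult_ac)
    then have "E_tot * (C0 * K1 * K2) / r\<^sup>2 \<le> \<gamma>\<^sup>2 * P_tot" using r(1) by (simp add: pos_divide_le_eq mult_ac)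
    moreover have "C0 / R0\<^sup>2 * K1 * K2 * E_tot * (R0 / r)\<^sup>2 = E_tot * (C0 * K1 * K2) / r\<^sup>2"
      using R0 by (simp add: power_divide)
    ultimately show ?thesis by simp
  qed
  have n: "(R0 / R)\<^sup>2 \<le> real n" "real n \<le> K1 * (R0 / R)\<^sup>2"
    using assms(27) by (simp_all add: optimal_ball_covering_def)
  have m: "(R0 / R2)\<^sup>2 \<le> real m" "real m \<le> K1 * (R0 / R2)\<^sup>2"
    using assms(29) by (simp_all add: optimal_shell_covering_def)
  have a2: "1 \<le> (R0 / R2)\<^sup>2"
  proof -
    have "1 \<le> R0 / R2" using RP R2 by (simp add: pos_le_divide_eq)
    then have "1\<^sup>2 \<le> (R0 / R2)\<^sup>2" by (intro power_mono) auto
    then show ?thesis by simp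
  qed
  have gam: "0 < \<gamma>\<^sup>2" "\<gamma>\<^sup>2 < 1" using assms(21,22) by (simp_all add: power_less_one_iff)
  have m5: "5 \<le> real m" using sh(2) by simp
  have B: "0 < C0 / R0\<^sup>2" using C0 R0 by simp
  note ratio = covering_ratio[OF nu P E_bounds B assms(11) K2 gam ba(2) n a2 m m5 small[OF RP(1) R(2)]
      small[OF RP(2) R2(2)] D sh(5,6), folded assms(33,34)]
  have "\<Psi>shell / \<Psi>ball = ((\<Sum>i=1..m. flux (\<psi>s i)) / real m) / ((\<Sum>i=1..n. flux (\<psi>b i)) / real n)"
    unfolding assms(31,32) using mean_flux_eq[OF sh(4)] mean_flux_eq[OF ba(3)] T_pos by simp
  moreover have "(R0 / R)\<^sup>2 / (R0 / R2)\<^sup>2 = (R2 / R)\<^sup>2" using R0 RP by (simp add: power_divide)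
  ultimately have main: "c0\<gamma> / c1\<gamma> * (R2 / R)\<^sup>2 \<le> \<Psi>shell / \<Psi>ball" "\<Psi>shell / \<Psi>ball \<le> c1\<gamma> / c0\<gamma> * (R2 / R)\<^sup>2"
    using ratio by simp_all
  have "(R2 / R)\<^sup>2 = 2 powi (2 * k)" if "R2 = 2 powi k * R" for k :: int
  proof -
    have "R2 / R = 2 powi k" using that RP by simp
    then show ?thesis by (simp add: power_int_mult mult.commute[of 2 k])
  qed
  then show ?thesis using main by (intro conjI allI impI) (metis main)+
qed

end
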